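(* Let $m,n\ge 1$ be integers, let $\boldsymbol{k}=(k_1,\ldots,k_m)$ with $1\le k_i\le n$ for all $i$, and let $f:\boldsymbol{\Lambda^k}=\prod_{i=1}^m\Lambda^{k_i}(\mathbb{R}^n)\to\mathbb{R}$. The following statements are equivalent. (i) $f$ is vectorially ext. polyaffine. (ii) $f$ is vectorially ext. quasiaffine. (iii) $f$ is vectorially ext. one affine. (iv) There exist $c_{\boldsymbol{\alpha}}\in\Lambda^{|\boldsymbol{k\alpha}|}(\mathbb{R}^n)$, for every $\boldsymbol{\alpha}=(\alpha_1,\ldots,\alpha_m)$ with $0\le\alpha_i\le[n/k_i]$ for all $1\le i\le m$ and $0\le|\boldsymbol{k\alpha}|\le n$, such that for every $\boldsymbol{\xi}\in\boldsymbol{\Lambda^k}$, $$f(\boldsymbol{\xi})=\sum_{\boldsymbol{\alpha},\ 0\le|\boldsymbol{k\alpha}|\le n}\langle c_{\boldsymbol{\alpha}};\boldsymbol{\xi^\alpha}\rangle.$$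
   Context: $\Lambda^k=\Lambda^k(\mathbb{R}^n)$ is the space of alternating $k$-linear forms on $\mathbb{R}^n$, with its usual scalar product $\langle\cdot\,;\cdot\rangle$. For $\boldsymbol{\xi}=(\xi_1,\ldots,\xi_m)\in\boldsymbol{\Lambda^k}$ and a multiindex $\boldsymbol{\alpha}=(\alpha_1,\ldots,\alpha_m)$ of integers with $0\le\alpha_i\le[n/k_i]$, put $|\boldsymbol{k\alpha}|=\sum_i k_i\alpha_i$ and, when $|\boldsymbol{k\alpha}|\le n$, $\boldsymbol{\xi^\alpha}=\xi_1^{\alpha_1}\wedge\cdots\wedge\xi_m^{\alpha_m}\in\Lambda^{|\boldsymbol{k\alpha}|}$, where $\xi_i^{\alpha_i}$ is the $\alpha_i$-fold wedge power (absent if $\alpha_i=0$; $\boldsymbol{\xi}^{\boldsymbol{0}}=1\in\Lambda^0=\mathbb{R}$). Definitions, for $f:\boldsymbol{\Lambda^k}\to\mathbb{R}$: - $f$ is vectorially ext. one affine if $t\mapsto f(\xi_1+t\,\alpha\wedge\beta_1,\ldots,\xi_m+t\,\alpha\wedge\beta_m)$ is affine on $\mathbb{R}$ for all $\xi_i\in\Lambda^{k_i}$, $\alpha\in\Lambda^1$, $\beta_i\in\Lambda^{k_i-1}$. - $f$ is vectorially ext. quasiaffine if it is Borel measurable, locally bounded and, for every bounded open set $\Omega\subset\mathbb{R}^n$, every $\xi_i\in\Lambda^{k_i}$ and every $\omega_i\in W^{1,\infty}_0(\Omega;\Lambda^{k_i-1})$, $\frac{1}{|\Omega|}\int_\Omega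 f(\xi_1+d\omega_1(x),\ldots,\xi_m+d\omega_m(x))\,dx=f(\xi_1,\ldots,\xi_m)$. - $f$ is vectorially ext. polyaffine if there is an affine function $F$ with $f(\boldsymbol{\xi})=F(T(\boldsymbol{\xi}))$ for all $\boldsymbol{\xi}$, where $T(\boldsymbol{\xi})$ is the vector whose components are all $\boldsymbol{\xi^\alpha}$ with $1\le|\boldsymbol{k\alpha}|\le n$. *)

theory Defs
  imports "HOL-Analysis.Analysis" "HOL-Combinatorics.Permutations"
begin

section \<open>The exterior algebra of \<open>real ^ 'n\<close>\<close>

text \<open>A \<open>k\<close>-form is a real function of \<open>k\<close> vectors, the vectors being passed as a list of length
  \<open>k\<close>. An element of the type below contains one alternating multilinear form for each list length;
  since forms of degree larger than \<open>CARD('n)\<close> vanish, the type is the direct sum of the spaces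
  \<open>\<Lambda>\<^sup>k(\<real>\<^sup>n)\<close>, \<open>0 \<le> k \<le> n\<close>. The individual summands are the sets \<open>Lambda k\<close> below.\<close>

definition alternating_multilinear :: "((real ^ 'n::finite) list \<Rightarrow> real) \<Rightarrow> bool" where
  "alternating_multilinear \<omega> \<longleftrightarrow>
     (\<forall>us vs. linear (\<lambda>v. \<omega> (us @ v # vs))) \<and> (\<forall>vs. \<not> distinct vs \<longrightarrow> \<omega> vs = 0)"

typedef (overloaded) ('n::finite) form = "{\<omega> :: (real ^ 'n) list \<Rightarrow> real. alternating_multilinear \<omega>}"
  morphisms form_app Abs_form
  by (rule exI[of _ "\<lambda>_. 0"]) (simp add: alternating_multilinear_def linear_zero)

setup_lifting type_definition_form

lemma form_eqI: "(\<And>vs. form_app \<omega> vs = form_app \<eta> vs) \<Longrightarrow> \<omega> = \<eta>"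
  by (metis ext form_app_inject)

lemma form_app_linear: "linear (\<lambda>v. form_app \<omega> (us @ v # vs))"
  using form_app[of \<omega>] by (simp add: alternating_multilinear_def)

lemma form_app_not_distinct: "\<not> distinct vs \<Longrightarrow> form_app \<omega> vs = 0"
  using form_app[of \<omega>] by (simp add: alternating_multilinear_def)

lemma linear_mult_left:
  fixes f :: "'a::real_vector \<Rightarrow> real"
  shows "linear f \<Longrightarrow> linear (\<lambda>v. c * f v)"
  using linear_compose_scale_right[of f c] by simp

instantiation form :: (finite) real_vector
begin

lift_definition zero_form :: "'a form" is "\<lambda>_. 0"
  by (simp add: alternating_multilinear_def linear_zero)

lift_definition plus_form :: "'a form \<Rightarrow> 'a form \<Rightarrow> 'a form" is "\<lambda>\<omega> \<eta> vs. \<omega> vs + \<eta> vs"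
  by (simp add: alternating_multilinear_def linear_compose_add)

lift_definition uminus_form :: "'a form \<Rightarrow> 'a form" is "\<lambda>\<omega> vs. - \<omega> vs"
  by (simp add: alternating_multilinear_def linear_compose_neg)

lift_definition minus_form :: "'a form \<Rightarrow> 'a form \<Rightarrow> 'a form" is "\<lambda>\<omega> \<eta> vs. \<omega> vs - \<eta> vs"
  by (simp add: alternating_multilinear_def linear_compose_sub)

lift_definition scaleR_form :: "real \<Rightarrow> 'a form \<Rightarrow> 'a form" is "\<lambda>c \<omega> vs. c * \<omega> vs"
  by (auto simp: alternating_multilinear_def intro: linear_mult_left)

instance
  by standard (transfer; simp add: fun_eq_iff algebra_simps)+

end

lemmas form_app_simps [simp] =
  zero_form.rep_eq plus_form.rep_eq uminus_form.rep_eq minus_form.rep_eq scaleR_form.rep_eq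

lemma form_app_sum: "form_app (\<Sum>i\<in>I. \<omega> i) vs = (\<Sum>i\<in>I. form_app (\<omega> i) vs)"
  by (induction I rule: infinite_finite_induct) auto

definition Lambda :: "nat \<Rightarrow> 'n::finite form set" where
  "Lambda k = {\<omega>. \<forall>vs. length vs \<noteq> k \<longrightarrow> form_app \<omega> vs = 0}"

subsection \<open>Scalar product\<close>

definition basis_vecs :: "'n list \<Rightarrow> (real ^ 'n::finite) list" where
  "basis_vecs is = map (\<lambda>i. axis i 1) is"

lemma form_eq_0I:
  assumes "\<And>is. distinct is \<Longrightarrow> form_app \<omega> (basis_vecs is) = 0"
  shows "\<omega> = (0 :: 'n::finite form)"
proof (rule form_eqI)
  fix vs
  have "form_app \<omega> (basis_vecs is @ vs) = 0" for "is"
  proof (induction vs arbitrary: "is")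
    case Nil
    show ?case
    proof (cases "distinct is")
      case False
      then have "\<not> distinct (basis_vecs is :: (real^'n) list)"
        by (simp add: basis_vecs_def distinct_map)
      then show ?thesis by (simp add: form_app_not_distinct)
    qed (simp add: assms)
  next
    case (Cons v vs)
    interpret linear "\<lambda>v. form_app \<omega> (basis_vecs is @ v # vs)" by (rule form_app_linear)
    have "form_app \<omega> (basis_vecs is @ v # vs)
        = form_app \<omega> (basis_vecs is @ (\<Sum>i\<in>UNIV. (v $ i) *\<^sub>R axis i 1) # vs)"
      using basis_expansion[of v] by (simp add: scalar_mult_eq_scaleR)
    also have "\<dots> = (\<Sum>i\<in>UNIV. v $ i * form_app \<omega> (basis_vecs is @ axis i 1 # vs))"
      by (simp add: sum scale)
    also have "\<dots> = (\<Sum>i\<in>UNIV. v $ i * form_app \<omega> (basis_vecs (is @ [i]) @ vs))"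
      by (simp add: basis_vecs_def)
    finally show ?case using Cons.IH by simp
  qed
  from this[of "[]"] show "form_app \<omega> vs = form_app 0 vs" by (simp add: basis_vecs_def)
qed

lemma finite_distinct_lists: "finite {is :: 'n::finite list. distinct is}"
  using finite_subset_distinct[of "UNIV :: 'n set"] by simp

instantiation form :: (finite) real_inner
begin

text \<open>The sum over the strictly increasing multiindices, written as a sum over all orderings of
  each of them and divided by the number of orderings. No order on the index type is needed.\<close>

definition inner_form :: "'a form \<Rightarrow> 'a form \<Rightarrow> real" where
  "inner_form \<omega> \<eta> = (\<Sum>is | distinct is.
     form_app \<omega> (basis_vecs is) * form_app \<eta> (basis_vecs is) / fact (length is))"

definition norm_form :: "'a form \<Rightarrow> real" where "norm_form \<omega> = sqrt (inner \<omega> \<omega>)"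

definition sgn_form :: "'a form \<Rightarrow> 'a form" where "sgn_form \<omega> = \<omega> /\<^sub>R norm \<omega>"

definition dist_form :: "'a form \<Rightarrow> 'a form \<Rightarrow> real" where "dist_form \<omega> \<eta> = norm (\<omega> - \<eta>)"

definition uniformity_form :: "('a form \<times> 'a form) filter" where
  "uniformity_form = (INF e\<in>{0<..}. principal {(x, y). dist x y < e})"

definition open_form :: "'a form set \<Rightarrow> bool" where
  "open_form U \<longleftrightarrow> (\<forall>x\<in>U. \<forall>\<^sub>F (x', y) in uniformity. x' = x \<longrightarrow> y \<in> U)"

instance
proof
  fix x y z :: "'a form" and r :: real
  show "inner x y = inner y x" by (simp add: inner_form_def mult.commute)
  show "inner (x + y) z = inner x z + inner y z"
    by (simp add: inner_form_def algebra_simps add_divide_distrib sum.distrib)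
  show "inner (r *\<^sub>R x) y = r * inner x y"
    by (simp add: inner_form_def sum_distrib_left mult.assoc)
  show "0 \<le> inner x x" by (simp add: inner_form_def sum_nonneg)
  show "inner x x = 0 \<longleftrightarrow> x = 0"
  proof
    assume "inner x x = 0"
    then have "\<forall>is\<in>{is. distinct is}. form_app x (basis_vecs is) * form_app x (basis_vecs is)
        / fact (length is) = 0"
      unfolding inner_form_def by (subst (asm) sum_nonneg_eq_0_iff) (auto simp: finite_distinct_lists)
    then show "x = 0" by (intro form_eq_0I) auto
  qed (simp add: inner_form_def)
qed (simp_all add: norm_form_def sgn_form_def dist_form_def uniformity_form_def open_form_def)

end

subsection \<open>Exterior product\<close>

lemma alternating_permute_sum:
  fixes h :: "(real ^ 'n::finite) list \<Rightarrow> real"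
  assumes "\<not> distinct vs"
  shows "(\<Sum>\<sigma> | \<sigma> permutes {..<length vs}. of_int (sign \<sigma>) * h (permute_list \<sigma> vs)) = 0"
    (is "sum ?g ?P = 0")
proof -
  obtain a b where ab: "a < length vs" "b < length vs" "a \<noteq> b" "vs ! a = vs ! b"
    using assms by (auto simp: distinct_conv_nth)
  let ?t = "Transposition.transpose a b"
  have t: "?t permutes {..<length vs}" using ab by (intro permutes_swap_id) auto
  have vs: "permute_list ?t vs = vs"
    using ab t by (intro nth_equalityI) (auto simp: permute_list_nth Transposition.transpose_def)
  have "sum ?g ?P = (\<Sum>\<sigma>\<in>?P. ?g (?t \<circ> \<sigma>))"
    using setum_permutations_compose_left[OF t] by (simp add: o_def)
  also have "\<dots> = (\<Sum>\<sigma>\<in>?P. - ?g \<sigma>)"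
  proof (rule sum.cong[OF refl])
    fix \<sigma> assume "\<sigma> \<in> ?P"
    then have s: "\<sigma> permutes {..<length vs}" by simp
    have "sign (?t \<circ> \<sigma>) = - sign \<sigma>"
    proof (subst sign_compose)
      show "permutation ?t" by (rule permutation_swap_id)
      show "permutation \<sigma>" using s by (rule permutes_imp_permutation[rotated]) simp
    qed (use ab in \<open>simp add: sign_swap_id\<close>)
    moreover have "permute_list (?t \<circ> \<sigma>) vs = permute_list \<sigma> vs"
      using permute_list_compose[OF s, of ?t] vs by simp
    ultimately show "?g (?t \<circ> \<sigma>) = - ?g \<sigma>" by simp
  qed
  finally show ?thesis by (simp add: sum_negf)
qed

lemma form_app_update_linear:
  assumes "p < length xs"
  shows "linear (\<lambda>v. form_app \<omega> (xs[p := v]))"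
  using form_app_linear[of \<omega> "take p xs" "drop (Suc p) xs"] assms
  by (simp add: upd_conv_take_nth_drop)

lemma wedge_term_linear:
  assumes "p < length xs"
  shows "linear (\<lambda>v. form_app \<omega> (take k (xs[p := v])) * form_app \<eta> (drop k (xs[p := v])))"
proof (cases "p < k")
  case True
  then have "linear (\<lambda>v. form_app \<omega> ((take k xs)[p := v]))"
    using assms by (intro form_app_update_linear) simp
  from linear_compose_scale_right[OF this, of "form_app \<eta> (drop k xs)"] show ?thesis
    using True by (simp add: take_update_swap mult.commute)
next
  case False
  then have "linear (\<lambda>v. form_app \<eta> ((drop k xs)[p - k := v]))"
    using assms by (intro form_app_update_linear) simp
  from linear_compose_scale_right[OF this, of "form_app \<omega> (take k xs)"] show ?thesis
    using False by (simp add: drop_update_swap)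
qed

text \<open>For a \<open>k\<close>-form \<open>\<omega>\<close> and an \<open>l\<close>-form \<open>\<eta>\<close> only the \<open>k\<close>-th summand is nonzero, and on \<open>k + l\<close> vectors
  the definition reads \<open>1/(k! l!) \<Sum>\<^sub>\<sigma> sign \<sigma> \<omega>(v\<^sub>\<sigma>\<^sub>(\<^sub>1\<^sub>), \<dots>, v\<^sub>\<sigma>\<^sub>(\<^sub>k\<^sub>)) \<eta>(v\<^sub>\<sigma>\<^sub>(\<^sub>k\<^sub>+\<^sub>1\<^sub>), \<dots>, v\<^sub>\<sigma>\<^sub>(\<^sub>k\<^sub>+\<^sub>l\<^sub>))\<close>.\<close>

lift_definition wedge :: "'n::finite form \<Rightarrow> 'n form \<Rightarrow> 'n form" (infixr \<open>\<and>\<^sub>\<Lambda>\<close> 75) is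
  "\<lambda>\<omega> \<eta> vs. \<Sum>k\<le>length vs. (\<Sum>\<sigma> | \<sigma> permutes {..<length vs}. of_int (sign \<sigma>) *
      (\<omega> (take k (permute_list \<sigma> vs)) * \<eta> (drop k (permute_list \<sigma> vs))))
      / (fact k * fact (length vs - k))"
proof -
  fix \<omega> \<eta> :: "(real ^ 'n) list \<Rightarrow> real"
  assume "alternating_multilinear \<omega>" "alternating_multilinear \<eta>"
  then obtain \<omega>' \<eta>' where app: "\<omega> = form_app \<omega>'" "\<eta> = form_app \<eta>'"
    by (metis Abs_form_inverse mem_Collect_eq)
  let ?w = "\<lambda>vs. \<Sum>k\<le>length vs. (\<Sum>\<sigma> | \<sigma> permutes {..<length vs}. of_int (sign \<sigma>) *
      (\<omega> (take k (permute_list \<sigma> vs)) * \<eta> (drop k (permute_list \<sigma> vs))))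
      / (fact k * fact (length vs - k))"
  show "alternating_multilinear ?w"
    unfolding alternating_multilinear_def
  proof (intro conjI allI impI)
    fix vs :: "(real ^ 'n) list" assume "\<not> distinct vs"
    then show "?w vs = 0"
      using alternating_permute_sum[of vs "\<lambda>xs. \<omega> (take k xs) * \<eta> (drop k xs)" for k] by simp
  next
    fix us vs :: "(real ^ 'n) list"
    let ?N = "Suc (length us + length vs)"
    have *: "linear (\<lambda>v. \<omega> (take k (permute_list \<sigma> (us @ v # vs)))
                       * \<eta> (drop k (permute_list \<sigma> (us @ v # vs))))"
      if \<sigma>: "\<sigma> permutes {..<?N}" for k \<sigma>
    proof -
      define p where "p = inv \<sigma> (length us)"
      define xs where "xs = permute_list \<sigma> (us @ 0 # vs)"
      have p: "p < length xs"
        using permutes_in_image[OF permutes_inv[OF \<sigma>], of "length us"] by (simp add: p_def xs_def)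
      have "permute_list \<sigma> (us @ v # vs) = xs[p := v]" for v
      proof (rule nth_equalityI)
        fix i assume "i < length (permute_list \<sigma> (us @ v # vs))"
        then have i: "i < ?N" by simp
        have "\<sigma> i = length us \<longleftrightarrow> i = p"
          using \<sigma> unfolding p_def by (metis permutes_inverses)
        then show "permute_list \<sigma> (us @ v # vs) ! i = xs[p := v] ! i"
          using i \<sigma> p by (auto simp: xs_def permute_list_nth nth_list_update nth_append nth_Cons')
      qed (simp add: xs_def)
      then show ?thesis using wedge_term_linear[OF p] by (simp add: app)
    qed
    show "linear (\<lambda>v. ?w (us @ v # vs))"
      unfolding divide_inverse mult.commute[of _ "inverse _"] length_append list.size(4)
        One_nat_def add_Suc_right add_0_right
      by (intro linear_compose_sum ballI linear_mult_left *) simp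
  qed
qed

lift_definition one_form :: "'n::finite form" is "\<lambda>vs. if vs = [] then 1 else 0"
  by (simp add: alternating_multilinear_def linear_zero)

lift_definition dx :: "'n \<Rightarrow> 'n::finite form" is
  "\<lambda>i vs. if length vs = 1 then hd vs $ i else 0"
proof -
  fix i :: 'n
  have lin: "linear (\<lambda>v :: real ^ 'n. v $ i)" by (simp add: linear_iff)
  show "alternating_multilinear (\<lambda>vs. if length vs = 1 then hd vs $ i else 0)"
    unfolding alternating_multilinear_def
  proof (intro conjI allI impI)
    fix us vs :: "(real ^ 'n) list"
    show "linear (\<lambda>v. if length (us @ v # vs) = 1 then hd (us @ v # vs) $ i else 0)"
      using lin by (cases us; cases vs) (simp_all add: linear_zero)
  qed (auto simp: length_Suc_conv)
qed

subsection \<open>Euclidean structure\<close>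

lemma finite_span_of_functionals:
  fixes S :: "'a::real_vector set"
  assumes "finite F" "\<forall>\<phi>\<in>F. linear (\<phi> :: 'a \<Rightarrow> real)" "subspace S"
    and "\<And>x. x \<in> S \<Longrightarrow> \<forall>\<phi>\<in>F. \<phi> x = 0 \<Longrightarrow> x = 0"
  shows "\<exists>B. finite B \<and> S \<subseteq> span B"
  using assms
proof (induction F arbitrary: S rule: finite_induct)
  case empty
  then show ?case by (intro exI[of _ "{}"]) auto
next
  case (insert \<phi> F)
  interpret linear \<phi> using insert.prems by simp
  have "subspace (S \<inter> {x. \<phi> x = 0})"
    using insert.prems(2) by (intro subspace_inter linear_subspace_kernel linear_axioms) simp_all
  moreover have "x = 0" if "x \<in> S \<inter> {x. \<phi> x = 0}" "\<forall>\<psi>\<in>F. \<psi> x = 0" for x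
    using insert.prems(3) that by auto
  ultimately obtain B where B: "finite B" "S \<inter> {x. \<phi> x = 0} \<subseteq> span B"
    using insert.IH[of "S \<inter> {x. \<phi> x = 0}"] insert.prems(1) by blast
  show ?case
  proof (cases "\<exists>x0\<in>S. \<phi> x0 \<noteq> 0")
    case True
    then obtain x0 where x0: "x0 \<in> S" "\<phi> x0 \<noteq> 0" by blast
    have "x \<in> span (insert x0 B)" if "x \<in> S" for x
    proof -
      have "x - (\<phi> x / \<phi> x0) *\<^sub>R x0 \<in> S \<inter> {x. \<phi> x = 0}"
        using that x0 insert.prems(2) by (simp add: subspace_diff subspace_scale diff scale)
      then show ?thesis using B(2) unfolding span_insert by blast
    qed
    then show ?thesis using B(1) by (intro exI[of _ "insert x0 B"]) auto
  qed (use B in auto)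
qed

lemma ex_orthonormal_form_basis:
  "\<exists>B :: 'n::finite form set. B \<noteq> {} \<and> finite B
     \<and> (\<forall>u\<in>B. \<forall>v\<in>B. inner u v = (if u = v then 1 else 0))
     \<and> (\<forall>x. (\<forall>u\<in>B. inner x u = 0) \<longleftrightarrow> x = 0)"
proof -
  let ?F = "(\<lambda>is \<omega> :: 'n form. form_app \<omega> (basis_vecs is)) ` {is. distinct is}"
  have "finite ?F" by (simp add: finite_distinct_lists)
  moreover have "\<forall>\<phi>\<in>?F. linear \<phi>" by (auto intro!: linearI)
  moreover have "x = 0" if "\<forall>\<phi>\<in>?F. \<phi> x = 0" for x using that by (intro form_eq_0I) auto
  ultimately obtain B where "finite B" "span B = (UNIV :: 'n form set)"
    using finite_span_of_functionals[of ?F UNIV] by auto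
  then obtain C where C: "finite C" "span C = (UNIV :: 'n form set)" "pairwise orthogonal C"
    using basis_orthogonal[of B] by auto
  define D where "D = (\<lambda>x. x /\<^sub>R norm x) ` (C - {0})"
  have unit: "inner (x /\<^sub>R norm x) (x /\<^sub>R norm x) = 1" if "x \<noteq> 0" for x :: "'n form"
    using that by (simp add: dot_square_norm power2_eq_square)
  have ortho: "inner u v = (if u = v then 1 else 0)" if uv: "u \<in> D" "v \<in> D" for u v
  proof -
    obtain x where x: "x \<in> C" "x \<noteq> 0" "u = x /\<^sub>R norm x" using uv(1) by (auto simp: D_def)
    obtain y where y: "y \<in> C" "y \<noteq> 0" "v = y /\<^sub>R norm y" using uv(2) by (auto simp: D_def)
    show ?thesis
    proof (cases "x = y")
      case True
      then show ?thesis using x y unit[of x] by simp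
    next
      case False
      then have "inner x y = 0" using C(3) x(1) y(1) by (simp add: pairwise_def orthogonal_def)
      then have "inner u v = 0" by (simp add: x(3) y(3))
      moreover have "inner u u = 1" using unit[OF x(2)] x(3) by simp
      ultimately show ?thesis by (cases "u = v") simp_all
    qed
  qed
  have zero: "x = 0" if x: "\<forall>u\<in>D. inner x u = 0" for x
  proof -
    have C0: "orthogonal x c" if c: "c \<in> C" for c
    proof (cases "c = 0")
      case False
      then have "inner x (c /\<^sub>R norm c) = 0" using x c by (simp add: D_def del: inner_scaleR_right)
      then show ?thesis using False by (simp add: orthogonal_def)
    qed (simp add: orthogonal_def)
    have "orthogonal x x"
      by (rule orthogonal_to_span[of x C]) (use C(2) C0 in simp_all)
    then show ?thesis by (simp add: orthogonal_self)
  qed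
  have "form_app (one_form :: 'n form) [] \<noteq> form_app 0 []" by (simp add: one_form.rep_eq)
  then have "D \<noteq> {}" using zero[of one_form] by auto
  moreover have "finite D" using C(1) by (simp add: D_def)
  moreover have "\<forall>u\<in>D. \<forall>v\<in>D. inner u v = (if u = v then 1 else 0)"
    by (intro ballI) (rule ortho)
  moreover have "\<forall>x. (\<forall>u\<in>D. inner x u = 0) \<longleftrightarrow> x = 0"
  proof (intro allI iffI)
    fix x :: "'n form" assume "x = 0"
    then show "\<forall>u\<in>D. inner x u = 0" by simp
  qed (rule zero)
  ultimately show ?thesis by (intro exI[of _ D] conjI)
qed

instantiation form :: (finite) euclidean_space
begin

definition Basis_form :: "'a form set" where
  "Basis_form = (SOME B. B \<noteq> {} \<and> finite B
     \<and> (\<forall>u\<in>B. \<forall>v\<in>B. inner u v = (if u = v then 1 else 0))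
     \<and> (\<forall>x. (\<forall>u\<in>B. inner x u = 0) \<longleftrightarrow> x = 0))"

instance
proof
  have B: "(Basis :: 'a form set) \<noteq> {} \<and> finite (Basis :: 'a form set)
     \<and> (\<forall>u\<in>Basis. \<forall>v\<in>(Basis :: 'a form set). inner u v = (if u = v then 1 else 0))
     \<and> (\<forall>x :: 'a form. (\<forall>u\<in>Basis. inner x u = 0) \<longleftrightarrow> x = 0)"
    unfolding Basis_form_def by (rule someI_ex[OF ex_orthonormal_form_basis])
  show "(Basis :: 'a form set) \<noteq> {}" by (rule B[THEN conjunct1])
  show "finite (Basis :: 'a form set)" by (rule B[THEN conjunct2, THEN conjunct1])
  show "inner u v = (if u = v then 1 else 0)" if "u \<in> Basis" "v \<in> Basis" for u v :: "'a form"
    using B[THEN conjunct2, THEN conjunct2, THEN conjunct1] that by (metis (no_types))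
  show "(\<forall>u\<in>Basis. inner x u = 0) \<longleftrightarrow> x = 0" for x :: "'a form"
    using B[THEN conjunct2, THEN conjunct2, THEN conjunct2] by (rule spec)
qed

end

subsection \<open>Products of form spaces and multiindices\<close>

definition Lambda_prod :: "('m \<Rightarrow> nat) \<Rightarrow> ('n::finite form ^ 'm::finite) set" where
  "Lambda_prod k = {\<xi>. \<forall>i. \<xi> $ i \<in> Lambda (k i)}"

definition wdeg :: "('m::finite \<Rightarrow> nat) \<Rightarrow> ('m \<Rightarrow> nat) \<Rightarrow> nat" where
  "wdeg k \<alpha> = (\<Sum>i\<in>UNIV. k i * \<alpha> i)"

definition multiindices :: "nat \<Rightarrow> ('m::finite \<Rightarrow> nat) \<Rightarrow> ('m \<Rightarrow> nat) set" where
  "multiindices n k = {\<alpha>. (\<forall>i. \<alpha> i \<le> n div k i) \<and> wdeg k \<alpha> \<le> n}"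

definition wedge_power :: "'n::finite form \<Rightarrow> nat \<Rightarrow> 'n form" where
  "wedge_power \<omega> a = ((\<and>\<^sub>\<Lambda>) \<omega> ^^ a) one_form"

text \<open>The factors are multiplied in the increasing order of their index.\<close>

definition multi_power :: "'n::finite form ^ 'm::{finite,linorder} \<Rightarrow> ('m \<Rightarrow> nat) \<Rightarrow> 'n form" where
  "multi_power \<xi> \<alpha> =
     foldr (\<lambda>i \<eta>. wedge_power (\<xi> $ i) (\<alpha> i) \<and>\<^sub>\<Lambda> \<eta>) (sorted_list_of_set UNIV) one_form"

section \<open>Sobolev spaces on an open set\<close>

definition partial :: "'n \<Rightarrow> (real ^ 'n::finite \<Rightarrow> 'b::real_normed_vector) \<Rightarrow> real ^ 'n \<Rightarrow> 'b" where
  "partial j \<phi> x = frechet_derivative \<phi> (at x) (axis j 1)"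

fun Ck :: "nat \<Rightarrow> (real ^ 'n::finite \<Rightarrow> 'b::real_normed_vector) \<Rightarrow> bool" where
  "Ck 0 \<phi> \<longleftrightarrow> continuous_on UNIV \<phi>"
| "Ck (Suc r) \<phi> \<longleftrightarrow> (\<forall>x. \<phi> differentiable (at x)) \<and> (\<forall>j. Ck r (partial j \<phi>))"

text \<open>\<open>C\<^sub>c\<^sup>\<infinity>(\<Omega>)\<close>, the functions being extended by zero to the whole space.\<close>

definition test_functions ::
  "(real ^ 'n::finite) set \<Rightarrow> (real ^ 'n \<Rightarrow> 'b::real_normed_vector) set" where
  "test_functions \<Omega> = {\<phi>. (\<forall>r. Ck r \<phi>) \<and>
     compact (closure {x. \<phi> x \<noteq> 0}) \<and> closure {x. \<phi> x \<noteq> 0} \<subseteq> \<Omega>}"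

definition locally_integrable ::
  "(real ^ 'n::finite) set \<Rightarrow> (real ^ 'n \<Rightarrow> 'b::euclidean_space) \<Rightarrow> bool" where
  "locally_integrable \<Omega> u \<longleftrightarrow> (\<forall>K. compact K \<and> K \<subseteq> \<Omega> \<longrightarrow> integrable (lebesgue_on K) u)"

text \<open>\<open>g\<close> is a representative of the weak derivative of \<open>u\<close> with respect to the \<open>j\<close>-th variable.\<close>

definition weak_partial :: "(real ^ 'n::finite) set \<Rightarrow> 'n \<Rightarrow>
    (real ^ 'n \<Rightarrow> 'b::euclidean_space) \<Rightarrow> (real ^ 'n \<Rightarrow> 'b) \<Rightarrow> bool" where
  "weak_partial \<Omega> j u g \<longleftrightarrow> locally_integrable \<Omega> u \<and> locally_integrable \<Omega> g \<and>
     (\<forall>\<phi> :: real ^ 'n \<Rightarrow> real. \<phi> \<in> test_functions \<Omega> \<longrightarrow>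
        (\<integral>x. partial j \<phi> x *\<^sub>R u x \<partial>lebesgue_on \<Omega>) = - (\<integral>x. \<phi> x *\<^sub>R g x \<partial>lebesgue_on \<Omega>))"

definition L_infty ::
  "(real ^ 'n::finite) set \<Rightarrow> (real ^ 'n \<Rightarrow> 'b::euclidean_space) set" where
  "L_infty \<Omega> = {u. u \<in> borel_measurable (lebesgue_on \<Omega>) \<and>
     (\<exists>C. AE x in lebesgue_on \<Omega>. norm (u x) \<le> C)}"

definition W1_infty ::
  "(real ^ 'n::finite) set \<Rightarrow> (real ^ 'n \<Rightarrow> 'b::euclidean_space) set" where
  "W1_infty \<Omega> = {u. u \<in> L_infty \<Omega> \<and> (\<forall>j. \<exists>g. weak_partial \<Omega> j u g \<and> g \<in> L_infty \<Omega>)}"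

text \<open>The closure of \<open>C\<^sub>c\<^sup>\<infinity>(\<Omega>)\<close> in \<open>W\<^sup>1\<^sup>,\<^sup>1(\<Omega>)\<close>.\<close>

definition W1_1_zero ::
  "(real ^ 'n::finite) set \<Rightarrow> (real ^ 'n \<Rightarrow> 'b::euclidean_space) set" where
  "W1_1_zero \<Omega> = {u. integrable (lebesgue_on \<Omega>) u \<and>
     (\<exists>G. (\<forall>j. weak_partial \<Omega> j u (G j) \<and> integrable (lebesgue_on \<Omega>) (G j)) \<and>
       (\<exists>\<phi>. (\<forall>p::nat. \<phi> p \<in> test_functions \<Omega>) \<and>
         (\<lambda>p. \<integral>x. norm (\<phi> p x - u x) \<partial>lebesgue_on \<Omega>) \<longlonglongrightarrow> 0 \<and>
         (\<forall>j. (\<lambda>p. \<integral>x. norm (partial j (\<phi> p) x - G j x) \<partial>lebesgue_on \<Omega>) \<longlonglongrightarrow> 0)))}"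

text \<open>Zero boundary values are understood in the sense of \<open>W\<^sup>1\<^sup>,\<^sup>1\<close>: the closure of \<open>C\<^sub>c\<^sup>\<infinity>(\<Omega>)\<close> in the
  \<open>W\<^sup>1\<^sup>,\<^sup>\<infinity>\<close>-norm contains only \<open>C\<^sup>1\<close> functions and is not what is meant in the calculus of
  variations.\<close>

definition W1_infty_zero ::
  "(real ^ 'n::finite) set \<Rightarrow> (real ^ 'n \<Rightarrow> 'b::euclidean_space) set" where
  "W1_infty_zero \<Omega> = W1_infty \<Omega> \<inter> W1_1_zero \<Omega>"

text \<open>Exterior derivative of a form-valued function with (weak) partial derivatives \<open>D j\<close>.\<close>

definition ext_deriv :: "('n \<Rightarrow> real ^ 'n \<Rightarrow> 'n form) \<Rightarrow> real ^ 'n::finite \<Rightarrow> 'n form" where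
  "ext_deriv D x = (\<Sum>j\<in>UNIV. dx j \<and>\<^sub>\<Lambda> D j x)"

section \<open>Vectorial notions of affinity\<close>

text \<open>A function on \<open>Lambda_prod k\<close> is given by a function on the surrounding type; its values outside
  \<open>Lambda_prod k\<close> are irrelevant.\<close>

definition ext_one_affine ::
  "('m \<Rightarrow> nat) \<Rightarrow> ('n::finite form ^ 'm::finite \<Rightarrow> real) \<Rightarrow> bool" where
  "ext_one_affine k f \<longleftrightarrow> (\<forall>\<xi>\<in>Lambda_prod k. \<forall>a\<in>Lambda 1. \<forall>\<beta>\<in>Lambda_prod (\<lambda>i. k i - 1).
     \<exists>p q. \<forall>t. f (\<chi> i. \<xi> $ i + t *\<^sub>R (a \<and>\<^sub>\<Lambda> \<beta> $ i)) = p + q * t)"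

text \<open>\<open>D i j\<close> ranges over the representatives of the weak derivatives of \<open>\<omega> i\<close>; the integral does not
  depend on the choice. As \<open>f\<close> is Borel and locally bounded on \<open>Lambda_prod k\<close> and the argument of \<open>f\<close>
  is essentially bounded and lies in \<open>Lambda_prod k\<close> almost everywhere, the integrand is integrable.
  The empty set has to be excluded because of the division by the volume.\<close>

definition ext_quasiaffine ::
  "('m \<Rightarrow> nat) \<Rightarrow> ('n::finite form ^ 'm::finite \<Rightarrow> real) \<Rightarrow> bool" where
  "ext_quasiaffine k f \<longleftrightarrow>
     f \<in> borel_measurable (restrict_space borel (Lambda_prod k)) \<and>
     (\<forall>\<xi>\<in>Lambda_prod k. \<exists>U. open U \<and> \<xi> \<in> U \<and> bounded (f ` (U \<inter> Lambda_prod k))) \<and>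
     (\<forall>\<Omega> :: (real ^ 'n) set. open \<Omega> \<longrightarrow> bounded \<Omega> \<longrightarrow> \<Omega> \<noteq> {} \<longrightarrow>
        (\<forall>\<xi>\<in>Lambda_prod k. \<forall>\<omega> D.
           (\<forall>i. \<omega> i \<in> W1_infty_zero \<Omega> \<and> (\<forall>x\<in>\<Omega>. \<omega> i x \<in> Lambda (k i - 1)) \<and>
                (\<forall>j. weak_partial \<Omega> j (\<omega> i) (D i j))) \<longrightarrow>
           1 / measure lebesgue \<Omega> *
             (\<integral>x. f (\<chi> i. \<xi> $ i + ext_deriv (D i) x) \<partial>lebesgue_on \<Omega>) = f \<xi>))"

text \<open>Index set and target space of \<open>T\<close>: families of forms indexed by the multiindices of
  positive degree, padded by \<open>0\<close> elsewhere.\<close>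

definition pos_multiindices :: "nat \<Rightarrow> ('m::finite \<Rightarrow> nat) \<Rightarrow> ('m \<Rightarrow> nat) set" where
  "pos_multiindices n k = {\<alpha> \<in> multiindices n k. 1 \<le> wdeg k \<alpha>}"

definition T_space :: "('m::finite \<Rightarrow> nat) \<Rightarrow> (('m \<Rightarrow> nat) \<Rightarrow> 'n::finite form) set" where
  "T_space k = {X. (\<forall>\<alpha>\<in>pos_multiindices CARD('n) k. X \<alpha> \<in> Lambda (wdeg k \<alpha>)) \<and>
                   (\<forall>\<alpha>. \<alpha> \<notin> pos_multiindices CARD('n) k \<longrightarrow> X \<alpha> = 0)}"

definition T_vec :: "('m \<Rightarrow> nat) \<Rightarrow> 'n::finite form ^ 'm::{finite,linorder} \<Rightarrow>
    ('m \<Rightarrow> nat) \<Rightarrow> 'n form" where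
  "T_vec k \<xi> = (\<lambda>\<alpha>. if \<alpha> \<in> pos_multiindices CARD('n) k then multi_power \<xi> \<alpha> else 0)"

definition affine_on_T_space ::
  "('m::finite \<Rightarrow> nat) \<Rightarrow> ((('m \<Rightarrow> nat) \<Rightarrow> 'n::finite form) \<Rightarrow> real) \<Rightarrow> bool" where
  "affine_on_T_space k F \<longleftrightarrow> (\<forall>X\<in>T_space k. \<forall>Y\<in>T_space k. \<forall>t::real.
     F (\<lambda>\<alpha>. (1 - t) *\<^sub>R X \<alpha> + t *\<^sub>R Y \<alpha>) = (1 - t) * F X + t * F Y)"

definition ext_polyaffine ::
  "('m \<Rightarrow> nat) \<Rightarrow> ('n::finite form ^ 'm::{finite,linorder} \<Rightarrow> real) \<Rightarrow> bool" where
  "ext_polyaffine k f \<longleftrightarrow>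
     (\<exists>F. affine_on_T_space k F \<and> (\<forall>\<xi>\<in>Lambda_prod k. f \<xi> = F (T_vec k \<xi>)))"

end

theory Submission
  imports Defs
begin

text \<open>One affine implies the power expansion: if \<open>f\<close> is affine in the directions \<open>a \<and> \<beta>\<close>, its difference
  \<open>\<Delta>\<^sub>v f(\<xi>) = f(\<xi> + v) - f(\<xi>)\<close> in such a direction is again one affine, and \<open>\<Delta>\<^sub>v \<Delta>\<^sub>w f = 0\<close> whenever \<open>v\<close> and
  \<open>w\<close> share the covector \<open>a\<close>. Hence \<open>\<Delta> \<cdots> \<Delta> f(0)\<close> in decomposable directions is an alternating multilinear
  function of all covectors involved, that is, \<open>\<langle>c; v\<^sub>1 \<and> \<cdots> \<and> v\<^sub>s\<rangle>\<close> for some form \<open>c\<close>, and a Taylor formula for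
  differences expands \<open>f\<close> in these terms.

  The power expansion implies quasiaffine: replacing \<open>\<xi>\<^sub>i\<close> by \<open>\<xi>\<^sub>i + d\<omega>\<^sub>i\<close> in a wedge product one factor at a
  time, every correction has the form \<open>d\<omega> \<and> X\<close>. In \<open>W\<^sup>1\<^sup>,\<^sup>1\<close> each factor can be approximated by test functions
  while the others stay bounded; for test functions \<open>X\<close> is closed, so that \<open>d\<omega> \<and> X = d(\<omega> \<and> X)\<close> has integral
  zero.

  Quasiaffine implies one affine: testing with \<open>\<omega> = u \<beta>\<close>, where the gradient of \<open>u\<close> is \<open>\<plusminus> a\<close> outside a small
  set, gives \<open>f(\<xi> + a \<and> \<beta>) + f(\<xi> - a \<and> \<beta>) = 2 f(\<xi>)\<close>, and a locally bounded solution of Jensen's equation is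
  affine.\<close>

section \<open>Exterior algebra\<close>

text \<open>The Taylor formula is an exponential. With the argument written as a sum of decomposable
  directions \<open>e p\<close>, one affinity reads f(y + \<Sum> x_p e_p) = \<Prod> (1 + x_p
  \<Delta>_p) f(y). The differences commute and \<Delta>_p^2 = 0, so the product is exp(\<Sum> x_p
  \<Delta>_p), and the a-th power of the exponent runs over all words of length a in the indices of
  the \<xi>_i. Each word gives the pairing of one form with the product of the \<xi>_i in that
  order; sorting the word costs a sign depending on the degrees only.

  In the integral identities the approximating sequences converge in L^1 with no uniform bound at
  hand, which rules out replacing all factors simultaneously. The definition admits every
  representative of the weak derivatives; the fundamental lemma compares them with those attached to
  the sequence.

  A zigzag function leaves open how much of the volume carries the gradient a and how much -a.
  Subtracting a multiple of one partial derivative, which has integral zero, makes the integrand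
  take the same value on both parts.\<close>

lemma finite_distinct [simp]: "finite {is :: 'n::finite list. distinct is}"
  by (rule finite_distinct_lists)

text \<open>Polarisation: expand the value with \<open>v + w\<close> in both slots; the values with
  a repeated vector vanish.\<close>

lemma form_app_swap:
  "form_app \<omega> (us @ v # ws @ w # xs) = - form_app \<omega> (us @ w # ws @ v # xs)"
proof -
  let ?g = "\<lambda>a b. form_app \<omega> (us @ a # ws @ b # xs)"
  have l1: "linear (\<lambda>a. ?g a b)" for b by (rule form_app_linear)
  have l2: "linear (\<lambda>b. ?g a b)" for a
    using form_app_linear[of \<omega> "us @ a # ws" xs] by simp
  have z: "?g a a = 0" for a by (rule form_app_not_distinct) simp
  have "?g (v + w) (v + w) = ?g v v + ?g v w + (?g w v + ?g w w)"
    by (simp add: linear_add[OF l1] linear_add[OF l2])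
  then show ?thesis by (simp add: z)
qed

text \<open>Induction along a decomposition into transpositions. One transposition is
  \<open>form_app_swap\<close> after the list has been cut at the two positions.\<close>

lemma form_app_permute_list:
  assumes "\<sigma> permutes {..<length vs}"
  shows "form_app \<omega> (permute_list \<sigma> vs) = of_int (sign \<sigma>) * form_app \<omega> vs"
proof -
  have "\<forall>vs. length vs = n \<longrightarrow> form_app \<omega> (permute_list \<sigma> vs) = of_int (sign \<sigma>) * form_app \<omega> vs"
    if "\<sigma> permutes {..<n}" for n using finite_lessThan[of n] that
  proof (induction rule: permutes_rev_induct)
    case id
    show ?case by simp
  next
    case (swap a b p)
    show ?case
    proof -
      have t: "Transposition.transpose a b permutes {..<n}"
        using swap by (intro permutes_swap_id) auto
      have sg: "sign (p \<circ> Transposition.transpose a b) = - sign p"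
        using swap by (subst sign_compose)
         (auto simp: permutation_swap_id sign_swap_id intro: permutes_imp_permutation[rotated])
      show ?thesis
      proof (intro allI impI)
        fix vs0 :: "(real ^ 'a) list" assume n0: "length vs0 = n"
        define vs where "vs = permute_list p vs0"
        have n: "length vs = n" by (simp add: vs_def n0)
        have *: "form_app \<omega> (permute_list (Transposition.transpose a b) vs) = - form_app \<omega> vs"
          if "a < b" "a < n" "b < n" for a b
        proof -
          let ?us = "take a vs" and ?ws = "take (b - a - 1) (drop (Suc a) vs)" and ?xs = "drop (Suc b) vs"
          have vs: "vs = ?us @ vs ! a # ?ws @ vs ! b # ?xs"
          proof -
            have "vs = ?us @ vs ! a # drop (Suc a) vs" using that n by (simp add: id_take_nth_drop)
            moreover have "drop (Suc a) vs = ?ws @ vs ! b # ?xs"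
              using that n id_take_nth_drop[of "b - a - 1" "drop (Suc a) vs"] by simp
            ultimately show ?thesis by simp
          qed
          have "permute_list (Transposition.transpose a b) vs = ?us @ vs ! b # ?ws @ vs ! a # ?xs"
          proof (rule nth_equalityI)
            show "length (permute_list (Transposition.transpose a b) vs) = length (?us @ vs ! b # ?ws @ vs ! a # ?xs)"
              using that n by simp
          next
            fix i assume "i < length (permute_list (Transposition.transpose a b) vs)"
            then have i: "i < length vs" by simp
            have "Transposition.transpose a b permutes {..<length vs}"
              using that n by (intro permutes_swap_id) auto
            then have "permute_list (Transposition.transpose a b) vs ! i = vs ! (Transposition.transpose a b i)"
              using i by (simp add: permute_list_nth)
            then show "permute_list (Transposition.transpose a b) vs ! i = (?us @ vs ! b # ?ws @ vs ! a # ?xs) ! i"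
              using that n i by (auto simp: nth_append nth_Cons' Transposition.transpose_def)
          qed
          then show ?thesis using form_app_swap[of \<omega> ?us "vs ! b" ?ws "vs ! a" ?xs] vs by simp
        qed
        have **: "form_app \<omega> (permute_list (Transposition.transpose a b) vs) = - form_app \<omega> vs"
          using *[of a b] *[of b a] swap(1-3) by (cases "a < b") (auto simp: transpose_commute)
        show "form_app \<omega> (permute_list (p \<circ> Transposition.transpose a b) vs0)
            = of_int (sign (p \<circ> Transposition.transpose a b)) * form_app \<omega> vs0"
          using swap n0 ** permute_list_compose[of "Transposition.transpose a b" vs0 p] t
          by (simp add: sg vs_def)
      qed
    qed
  qed
  with assms show ?thesis by blast
qed

text \<open>Permuting positions is a bijection of the distinct lists of a fixed length, so each of
  the \<open>fact N\<close> permutations contributes the same sum. This removes the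
  antisymmetrisation in the definition of the exterior product.\<close>

lemma sum_distinct_permute:
  fixes g :: "'n::finite list \<Rightarrow> real"
  shows "(\<Sum>ks | distinct ks. (\<Sum>\<sigma> | \<sigma> permutes {..<length ks}. g (permute_list \<sigma> ks)) / fact (length ks))
       = (\<Sum>ks | distinct ks. g ks)"
proof -
  let ?D = "{ks :: 'n list. distinct ks}"
  have "(\<Sum>ks | ks \<in> ?D \<and> length ks = N. (\<Sum>\<sigma> | \<sigma> permutes {..<length ks}. g (permute_list \<sigma> ks)) / fact (length ks))
      = (\<Sum>ks | ks \<in> ?D \<and> length ks = N. g ks)" for N
  proof -
    let ?S = "{ks. ks \<in> ?D \<and> length ks = N}"
    have "(\<Sum>ks\<in>?S. g (permute_list \<sigma> ks)) = (\<Sum>ks\<in>?S. g ks)" if "\<sigma> permutes {..<N}" for \<sigma>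
      using that permutes_inv[OF that]
      by (intro sum.reindex_bij_witness[of _ "permute_list (inv \<sigma>)" "permute_list \<sigma>"])
         (auto simp flip: permute_list_compose simp: permutes_inv_o)
    then have "(\<Sum>\<sigma> | \<sigma> permutes {..<N}. \<Sum>ks\<in>?S. g (permute_list \<sigma> ks)) = fact N * (\<Sum>ks\<in>?S. g ks)"
      by (simp add: card_permutations[of "{..<N}" N])
    then show ?thesis
      by (subst (asm) sum.swap) (simp flip: sum_divide_distrib)
  qed
  then show ?thesis
    by (subst (1 2) sum.image_gen[of _ _ length]) auto
qed

text \<open>A distinct list with a cutting position is a pair of lists whose concatenation is
  distinct. By the hypothesis the other pairs of distinct lists contribute nothing, which decouples
  the two sums.\<close>

lemma sum_distinct_append:
  fixes h :: "'n::finite list \<Rightarrow> 'n list \<Rightarrow> real"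
  assumes "\<And>is js. \<not> distinct (is @ js) \<Longrightarrow> h is js = 0"
  shows "(\<Sum>ks | distinct ks. \<Sum>k\<le>length ks. h (take k ks) (drop k ks))
       = (\<Sum>is | distinct is. \<Sum>js | distinct js. h is js)"
proof -
  have "(\<Sum>ks | distinct ks. \<Sum>k\<le>length ks. h (take k ks) (drop k ks))
      = (\<Sum>(ks, k)\<in>(SIGMA ks:{ks. distinct ks}. {..length ks}). h (take k ks) (drop k ks))"
    by (simp add: sum.Sigma)
  also have "\<dots> = (\<Sum>(is, js) | distinct (is @ js). h is js)"
    by (rule sum.reindex_bij_witness[of _ "\<lambda>(is, js). (is @ js, length is)" "\<lambda>(ks, k). (take k ks, drop k ks)"])
       (auto simp: distinct_append dest: set_take_disj_set_drop_if_distinct[THEN equalityD1, THEN subsetD, OF _ order_refl IntI])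
  also have "\<dots> = (\<Sum>(is, js)\<in>{is. distinct is} \<times> {js. distinct js}. h is js)"
    using assms by (intro sum.mono_neutral_left) auto
  also have "\<dots> = (\<Sum>is | distinct is. \<Sum>js | distinct js. h is js)"
    by (simp add: sum.cartesian_product)
  finally show ?thesis .
qed

lemma basis_vecs_simps [simp]:
  "basis_vecs [] = []" "basis_vecs (i # is) = axis i 1 # basis_vecs is"
  "basis_vecs (is @ js) = basis_vecs is @ basis_vecs js" "length (basis_vecs is) = length is"
  "take k (basis_vecs is) = basis_vecs (take k is)" "drop k (basis_vecs is) = basis_vecs (drop k is)"
  by (simp_all add: basis_vecs_def take_map drop_map)

lemma distinct_basis_vecs [simp]: "distinct (basis_vecs is) = distinct is"
  by (auto simp: basis_vecs_def distinct_map inj_on_def axis_eq_axis)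

text \<open>The exterior product is adjoint to the shuffle coproduct; associativity, graded commutativity and
  the unit laws are read off from the right-hand side.\<close>

lemma inner_wedge:
  fixes \<omega> \<eta> \<zeta> :: "'n::finite form"
  shows "\<zeta> \<bullet> (\<omega> \<and>\<^sub>\<Lambda> \<eta>) = (\<Sum>is | distinct is. \<Sum>js | distinct js.
    form_app \<zeta> (basis_vecs is @ basis_vecs js) * form_app \<omega> (basis_vecs is) * form_app \<eta> (basis_vecs js)
    / (fact (length is) * fact (length js)))"
proof -
  define g where "g ks = (\<Sum>k\<le>length ks. form_app \<zeta> (basis_vecs (take k ks) @ basis_vecs (drop k ks)) *
    form_app \<omega> (basis_vecs (take k ks)) * form_app \<eta> (basis_vecs (drop k ks))
    / (fact (length (take k ks)) * fact (length (drop k ks))))" for ks :: "'n list"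
  have *: "form_app \<zeta> (basis_vecs ks) * form_app (\<omega> \<and>\<^sub>\<Lambda> \<eta>) (basis_vecs ks)
    = (\<Sum>\<sigma> | \<sigma> permutes {..<length ks}. g (permute_list \<sigma> ks))" for ks
  proof -
    \<comment> \<open>The form \<open>\<zeta>\<close> is alternating too and absorbs the sign of the
      permutation; the summand then depends on the permuted list alone.\<close>
    have 1: "form_app \<zeta> (basis_vecs ks) * of_int (sign \<sigma>) = form_app \<zeta> (basis_vecs (permute_list \<sigma> ks))"
      if "\<sigma> permutes {..<length ks}" for \<sigma>
      using form_app_permute_list[of \<sigma> "basis_vecs ks" \<zeta>] that
      by (simp add: basis_vecs_def permute_list_map[OF that] mult.commute)
    have 2: "permute_list \<sigma> (basis_vecs ks) = basis_vecs (permute_list \<sigma> ks)"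
      if "\<sigma> permutes {..<length ks}" for \<sigma>
      by (simp add: basis_vecs_def permute_list_map[OF that])
    have "form_app \<zeta> (basis_vecs ks) * form_app (\<omega> \<and>\<^sub>\<Lambda> \<eta>) (basis_vecs ks)
      = (\<Sum>k\<le>length ks. \<Sum>\<sigma> | \<sigma> permutes {..<length ks}. form_app \<zeta> (basis_vecs ks) * of_int (sign \<sigma>) *
      (form_app \<omega> (take k (permute_list \<sigma> (basis_vecs ks))) * form_app \<eta> (drop k (permute_list \<sigma> (basis_vecs ks))))
      / (fact k * fact (length ks - k)))"
      by (simp add: wedge.rep_eq sum_distrib_left sum_divide_distrib mult.assoc)
    also have "\<dots> = (\<Sum>k\<le>length ks. \<Sum>\<sigma> | \<sigma> permutes {..<length ks}. form_app \<zeta> (basis_vecs (permute_list \<sigma> ks)) *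
      (form_app \<omega> (basis_vecs (take k (permute_list \<sigma> ks))) * form_app \<eta> (basis_vecs (drop k (permute_list \<sigma> ks))))
      / (fact k * fact (length ks - k)))"
      by (intro sum.cong refl) (simp add: 1 2)
    also have "\<dots> = (\<Sum>\<sigma> | \<sigma> permutes {..<length ks}. g (permute_list \<sigma> ks))"
      by (subst sum.swap) (auto intro!: sum.cong simp: g_def min_absorb2 mult.assoc simp flip: basis_vecs_simps(3))
    finally show ?thesis .
  qed
  have "\<zeta> \<bullet> (\<omega> \<and>\<^sub>\<Lambda> \<eta>) = (\<Sum>ks | distinct ks. g ks)"
    by (simp add: inner_form_def * sum_distinct_permute)
  also have "\<dots> = (\<Sum>is | distinct is. \<Sum>js | distinct js.
    form_app \<zeta> (basis_vecs is @ basis_vecs js) * form_app \<omega> (basis_vecs is) * form_app \<eta> (basis_vecs js)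
    / (fact (length is) * fact (length js)))"
    unfolding g_def
    by (rule sum_distinct_append) (simp add: form_app_not_distinct flip: basis_vecs_simps(3) del: basis_vecs_simps(3))
  finally show ?thesis .
qed

subsection \<open>Algebraic properties of the exterior product\<close>

lemma inner_eqI: "(\<And>z. z \<bullet> x = z \<bullet> y) \<Longrightarrow> x = y" for x y :: "'n::finite form"
  using vector_eq_ldot by blast

lemma bilinear_wedge: "bilinear ((\<and>\<^sub>\<Lambda>) :: 'n::finite form \<Rightarrow> 'n form \<Rightarrow> 'n form)"
  unfolding bilinear_def
  by (intro conjI allI linearI inner_eqI)
     (simp_all only: inner_wedge inner_add_right inner_scaleR_right form_app_simps distrib_left distrib_right
        add_divide_distrib sum.distrib sum_distrib_left times_divide_eq_right mult.assoc mult.left_commute)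

lemma bounded_bilinear_wedge: "bounded_bilinear ((\<and>\<^sub>\<Lambda>) :: 'n::finite form \<Rightarrow> 'n form \<Rightarrow> 'n form)"
  using bilinear_wedge by (simp add: bilinear_conv_bounded_bilinear)

interpretation wedge: bounded_bilinear "(\<and>\<^sub>\<Lambda>) :: 'n::finite form \<Rightarrow> 'n form \<Rightarrow> 'n form"
  by (rule bounded_bilinear_wedge)

lift_definition left_contraction :: "(real ^ 'n::finite) list \<Rightarrow> 'n form \<Rightarrow> 'n form" is "\<lambda>us \<omega> vs. \<omega> (us @ vs)"
  by (auto simp: alternating_multilinear_def simp flip: append_assoc)

lift_definition right_contraction :: "(real ^ 'n::finite) list \<Rightarrow> 'n form \<Rightarrow> 'n form" is "\<lambda>us \<omega> vs. \<omega> (vs @ us)"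
  by (auto simp: alternating_multilinear_def)

lemma inner_wedge_left:
  "\<zeta> \<bullet> (\<omega> \<and>\<^sub>\<Lambda> \<eta>) = (\<Sum>is | distinct is. form_app \<omega> (basis_vecs is) / fact (length is) *
     (left_contraction (basis_vecs is) \<zeta> \<bullet> \<eta>))"
  unfolding inner_wedge inner_form_def[of "left_contraction _ _"]
  by (simp add: left_contraction.rep_eq sum_distrib_left mult_ac)

lemma inner_wedge_right:
  "\<zeta> \<bullet> (\<omega> \<and>\<^sub>\<Lambda> \<eta>) = (\<Sum>is | distinct is. form_app \<eta> (basis_vecs is) / fact (length is) *
     (right_contraction (basis_vecs is) \<zeta> \<bullet> \<omega>))"
  unfolding inner_wedge inner_form_def[of "right_contraction _ _"]
  by (subst sum.swap) (simp add: right_contraction.rep_eq sum_distrib_left mult_ac)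

text \<open>Tested against \<open>\<zeta>\<close>, both bracketings contract \<open>\<omega>\<close>
  off the front and \<open>\<theta>\<close> off the back, and these two contractions
  commute.\<close>

lemma wedge_assoc: "(\<omega> \<and>\<^sub>\<Lambda> \<eta>) \<and>\<^sub>\<Lambda> \<theta> = \<omega> \<and>\<^sub>\<Lambda> (\<eta> \<and>\<^sub>\<Lambda> \<theta>)" for \<omega> \<eta> \<theta> :: "'n::finite form"
proof -
  have "\<zeta> \<bullet> ((\<omega> \<and>\<^sub>\<Lambda> \<eta>) \<and>\<^sub>\<Lambda> \<theta>) = \<zeta> \<bullet> (\<omega> \<and>\<^sub>\<Lambda> (\<eta> \<and>\<^sub>\<Lambda> \<theta>))" for \<zeta>
  proof -
    have "\<zeta> \<bullet> ((\<omega> \<and>\<^sub>\<Lambda> \<eta>) \<and>\<^sub>\<Lambda> \<theta>) = (\<Sum>ks | distinct ks. \<Sum>is | distinct is.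
        form_app \<theta> (basis_vecs ks) / fact (length ks) * (form_app \<omega> (basis_vecs is) / fact (length is) *
          (left_contraction (basis_vecs is) (right_contraction (basis_vecs ks) \<zeta>) \<bullet> \<eta>)))"
      by (subst inner_wedge_right) (simp add: inner_wedge_left sum_distrib_left)
    moreover have "\<zeta> \<bullet> (\<omega> \<and>\<^sub>\<Lambda> (\<eta> \<and>\<^sub>\<Lambda> \<theta>)) = (\<Sum>is | distinct is. \<Sum>ks | distinct ks.
        form_app \<omega> (basis_vecs is) / fact (length is) * (form_app \<theta> (basis_vecs ks) / fact (length ks) *
          (right_contraction (basis_vecs ks) (left_contraction (basis_vecs is) \<zeta>) \<bullet> \<eta>)))"
      by (subst inner_wedge_left) (simp add: inner_wedge_right sum_distrib_left)
    moreover have "left_contraction us (right_contraction vs \<zeta>) = right_contraction vs (left_contraction us \<zeta>)" for us vs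
      by (rule form_eqI) (simp add: left_contraction.rep_eq right_contraction.rep_eq)
    ultimately show ?thesis by (simp only:) (subst sum.swap, simp add: mult_ac)
  qed
  then show ?thesis by (rule inner_eqI)
qed

lemma wedge_one_left [simp]: "one_form \<and>\<^sub>\<Lambda> \<omega> = \<omega>"
proof -
  have "\<zeta> \<bullet> (one_form \<and>\<^sub>\<Lambda> \<omega>) = \<zeta> \<bullet> \<omega>" for \<zeta>
  proof -
    have "\<zeta> \<bullet> (one_form \<and>\<^sub>\<Lambda> \<omega>) = (\<Sum>is\<in>{[]}. form_app one_form (basis_vecs is) / fact (length is) *
      (left_contraction (basis_vecs is) \<zeta> \<bullet> \<omega>))"
      unfolding inner_wedge_left
      by (rule sum.mono_neutral_right) (auto simp: one_form.rep_eq basis_vecs_def)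
    also have "left_contraction [] \<zeta> = \<zeta>" by (rule form_eqI) (simp add: left_contraction.rep_eq)
    ultimately show ?thesis by (simp add: one_form.rep_eq)
  qed
  then show ?thesis by (rule inner_eqI)
qed

lemma wedge_one_right [simp]: "\<omega> \<and>\<^sub>\<Lambda> one_form = \<omega>"
proof -
  have "\<zeta> \<bullet> (\<omega> \<and>\<^sub>\<Lambda> one_form) = \<zeta> \<bullet> \<omega>" for \<zeta>
  proof -
    have "\<zeta> \<bullet> (\<omega> \<and>\<^sub>\<Lambda> one_form) = (\<Sum>is\<in>{[]}. form_app one_form (basis_vecs is) / fact (length is) *
      (right_contraction (basis_vecs is) \<zeta> \<bullet> \<omega>))"
      unfolding inner_wedge_right
      by (rule sum.mono_neutral_right) (auto simp: one_form.rep_eq basis_vecs_def)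
    also have "right_contraction [] \<zeta> = \<zeta>" by (rule form_eqI) (simp add: right_contraction.rep_eq)
    ultimately show ?thesis by (simp add: one_form.rep_eq)
  qed
  then show ?thesis by (rule inner_eqI)
qed

lemma form_app_move: "form_app \<omega> (us @ v # ws) = (-1) ^ length us * form_app \<omega> (v # us @ ws)"
proof (induction us arbitrary: ws rule: rev_induct)
  case (snoc u us)
  have "form_app \<omega> (us @ u # v # ws) = - form_app \<omega> (us @ v # u # ws)"
    using form_app_swap[of \<omega> us u "[]" v ws] by simp
  then show ?case using snoc[of "u # ws"] by simp
qed simp

lemma form_app_append_commute:
  "form_app \<omega> (us @ vs) = (-1) ^ (length us * length vs) * form_app \<omega> (vs @ us)"
proof (induction us arbitrary: vs)
  case (Cons u us)
  have "form_app \<omega> (u # us @ vs) = (-1) ^ length us * form_app \<omega> (us @ u # vs)"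
    using form_app_move[of \<omega> us u vs] by (simp flip: power_add power_mult_distrib mult.assoc)
  also have "form_app \<omega> (us @ u # vs) = (-1) ^ (length us * Suc (length vs)) * form_app \<omega> (u # vs @ us)"
    using Cons[of "u # vs"] by simp
  also have "form_app \<omega> (u # vs @ us) = (-1) ^ length vs * form_app \<omega> (vs @ u # us)"
    using form_app_move[of \<omega> vs u us] by (simp flip: power_add power_mult_distrib mult.assoc)
  finally show ?case by (simp add: power_add mult_ac power_mult_distrib)
qed simp

text \<open>The grading involution, (-1)^k on the part of degree k. It lets a 1-form pass a form of
  mixed degree, so that no degrees have to be tracked in the Leibniz rule.\<close>

lift_definition parity :: "'n::finite form \<Rightarrow> 'n form" is "\<lambda>\<omega> vs. (-1) ^ length vs * \<omega> vs"
  unfolding alternating_multilinear_def length_append list.size by (auto intro!: linear_mult_left simp del: power_Suc add_Suc_right)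

lemma Lambda_app: "\<omega> \<in> Lambda k \<Longrightarrow> length vs \<noteq> k \<Longrightarrow> form_app \<omega> vs = 0"
  by (simp add: Lambda_def)

text \<open>Lists of the wrong length contribute zero on both sides; on the others the sign is that
  of exchanging two blocks.\<close>

lemma wedge_commute:
  assumes "\<omega> \<in> Lambda k" "\<eta> \<in> Lambda l"
  shows "\<omega> \<and>\<^sub>\<Lambda> \<eta> = (-1) ^ (k * l) *\<^sub>R (\<eta> \<and>\<^sub>\<Lambda> \<omega>)"
proof -
  have "\<zeta> \<bullet> (\<omega> \<and>\<^sub>\<Lambda> \<eta>) = \<zeta> \<bullet> ((-1) ^ (k * l) *\<^sub>R (\<eta> \<and>\<^sub>\<Lambda> \<omega>))" for \<zeta>
    unfolding inner_wedge inner_scaleR_right sum_distrib_left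
  proof (subst sum.swap, intro sum.cong refl, goal_cases)
    case (1 js "is")
    show ?case
    proof (cases "length is = k \<and> length js = l")
      case True
      then show ?thesis using form_app_append_commute[of \<zeta> "basis_vecs is" "basis_vecs js"] by (simp add: mult_ac)
    qed (use assms in \<open>auto simp: Lambda_app\<close>)
  qed
  then show ?thesis by (rule inner_eqI)
qed

text \<open>Only one-element lists contribute for \<open>a\<close>, and moving one vector past a
  list gives exactly the sign stored in \<open>parity\<close>.\<close>

lemma wedge_parity:
  assumes "a \<in> Lambda 1"
  shows "a \<and>\<^sub>\<Lambda> \<omega> = parity \<omega> \<and>\<^sub>\<Lambda> a"
proof -
  have "\<zeta> \<bullet> (a \<and>\<^sub>\<Lambda> \<omega>) = \<zeta> \<bullet> (parity \<omega> \<and>\<^sub>\<Lambda> a)" for \<zeta>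
    unfolding inner_wedge
  proof (subst sum.swap, intro sum.cong refl, goal_cases)
    case (1 js "is")
    show ?case
    proof (cases "length is = 1")
      case True
      then show ?thesis using form_app_append_commute[of \<zeta> "basis_vecs is" "basis_vecs js"]
        by (simp add: parity.rep_eq)
    qed (use assms in \<open>auto simp: Lambda_app\<close>)
  qed
  then show ?thesis by (rule inner_eqI)
qed

lemma subspace_Lambda: "subspace (Lambda k)"
  by (auto simp: subspace_def Lambda_def)

lemma wedge_Lambda:
  assumes "\<omega> \<in> Lambda k" "\<eta> \<in> Lambda l"
  shows "\<omega> \<and>\<^sub>\<Lambda> \<eta> \<in> Lambda (k + l)"
  unfolding Lambda_def
proof (intro CollectI allI impI)
  fix vs :: "(real ^ 'a) list" assume vs: "length vs \<noteq> k + l"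
  have *: "form_app \<omega> (take j (permute_list \<sigma> vs)) * form_app \<eta> (drop j (permute_list \<sigma> vs)) = 0"
    if "j \<le> length vs" for j \<sigma>
    using assms vs that by (cases "j = k") (auto simp: Lambda_app)
  show "form_app (\<omega> \<and>\<^sub>\<Lambda> \<eta>) vs = 0"
    unfolding wedge.rep_eq by (intro sum.neutral ballI) (simp only: * atMost_iff mult_zero_right sum.neutral_const div_0)
qed

lemma Lambda_eq_0: 
  assumes "\<omega> \<in> Lambda k" "k > CARD('n)"
  shows "\<omega> = (0 :: 'n::finite form)"
proof (rule form_eq_0I)
  fix "is" :: "'n list" assume "distinct is"
  then have "length is \<le> CARD('n)" by (metis card_mono distinct_card finite subset_UNIV)
  then show "form_app \<omega> (basis_vecs is) = 0" using assms by (intro Lambda_app) auto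
qed

lemma one_form_Lambda: "one_form \<in> Lambda 0"
  by (simp add: Lambda_def one_form.rep_eq)

lemma dx_Lambda: "dx i \<in> Lambda 1"
  by (simp add: Lambda_def dx.rep_eq)

subsection \<open>Decomposable forms\<close>

text \<open>The Euclidean identification of vectors with 1-forms. Through it a form, which takes
  vectors as arguments, can be evaluated on covectors.\<close>

definition covec :: "real ^ 'n::finite \<Rightarrow> 'n form" where
  "covec v = (\<Sum>i\<in>UNIV. v $ i *\<^sub>R dx i)"

lemma covec_Lambda: "covec v \<in> Lambda 1"
  unfolding covec_def by (intro subspace_sum subspace_scale subspace_Lambda dx_Lambda)

lemma form_app_covec: "form_app (covec v) [w] = (\<Sum>i\<in>UNIV. v $ i * w $ i)"
  by (simp add: covec_def form_app_sum dx.rep_eq)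

lemma form_app_covec_axis [simp]: "form_app (covec v) [axis i 1] = v $ i"
  by (simp add: form_app_covec axis_def if_distrib cong: if_cong)

lemma Lambda_1_covec:
  assumes "a \<in> Lambda 1"
  shows "a = covec (\<chi> i. form_app a [axis i 1])"
proof -
  have "a - covec (\<chi> i. form_app a [axis i 1]) = 0" (is "?d = 0")
  proof (rule form_eq_0I)
    fix "is" :: "'a list"
    have d: "?d \<in> Lambda 1" using assms covec_Lambda subspace_Lambda by (rule subspace_diff[rotated])
    show "form_app ?d (basis_vecs is) = 0"
    proof (cases "length is = 1")
      case True
      then obtain i where "is = [i]" by (auto simp: length_Suc_conv)
      then show ?thesis by simp
    qed (rule Lambda_app[OF d], simp)
  qed
  then show ?thesis by simp
qed

definition dec :: "(real ^ 'n::finite) list \<Rightarrow> 'n form" where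
  "dec vs = foldr (\<lambda>v \<eta>. covec v \<and>\<^sub>\<Lambda> \<eta>) vs one_form"

lemma dec_simps [simp]: "dec [] = one_form" "dec (v # vs) = covec v \<and>\<^sub>\<Lambda> dec vs"
  by (simp_all add: dec_def)

text \<open>Only one-element lists survive in \<open>inner_wedge_left\<close>, and their
  coefficients assemble the vector \<open>v\<close> in the first slot: interior multiplication is
  the adjoint of exterior multiplication.\<close>

lemma inner_covec_wedge: "\<omega> \<bullet> (covec v \<and>\<^sub>\<Lambda> \<eta>) = left_contraction [v] \<omega> \<bullet> \<eta>"
proof -
  have "\<omega> \<bullet> (covec v \<and>\<^sub>\<Lambda> \<eta>) = (\<Sum>is\<in>(\<lambda>i. [i]) ` UNIV. form_app (covec v) (basis_vecs is) / fact (length is) *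
      (left_contraction (basis_vecs is) \<omega> \<bullet> \<eta>))"
    unfolding inner_wedge_left
  proof (rule sum.mono_neutral_right, goal_cases)
    case 3
    have "form_app (covec v) (basis_vecs is) = 0" if "is \<notin> range (\<lambda>i. [i])" for "is" :: "'a list"
      using that by (intro Lambda_app[OF covec_Lambda]) (auto simp: length_Suc_conv)
    then show ?case by auto
  qed auto
  also have "\<dots> = (\<Sum>i\<in>UNIV. v $ i *\<^sub>R left_contraction [axis i 1] \<omega>) \<bullet> \<eta>"
    by (subst sum.reindex) (auto simp: inj_on_def inner_sum_left)
  also have "(\<Sum>i\<in>UNIV. v $ i *\<^sub>R left_contraction [axis i 1] \<omega>) = left_contraction [v] \<omega>"
  proof (rule form_eqI)
    fix vs
    have l: "linear (\<lambda>v. form_app \<omega> (v # vs))" using form_app_linear[of \<omega> "[]" vs] by simp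
    have "form_app (left_contraction [v] \<omega>) vs = form_app \<omega> ((\<Sum>i\<in>UNIV. v $ i *\<^sub>R axis i 1) # vs)"
      using basis_expansion[of v] by (simp add: left_contraction.rep_eq scalar_mult_eq_scaleR)
    then show "form_app (\<Sum>i\<in>UNIV. v $ i *\<^sub>R left_contraction [axis i 1] \<omega>) vs = form_app (left_contraction [v] \<omega>) vs"
      by (simp add: linear_sum[OF l] linear_scale[OF l] form_app_sum left_contraction.rep_eq)
  qed
  finally show ?thesis .
qed

text \<open>The adjunction of \<open>inner_covec_wedge\<close>, iterated. It identifies evaluation
  with pairing: an alternating multilinear function of covectors is a scalar product with their
  exterior product.\<close>

lemma inner_dec: "\<omega> \<bullet> dec vs = form_app \<omega> vs"
proof (induction vs arbitrary: \<omega>)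
  case Nil
  have "\<omega> \<bullet> one_form = (\<Sum>is\<in>{[]}. form_app \<omega> (basis_vecs is) * form_app one_form (basis_vecs is) / fact (length is))"
    unfolding inner_form_def by (rule sum.mono_neutral_right) (auto simp: one_form.rep_eq basis_vecs_def)
  then show ?case by (simp add: one_form.rep_eq)
qed (simp add: inner_covec_wedge left_contraction.rep_eq)

lemma dec_Lambda: "dec vs \<in> Lambda (length vs)"
proof (induction vs)
  case (Cons v vs)
  then show ?case using wedge_Lambda[OF covec_Lambda[of v] Cons.IH] by simp
qed (simp add: one_form_Lambda)

lemma dec_append: "dec (us @ vs) = dec us \<and>\<^sub>\<Lambda> dec vs"
  by (induction us) (simp_all add: wedge_assoc)

text \<open>All orderings of a multiindex occur and give equal terms, hence the factorial. The forms
  \<open>dec (basis_vecs is)\<close> are a spanning family, in general not a basis.\<close>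

lemma form_eq_sum_dec:
  "\<omega> = (\<Sum>is | distinct is. (form_app \<omega> (basis_vecs is) / fact (length is)) *\<^sub>R dec (basis_vecs is))"
proof -
  have "\<zeta> \<bullet> \<omega> = \<zeta> \<bullet> (\<Sum>is | distinct is. (form_app \<omega> (basis_vecs is) / fact (length is)) *\<^sub>R dec (basis_vecs is))" for \<zeta>
    by (simp add: inner_sum_right inner_dec) (simp add: inner_form_def mult.commute)
  then show ?thesis by (rule inner_eqI)
qed

lemma Lambda_eq_sum_dec:
  assumes "\<omega> \<in> Lambda k"
  shows "\<omega> = (\<Sum>is | distinct is \<and> length is = k. (form_app \<omega> (basis_vecs is) / fact k) *\<^sub>R dec (basis_vecs is))"
  by (subst form_eq_sum_dec, rule sum.mono_neutral_cong_right) (auto simp: Lambda_app[OF assms])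

lemma dec_not_distinct: "\<not> distinct vs \<Longrightarrow> dec vs = 0"
  by (rule inner_eqI) (simp add: inner_dec form_app_not_distinct)

lemma linear_dec: "linear (\<lambda>v. dec (us @ v # ws))"
  by (intro linearI inner_eqI)
     (simp_all add: inner_dec inner_add_right linear_add[OF form_app_linear] linear_scale[OF form_app_linear])

text \<open>Moving \<open>v\<close> to the front costs a sign, which goes into
  \<open>\<beta>\<close>. This is how two decomposable directions with a common covector are
  recognised as sharing a factor.\<close>

lemma dec_factor:
  assumes "v \<in> set vs"
  obtains \<beta> where "\<beta> \<in> Lambda (length vs - 1)" "dec vs = covec v \<and>\<^sub>\<Lambda> \<beta>"
proof -
  obtain us ws where vs: "vs = us @ v # ws" using assms by (meson split_list)
  have "dec vs = (-1) ^ length us *\<^sub>R dec (v # us @ ws)"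
    by (rule inner_eqI) (simp add: inner_dec vs form_app_move[of _ us] del: dec_simps)
  then have "dec vs = covec v \<and>\<^sub>\<Lambda> ((-1) ^ length us *\<^sub>R dec (us @ ws))" by (simp add: wedge.scaleR_right)
  moreover have "(-1) ^ length us *\<^sub>R dec (us @ ws) \<in> Lambda (length vs - 1)"
    using dec_Lambda[of "us @ ws"] by (simp add: vs subspace_Lambda subspace_scale)
  ultimately show ?thesis by (rule that[rotated])
qed

subsection \<open>Products along a list of indices\<close>

text \<open>Iterated differences produce products along arbitrary words in the indices;
  \<open>multi_power\<close> corresponds to the sorted words.\<close>

definition wedge_list :: "'n::finite form ^ 'm::finite \<Rightarrow> 'm list \<Rightarrow> 'n form" where
  "wedge_list \<xi> is = foldr (\<lambda>i \<eta>. \<xi> $ i \<and>\<^sub>\<Lambda> \<eta>) is one_form"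

lemma wedge_list_simps [simp]:
  "wedge_list \<xi> [] = one_form" "wedge_list \<xi> (i # is) = \<xi> $ i \<and>\<^sub>\<Lambda> wedge_list \<xi> is"
  by (simp_all add: wedge_list_def)

lemma wedge_list_append: "wedge_list \<xi> (is @ js) = wedge_list \<xi> is \<and>\<^sub>\<Lambda> wedge_list \<xi> js"
  by (induction "is") (simp_all add: wedge_assoc)

lemma wedge_power_eq: "wedge_power (\<xi> $ i) a = wedge_list \<xi> (replicate a i)"
  by (induction a) (simp_all add: wedge_power_def)

lemma wedge_list_Lambda:
  assumes "\<xi> \<in> Lambda_prod k"
  shows "wedge_list \<xi> is \<in> Lambda (sum_list (map k is))"
  using assms by (induction "is") (auto simp: one_form_Lambda Lambda_prod_def intro: wedge_Lambda)

definition index_list :: "('m::{finite,linorder} \<Rightarrow> nat) \<Rightarrow> 'm list" where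
  "index_list \<alpha> = concat (map (\<lambda>i. replicate (\<alpha> i) i) (sorted_list_of_set UNIV))"

lemma multi_power_eq: "multi_power \<xi> \<alpha> = wedge_list \<xi> (index_list \<alpha>)"
proof -
  have "foldr (\<lambda>i \<eta>. wedge_power (\<xi> $ i) (\<alpha> i) \<and>\<^sub>\<Lambda> \<eta>) is one_form
      = wedge_list \<xi> (concat (map (\<lambda>i. replicate (\<alpha> i) i) is))" for "is"
    by (induction "is") (simp_all add: wedge_power_eq wedge_list_append)
  then show ?thesis by (simp add: multi_power_def index_list_def)
qed

section \<open>Polyaffine functions\<close>

lemma finite_multiindices: "finite (multiindices n (k :: 'm::finite \<Rightarrow> nat))"
proof (rule finite_subset)
  show "multiindices n k \<subseteq> (UNIV :: 'm set) \<rightarrow>\<^sub>E {..n}"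
  proof
    fix \<alpha> assume "\<alpha> \<in> multiindices n k"
    then have "\<alpha> i \<le> n" for i
      using le_trans[OF _ div_le_dividend, of "\<alpha> i" n "k i"] by (simp add: multiindices_def)
    then show "\<alpha> \<in> UNIV \<rightarrow>\<^sub>E {..n}" by (simp add: PiE_UNIV_domain)
  qed
  show "finite ((UNIV :: 'm set) \<rightarrow>\<^sub>E {..n})" by (intro finite_PiE) simp_all
qed

text \<open>As \<open>L\<close> is linear on the subspace only, its representative is written down
  in the spanning family of decomposable forms. The family lists every ordering of a multiindex,
  hence the factor \<open>fact d\<close>.\<close>

lemma Lambda_riesz:
  assumes "\<And>x y. x \<in> Lambda d \<Longrightarrow> y \<in> Lambda d \<Longrightarrow> L (x + y) = L x + L y"
    and "\<And>r x. x \<in> Lambda d \<Longrightarrow> L (r *\<^sub>R x) = r * L x"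
  shows "\<exists>c \<in> Lambda d. \<forall>x\<in>Lambda d. (L x :: real) = (c :: 'n::finite form) \<bullet> x"
proof (intro bexI ballI)
  let ?I = "{is :: 'n list. distinct is \<and> length is = d}"
  let ?e = "\<lambda>is. dec (basis_vecs is) :: 'n form"
  have e: "?e is \<in> Lambda d" if "is \<in> ?I" for "is" using that dec_Lambda[of "basis_vecs is"] by simp
  have fin: "finite ?I" by (rule finite_subset[OF _ finite_distinct]) auto
  show "(\<Sum>is\<in>?I. (L (?e is) / fact d) *\<^sub>R ?e is) \<in> Lambda d"
    by (intro subspace_sum subspace_scale subspace_Lambda e)
  fix x :: "'n form" assume x: "x \<in> Lambda d"
  have L0: "L 0 = 0" using assms(2)[OF subspace_0[OF subspace_Lambda], of 0] by simp
  have sum: "L (\<Sum>is\<in>I. c is *\<^sub>R ?e is) = (\<Sum>is\<in>I. c is * L (?e is))" if "I \<subseteq> ?I" for I c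
    using finite_subset[OF that fin] that
  proof (induction I rule: finite_induct)
    case (insert i I)
    have "(\<Sum>is\<in>I. c is *\<^sub>R ?e is) \<in> Lambda d" "?e i \<in> Lambda d"
      using insert(4) by (blast intro: subspace_sum subspace_scale subspace_Lambda e)+
    then show ?case
      using insert by (simp add: assms subspace_scale subspace_Lambda)
  qed (simp add: L0)
  have "L x = (\<Sum>is\<in>?I. (form_app x (basis_vecs is) / fact d) * L (?e is))"
    using Lambda_eq_sum_dec[OF x] sum[OF order_refl, of "\<lambda>is. form_app x (basis_vecs is) / fact d"] by simp
  also have "\<dots> = (\<Sum>is\<in>?I. (L (?e is) / fact d) *\<^sub>R ?e is) \<bullet> x"
    by (subst inner_commute) (simp add: inner_sum_right inner_dec mult.commute)
  finally show "L x = (\<Sum>is\<in>?I. (L (?e is) / fact d) *\<^sub>R ?e is) \<bullet> x" .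
qed

text \<open>Homogeneity is affinity on the line through the origin; additivity follows by doubling
  the midpoint of \<open>X\<close> and \<open>Y\<close>.\<close>

lemma affine_on_T_space_linear_part:
  fixes F :: "(('m::finite \<Rightarrow> nat) \<Rightarrow> 'n::finite form) \<Rightarrow> real"
  assumes F: "affine_on_T_space k F" and X: "X \<in> T_space k" and Y: "Y \<in> T_space k"
  shows "F (\<lambda>\<alpha>. r *\<^sub>R X \<alpha>) - F (\<lambda>_. 0) = r * (F X - F (\<lambda>_. 0))"
    and "F (\<lambda>\<alpha>. X \<alpha> + Y \<alpha>) - F (\<lambda>_. 0) = (F X - F (\<lambda>_. 0)) + (F Y - F (\<lambda>_. 0))"
proof -
  have aff: "F (\<lambda>\<alpha>. (1 - t) *\<^sub>R X \<alpha> + t *\<^sub>R Y \<alpha>) = (1 - t) * F X + t * F Y"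
    if "X \<in> T_space k" "Y \<in> T_space k" for X Y t
    using F that by (auto simp: affine_on_T_space_def)
  have T0: "(\<lambda>_. 0) \<in> T_space k" by (simp add: T_space_def subspace_0 subspace_Lambda)
  have sc: "F (\<lambda>\<alpha>. r *\<^sub>R X \<alpha>) - F (\<lambda>_. 0) = r * (F X - F (\<lambda>_. 0))" if "X \<in> T_space k" for r X
    using aff[OF T0 that, of r] by (simp add: algebra_simps)
  show "F (\<lambda>\<alpha>. r *\<^sub>R X \<alpha>) - F (\<lambda>_. 0) = r * (F X - F (\<lambda>_. 0))" by (rule sc[OF X])
  define Z where "Z = (\<lambda>\<alpha>. (1 - 1/2) *\<^sub>R X \<alpha> + (1/2) *\<^sub>R Y \<alpha>)"
  have Z: "Z \<in> T_space k" using X Y 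
    by (auto simp: T_space_def Z_def intro!: subspace_add subspace_scale subspace_Lambda)
  have XY: "(\<lambda>\<alpha>. X \<alpha> + Y \<alpha>) = (\<lambda>\<alpha>. 2 *\<^sub>R Z \<alpha>)" by (simp add: Z_def scaleR_right_distrib)
  show "F (\<lambda>\<alpha>. X \<alpha> + Y \<alpha>) - F (\<lambda>_. 0) = (F X - F (\<lambda>_. 0)) + (F Y - F (\<lambda>_. 0))"
    using sc[OF Z, of 2] aff[OF X Y, of "1/2"] unfolding XY Z_def by simp
qed

lemma multi_power_Lambda:
  fixes \<xi> :: "'n::finite form ^ 'm::{finite,linorder}"
  assumes "\<xi> \<in> Lambda_prod k"
  shows "multi_power \<xi> \<alpha> \<in> Lambda (wdeg k \<alpha>)"
proof -
  have "sum_list (map k (concat (map (\<lambda>i. replicate (\<alpha> i) i) is))) = sum_list (map (\<lambda>i. k i * \<alpha> i) is)" for "is" :: "'m list"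
    by (induction "is") (simp_all add: sum_list_replicate)
  then have "sum_list (map k (index_list \<alpha>)) = wdeg k \<alpha>"
    unfolding index_list_def wdeg_def
    by (simp add: sum_list_distinct_conv_sum_set)
  then show ?thesis using wedge_list_Lambda[OF assms, of "index_list \<alpha>"] by (simp add: multi_power_eq)
qed

lemma multi_power_0:
  assumes "\<forall>i. 1 \<le> k i" "wdeg k \<alpha> = 0"
  shows "multi_power \<xi> \<alpha> = one_form"
proof -
  have "k i * \<alpha> i = 0" for i using assms(2) by (simp add: wdeg_def)
  moreover have "k i \<noteq> 0" for i using spec[OF assms(1), of i] by linarith
  ultimately have "\<alpha> i = 0" for i by simp
  then have "index_list \<alpha> = []" by (simp add: index_list_def)
  then show ?thesis by (simp add: multi_power_eq)
qed

lemma T_vec_T_space: "\<xi> \<in> Lambda_prod k \<Longrightarrow> T_vec k \<xi> \<in> T_space k"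
  by (simp add: T_space_def T_vec_def multi_power_Lambda)

definition power_expansion ::
  "('m::{finite,linorder} \<Rightarrow> nat) \<Rightarrow> ('n::finite form ^ 'm::{finite,linorder} \<Rightarrow> real) \<Rightarrow> bool" where
  "power_expansion k f \<longleftrightarrow> (\<exists>c :: ('m::{finite,linorder} \<Rightarrow> nat) \<Rightarrow> 'n::finite form.
              (\<forall>\<alpha>\<in>multiindices CARD('n) k. c \<alpha> \<in> Lambda (wdeg k \<alpha>)) \<and>
              (\<forall>\<xi>\<in>Lambda_prod k.
                 f \<xi> = (\<Sum>\<alpha>\<in>multiindices CARD('n) k. c \<alpha> \<bullet> multi_power \<xi> \<alpha>)))"

lemma power_expansion_imp_polyaffine:
  fixes f :: "'n::finite form ^ 'm::{finite,linorder} \<Rightarrow> real"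
  assumes k: "\<forall>i. 1 \<le> k i" and "power_expansion k f"
  shows "ext_polyaffine k f"
proof -
  let ?M = "multiindices CARD('n) k" and ?P = "pos_multiindices CARD('n) k"
  obtain c :: "('m \<Rightarrow> nat) \<Rightarrow> 'n form" where
    f: "\<And>\<xi>. \<xi> \<in> Lambda_prod k \<Longrightarrow> f \<xi> = (\<Sum>\<alpha>\<in>?M. c \<alpha> \<bullet> multi_power \<xi> \<alpha>)"
    using assms(2) unfolding power_expansion_def by blast
  \<comment> \<open>The term of degree 0 does not appear in \<open>T_vec\<close>; it is the constant
    part of the affine function.\<close>
  define F where "F X = (\<Sum>\<alpha>\<in>?M. if \<alpha> \<in> ?P then c \<alpha> \<bullet> X \<alpha> else c \<alpha> \<bullet> one_form)" for X
  have "affine_on_T_space k F"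
    unfolding affine_on_T_space_def F_def
    unfolding sum_distrib_left sum.distrib[symmetric]
    by (intro ballI allI sum.cong refl) (simp add: inner_add_right algebra_simps)
  moreover have "f \<xi> = F (T_vec k \<xi>)" if "\<xi> \<in> Lambda_prod k" for \<xi>
    unfolding f[OF that] F_def
  proof (intro sum.cong refl)
    fix \<alpha> assume a: "\<alpha> \<in> ?M"
    show "c \<alpha> \<bullet> multi_power \<xi> \<alpha> = (if \<alpha> \<in> ?P then c \<alpha> \<bullet> T_vec k \<xi> \<alpha> else c \<alpha> \<bullet> one_form)"
    proof (cases "\<alpha> \<in> ?P")
      case False
      then have "wdeg k \<alpha> = 0" using a by (simp add: pos_multiindices_def)
      then show ?thesis using False by (simp add: multi_power_0[OF k])
    qed (simp add: T_vec_def)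
  qed
  ultimately show ?thesis unfolding ext_polyaffine_def by blast
qed

lemma polyaffine_imp_power_expansion:
  fixes f :: "'n::finite form ^ 'm::{finite,linorder} \<Rightarrow> real"
  assumes k: "\<forall>i. 1 \<le> k i" and "ext_polyaffine k f"
  shows "power_expansion k f"
proof -
  let ?M = "multiindices CARD('n) k" and ?P = "pos_multiindices CARD('n) k"
  obtain F where F: "affine_on_T_space k F" and f: "\<And>\<xi>. \<xi> \<in> Lambda_prod k \<Longrightarrow> f \<xi> = F (T_vec k \<xi>)"
    using assms(2) unfolding ext_polyaffine_def by blast
  \<comment> \<open>Families with one nonzero component; on each of them the linear part of
    \<open>F\<close> is represented by a form.\<close>
  define single where "single \<alpha> x = (\<lambda>\<beta>. if \<beta> = \<alpha> then x else 0)" for \<alpha> :: "'m \<Rightarrow> nat" and x :: "'n form"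
  define L where "L X = F X - F (\<lambda>_. 0)" for X
  have T0: "(\<lambda>_. 0) \<in> T_space k" by (simp add: T_space_def subspace_0 subspace_Lambda)
  have single: "single \<alpha> x \<in> T_space k" if "\<alpha> \<in> ?P" "x \<in> Lambda (wdeg k \<alpha>)" for \<alpha> x
    using that by (auto simp: T_space_def single_def subspace_0 subspace_Lambda)
  note L = affine_on_T_space_linear_part[OF F, folded L_def]
  have "\<exists>c. c \<in> Lambda (wdeg k \<alpha>) \<and> (\<forall>x\<in>Lambda (wdeg k \<alpha>). L (single \<alpha> x) = c \<bullet> x)" if \<alpha>: "\<alpha> \<in> ?P" for \<alpha>
  proof -
    have sc: "L (single \<alpha> (r *\<^sub>R x)) = r * L (single \<alpha> x)" if x: "x \<in> Lambda (wdeg k \<alpha>)" for x r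
    proof -
      have "single \<alpha> (r *\<^sub>R x) = (\<lambda>\<beta>. r *\<^sub>R single \<alpha> x \<beta>)" by (auto simp: single_def)
      then show ?thesis
        using L(1)[OF single[OF \<alpha> x] T0] by simp
    qed
    have ad: "L (single \<alpha> (x + y)) = L (single \<alpha> x) + L (single \<alpha> y)"
      if x: "x \<in> Lambda (wdeg k \<alpha>)" and y: "y \<in> Lambda (wdeg k \<alpha>)" for x y
    proof -
      have "single \<alpha> (x + y) = (\<lambda>\<beta>. single \<alpha> x \<beta> + single \<alpha> y \<beta>)" by (auto simp: single_def)
      then show ?thesis
        using L(2)[OF single[OF \<alpha> x] single[OF \<alpha> y]] by simp
    qed
    show ?thesis
      using Lambda_riesz[of "wdeg k \<alpha>" "\<lambda>x. L (single \<alpha> x)", OF ad sc] by (simp add: Bex_def)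
  qed
  then have "\<exists>c. \<forall>\<alpha>\<in>?P. c \<alpha> \<in> Lambda (wdeg k \<alpha>) \<and> (\<forall>x\<in>Lambda (wdeg k \<alpha>). L (single \<alpha> x) = c \<alpha> \<bullet> x)"
    by (intro bchoice ballI)
  then obtain c where c: "\<And>\<alpha>. \<alpha> \<in> ?P \<Longrightarrow> c \<alpha> \<in> Lambda (wdeg k \<alpha>)"
    "\<And>\<alpha> x. \<alpha> \<in> ?P \<Longrightarrow> x \<in> Lambda (wdeg k \<alpha>) \<Longrightarrow> L (single \<alpha> x) = c \<alpha> \<bullet> x"
    by blast
  have fin: "finite ?M" by (rule finite_multiindices)
  have PM: "?P \<subseteq> ?M" by (auto simp: pos_multiindices_def)
  have LX: "L X = (\<Sum>\<alpha>\<in>?P. c \<alpha> \<bullet> X \<alpha>)" if X: "X \<in> T_space k" for X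
  proof -
    \<comment> \<open>Components are switched on one at a time over the finite set
      \<open>?P\<close>.\<close>
    have *: "L (\<lambda>\<beta>. if \<beta> \<in> A then X \<beta> else 0) = (\<Sum>\<alpha>\<in>A. c \<alpha> \<bullet> X \<alpha>)" if "A \<subseteq> ?P" for A
      using finite_subset[OF that finite_subset[OF PM fin]] that
    proof (induction A rule: finite_induct)
      case (insert \<alpha> A)
      have "(\<lambda>\<beta>. if \<beta> \<in> insert \<alpha> A then X \<beta> else 0)
          = (\<lambda>\<beta>. single \<alpha> (X \<alpha>) \<beta> + (if \<beta> \<in> A then X \<beta> else 0))"
        using insert(2) by (auto simp: single_def)
      moreover have "single \<alpha> (X \<alpha>) \<in> T_space k"
        using X insert(4) by (intro single) (auto simp: T_space_def)
      moreover have "(\<lambda>\<beta>. if \<beta> \<in> A then X \<beta> else 0) \<in> T_space k"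
        using X by (auto simp: T_space_def subspace_0 subspace_Lambda)
      moreover have "L (single \<alpha> (X \<alpha>)) = c \<alpha> \<bullet> X \<alpha>"
        using X insert(4) by (intro c) (auto simp: T_space_def)
      ultimately show ?case using L(2)[of "single \<alpha> (X \<alpha>)" "\<lambda>\<beta>. if \<beta> \<in> A then X \<beta> else 0"] insert
        by (simp add: insert)
    qed (simp add: L_def)
    have "X = (\<lambda>\<beta>. if \<beta> \<in> ?P then X \<beta> else 0)" using X by (auto simp: T_space_def)
    then show ?thesis using *[OF order_refl] by simp
  qed
  \<comment> \<open>The constant \<open>F (\<lambda>_. 0)\<close> becomes the coefficient of the
    zero multiindex, whose power is \<open>one_form\<close>, a form of norm 1.\<close>
  define d where "d \<alpha> = (if \<alpha> \<in> ?P then c \<alpha> else F (\<lambda>_. 0) *\<^sub>R one_form)" for \<alpha>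
  \<comment> \<open>All \<open>k i\<close> are positive, so weight 0 leaves only the zero
    multiindex.\<close>
  have zero_P: "?M - ?P = {\<lambda>_. 0}"
  proof (intro equalityI subsetI)
    fix \<alpha> assume "\<alpha> \<in> ?M - ?P"
    then have w: "wdeg k \<alpha> = 0" by (auto simp: pos_multiindices_def)
    have "\<alpha> i = 0" for i
    proof -
      have "k i * \<alpha> i = 0" using w by (simp add: wdeg_def)
      moreover have "k i \<noteq> 0" using spec[OF k, of i] by linarith
      ultimately show ?thesis by simp
    qed
    then show "\<alpha> \<in> {\<lambda>_. 0}" by (simp add: fun_eq_iff)
  qed (simp add: multiindices_def pos_multiindices_def wdeg_def)
  have one: "(one_form :: 'n form) \<bullet> one_form = 1"
    using inner_dec[of "one_form :: 'n form" "[]"] by (simp add: one_form.rep_eq)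
  have "f \<xi> = (\<Sum>\<alpha>\<in>?M. d \<alpha> \<bullet> multi_power \<xi> \<alpha>)" if \<xi>: "\<xi> \<in> Lambda_prod k" for \<xi>
  proof -
    have "(\<Sum>\<alpha>\<in>?M. d \<alpha> \<bullet> multi_power \<xi> \<alpha>)
        = (\<Sum>\<alpha>\<in>?P. d \<alpha> \<bullet> multi_power \<xi> \<alpha>) + (\<Sum>\<alpha>\<in>?M - ?P. d \<alpha> \<bullet> multi_power \<xi> \<alpha>)"
      using sum.subset_diff[OF PM fin] by (simp add: add.commute)
    also have "(\<Sum>\<alpha>\<in>?M - ?P. d \<alpha> \<bullet> multi_power \<xi> \<alpha>) = F (\<lambda>_. 0)"
    proof -
      have "(\<lambda>_. 0) \<notin> ?P" using zero_P by blast
      then show ?thesis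
        unfolding zero_P using multi_power_0[OF k, of "\<lambda>_. 0" \<xi>] by (simp add: d_def wdeg_def one)
    qed
    also have "(\<Sum>\<alpha>\<in>?P. d \<alpha> \<bullet> multi_power \<xi> \<alpha>) = L (T_vec k \<xi>)"
      unfolding LX[OF T_vec_T_space[OF \<xi>]] by (intro sum.cong) (simp_all add: d_def T_vec_def)
    finally show ?thesis by (simp add: f[OF \<xi>] L_def)
  qed
  moreover have "d \<alpha> \<in> Lambda (wdeg k \<alpha>)" if "\<alpha> \<in> ?M" for \<alpha>
  proof (cases "\<alpha> \<in> ?P")
    case False
    then have "wdeg k \<alpha> = 0" using that by (simp add: pos_multiindices_def)
    then show ?thesis using False by (simp add: d_def subspace_scale[OF subspace_Lambda one_form_Lambda])
  qed (simp add: d_def c)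
  ultimately show ?thesis unfolding power_expansion_def by blast
qed

section \<open>Functions which are affine along prescribed directions\<close>

definition fdiff :: "'a::real_vector \<Rightarrow> ('a \<Rightarrow> real) \<Rightarrow> 'a \<Rightarrow> real" where
  "fdiff v h x = h (x + v) - h x"

text \<open>\<open>V\<close> is the domain of interest, outside of which the function is arbitrary.
  \<open>R\<close> is just a set of directions: in the application it is a cone, and sums of
  directions belong to it only in special cases.\<close>

definition affine_along :: "'a::real_vector set \<Rightarrow> 'a set \<Rightarrow> ('a \<Rightarrow> real) \<Rightarrow> bool" where
  "affine_along V R h \<longleftrightarrow> (\<forall>x\<in>V. \<forall>v\<in>R. \<exists>p q. \<forall>t. h (x + t *\<^sub>R v) = p + q * t)"

lemma affine_along_eq:
  assumes "affine_along V R h" "x \<in> V" "v \<in> R"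
  shows "h (x + t *\<^sub>R v) = h x + t * fdiff v h x"
proof -
  obtain p q where pq: "\<And>t. h (x + t *\<^sub>R v) = p + q * t"
    using assms unfolding affine_along_def by blast
  show ?thesis using pq[of t] pq[of 0] pq[of 1] by (simp add: fdiff_def)
qed

lemma affine_alongI:
  assumes "\<And>x v t. x \<in> V \<Longrightarrow> v \<in> R \<Longrightarrow> h (x + t *\<^sub>R v) = h x + t * fdiff v h x"
  shows "affine_along V R h"
  unfolding affine_along_def
proof (intro ballI)
  fix x v assume "x \<in> V" "v \<in> R"
  then have "\<forall>t. h (x + t *\<^sub>R v) = h x + fdiff v h x * t" using assms by (simp add: mult.commute)
  then show "\<exists>p q. \<forall>t. h (x + t *\<^sub>R v) = p + q * t" by blast
qed

lemma fdiff_commute: "fdiff v (fdiff w h) = fdiff w (fdiff v h)"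
  by (rule ext) (simp add: fdiff_def add_ac)

lemma fdiff_scale:
  "affine_along V R h \<Longrightarrow> x \<in> V \<Longrightarrow> v \<in> R \<Longrightarrow> fdiff (t *\<^sub>R v) h x = t * fdiff v h x"
  using affine_along_eq[of V R h x v t] by (simp add: fdiff_def)

lemma affine_along_fdiff:
  assumes "affine_along V R h" "subspace V" "u \<in> V"
  shows "affine_along V R (fdiff u h)"
proof (rule affine_alongI)
  fix x v t assume x: "x \<in> V" "v \<in> R"
  then have "x + u \<in> V" using assms by (simp add: subspace_add)
  then show "fdiff u h (x + t *\<^sub>R v) = fdiff u h x + t * fdiff v (fdiff u h) x"
    using affine_along_eq[OF assms(1) x, of t] affine_along_eq[OF assms(1) _ x(2), of "x + u" t]
    by (simp add: fdiff_def algebra_simps)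
qed

text \<open>Along the diagonal \<open>t \<mapsto> x + t (v + w)\<close> the second difference is the coefficient of \<open>t\<^sup>2\<close>.\<close>

lemma fdiff_fdiff_eq_0:
  assumes h: "affine_along V R h" and V: "subspace V" and R: "R \<subseteq> V"
    and vw: "v \<in> R" "w \<in> R" "v + w \<in> R" and x: "x \<in> V"
  shows "fdiff v (fdiff w h) x = 0"
proof -
  \<comment> \<open>The value at \<open>x + 2 *\<^sub>R (v + w)\<close> is computed once along the
    diagonal and once along two sides of the parallelogram. The factor 2 matters: with 1 the
    comparison would be trivial.\<close>
  have 1: "h (x + 2 *\<^sub>R (v + w)) = h x + 2 * (h (x + (v + w)) - h x)"
    using affine_along_eq[OF h x vw(3), of 2] by (simp add: fdiff_def)
  have 2: "h (x + 2 *\<^sub>R v) = h x + 2 * (h (x + v) - h x)"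
    using affine_along_eq[OF h x vw(1), of 2] by (simp add: fdiff_def)
  have 3: "h ((x + w) + 2 *\<^sub>R v) = h (x + w) + 2 * (h ((x + w) + v) - h (x + w))"
    using affine_along_eq[OF h _ vw(1), of "x + w" 2] x vw R V by (simp add: fdiff_def subspace_add subsetD)
  have 4: "h ((x + 2 *\<^sub>R v) + 2 *\<^sub>R w) = h (x + 2 *\<^sub>R v) + 2 * (h ((x + 2 *\<^sub>R v) + w) - h (x + 2 *\<^sub>R v))"
    using affine_along_eq[OF h _ vw(2), of "x + 2 *\<^sub>R v" 2] x vw R V
    by (simp add: fdiff_def subspace_add subspace_scale subsetD)
  have e: "(x + 2 *\<^sub>R v) + 2 *\<^sub>R w = x + 2 *\<^sub>R (v + w)" "(x + 2 *\<^sub>R v) + w = (x + w) + 2 *\<^sub>R v"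
    "x + (v + w) = x + w + v" "x + v + w = x + w + v"
    by (simp_all add: algebra_simps)
  show ?thesis using 1 2 3 4 unfolding e fdiff_def by simp
qed

text \<open>The source of additivity of iterated differences in a single covector.\<close>

lemma fdiff_add:
  assumes "affine_along V R h" "subspace V" "R \<subseteq> V" "v \<in> R" "w \<in> R" "v + w \<in> R" "x \<in> V"
  shows "fdiff (v + w) h x = fdiff v h x + fdiff w h x"
  using fdiff_fdiff_eq_0[OF assms] by (simp add: fdiff_def add.assoc)

subsection \<open>Exponential formula for iterated differences\<close>

text \<open>The first-order operator whose exponential is the translation by
  \<open>\<Sum>p\<in>P. x p *\<^sub>R e p\<close> on functions affine along the \<open>e p\<close>.
  Its powers are formed with \<open>^^\<close>.\<close>

definition wdiff :: "('p \<Rightarrow> real) \<Rightarrow> ('p \<Rightarrow> 'a::real_vector) \<Rightarrow> 'p set \<Rightarrow> ('a \<Rightarrow> real) \<Rightarrow> 'a \<Rightarrow> real" where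
  "wdiff x e P h \<eta> = (\<Sum>p\<in>P. x p * fdiff (e p) h \<eta>)"

lemma wdiff_cmul_sum:
  "wdiff x e P (\<lambda>\<eta>. \<Sum>i\<in>I. c i * h i \<eta>) = (\<lambda>\<eta>. \<Sum>i\<in>I. c i * wdiff x e P (h i) \<eta>)"
proof
  fix \<eta>
  have "wdiff x e P (\<lambda>\<eta>. \<Sum>i\<in>I. c i * h i \<eta>) \<eta> = (\<Sum>p\<in>P. \<Sum>i\<in>I. c i * (x p * fdiff (e p) (h i) \<eta>))"
    by (simp add: wdiff_def fdiff_def sum_distrib_left algebra_simps flip: sum_subtractf)
  then show "wdiff x e P (\<lambda>\<eta>. \<Sum>i\<in>I. c i * h i \<eta>) \<eta> = (\<Sum>i\<in>I. c i * wdiff x e P (h i) \<eta>)"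
    by (subst (asm) sum.swap) (simp add: wdiff_def sum_distrib_left)
qed

lemma wdiff_pow_cmul_sum:
  "(wdiff x e P ^^ a) (\<lambda>\<eta>. \<Sum>i\<in>I. c i * h i \<eta>) = (\<lambda>\<eta>. \<Sum>i\<in>I. c i * (wdiff x e P ^^ a) (h i) \<eta>)"
  by (induction a) (simp_all add: wdiff_cmul_sum)

lemma wdiff_cong:
  assumes "\<And>z. z \<in> V \<Longrightarrow> h z = h' z" "subspace V" "e ` P \<subseteq> V" "y \<in> V"
  shows "wdiff x e P h y = wdiff x e P h' y"
  using assms by (auto simp: wdiff_def fdiff_def subspace_add intro!: sum.cong)

lemma fdiff_wdiff: "fdiff v (wdiff x e P h) = wdiff x e P (fdiff v h)"
  by (rule ext) (simp add: fdiff_def wdiff_def sum_subtractf[symmetric] algebra_simps)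

lemma wdiff_commute: "wdiff x e P (wdiff y e' Q h) = wdiff y e' Q (wdiff x e P h)"
proof -
  have "wdiff x e P (wdiff y e' Q h) = (\<lambda>\<eta>. \<Sum>p\<in>P. x p * wdiff y e' Q (fdiff (e p) h) \<eta>)"
    by (rule ext) (simp add: wdiff_def[of x] fdiff_wdiff)
  also have "\<dots> = wdiff y e' Q (wdiff x e P h)"
    unfolding wdiff_cmul_sum[symmetric] by (simp add: wdiff_def[of x, abs_def])
  finally show ?thesis .
qed

lemma wdiff_pow_commute: "(wdiff x e P ^^ a) (wdiff y e' Q h) = wdiff y e' Q ((wdiff x e P ^^ a) h)"
  by (induction a) (simp_all add: wdiff_commute[of x])

lemma affine_along_sum:
  assumes "\<And>i. i \<in> I \<Longrightarrow> affine_along V R (h i)"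
  shows "affine_along V R (\<lambda>\<eta>. \<Sum>i\<in>I. c i * h i \<eta>)"
proof (rule affine_alongI)
  fix y v t assume "y \<in> V" "v \<in> R"
  then have "(\<Sum>i\<in>I. c i * h i (y + t *\<^sub>R v)) = (\<Sum>i\<in>I. c i * (h i y + t * fdiff v (h i) y))"
    using affine_along_eq[OF assms] by simp
  also have "\<dots> = (\<Sum>i\<in>I. c i * h i y) + t * fdiff v (\<lambda>\<eta>. \<Sum>i\<in>I. c i * h i \<eta>) y"
    by (simp add: fdiff_def sum_distrib_left algebra_simps sum.distrib sum_subtractf)
  finally show "(\<Sum>i\<in>I. c i * h i (y + t *\<^sub>R v)) = (\<Sum>i\<in>I. c i * h i y) + t * fdiff v (\<lambda>\<eta>. \<Sum>i\<in>I. c i * h i \<eta>) y" .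
qed

lemma affine_along_wdiff:
  assumes "affine_along V R h" "subspace V" "e ` P \<subseteq> V"
  shows "affine_along V R (wdiff x e P h)"
  unfolding wdiff_def[abs_def] using assms by (auto intro!: affine_along_sum affine_along_fdiff)

lemma affine_along_wdiff_pow:
  assumes "affine_along V R h" "subspace V" "e ` P \<subseteq> V"
  shows "affine_along V R ((wdiff x e P ^^ a) h)"
  using assms by (induction a) (simp_all add: affine_along_wdiff)

text \<open>The binomial formula for two commuting operators, cut after the linear term because the
  difference in direction \<open>e q\<close> has square zero.\<close>

lemma wdiff_pow_insert:
  assumes h: "affine_along V R h" and V: "subspace V" and R: "R \<subseteq> V" and cone: "\<forall>v\<in>R. \<forall>t. t *\<^sub>R v \<in> R"
    and e: "e ` insert q P \<subseteq> R" and P: "finite P" "q \<notin> P" and y: "y \<in> V"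
  shows "(wdiff x e (insert q P) ^^ Suc a) h y
       = (wdiff x e P ^^ Suc a) h y + real (Suc a) * (wdiff x e P ^^ a) (wdiff x e {q} h) y"
  using y
proof (induction a arbitrary: y)
  case 0
  then show ?case using P by (simp add: wdiff_def)
next
  case (Suc a)
  let ?E = "wdiff x e P" and ?F = "wdiff x e (insert q P)" and ?y = "wdiff x e {q}"
  let ?g = "\<lambda>y. (?E ^^ Suc a) h y + real (Suc a) * (?E ^^ a) (?y h) y"
  have eV: "e ` insert q P \<subseteq> V" using e R by blast
  have "(?F ^^ Suc (Suc a)) h y = ?F ?g y"
    unfolding funpow.simps(2)[of "Suc a"] o_apply
    using Suc.IH V eV Suc.prems by (rule wdiff_cong)
  also have "\<dots> = ?y ?g y + ?E ?g y" using P by (simp add: wdiff_def)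
  \<comment> \<open>A combination of two functions is treated as a sum indexed by the
    booleans.\<close>
  also have "?E ?g y = (?E ^^ Suc (Suc a)) h y + real (Suc a) * (?E ^^ Suc a) (?y h) y"
    using wdiff_cmul_sum[of x e P "\<lambda>i. if i then 1 else real (Suc a)" "\<lambda>i. if i then (?E ^^ Suc a) h else (?E ^^ a) (?y h)" UNIV]
    by (simp add: UNIV_bool fun_eq_iff add_ac)
  also have "?y ?g y = ?y ((?E ^^ Suc a) h) y + real (Suc a) * ?y ((?E ^^ a) (?y h)) y"
    using wdiff_cmul_sum[of x e "{q}" "\<lambda>i. if i then 1 else real (Suc a)" "\<lambda>i. if i then (?E ^^ Suc a) h else (?E ^^ a) (?y h)" UNIV]
    by (simp add: UNIV_bool fun_eq_iff add_ac)
  also have "?y ((?E ^^ Suc a) h) = (?E ^^ Suc a) (?y h)"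
    by (rule wdiff_pow_commute[symmetric])
  \<comment> \<open>A repeated difference in direction \<open>e q\<close>: it vanishes because
    \<open>e q + e q\<close> lies in the cone again.\<close>
  also have "?y ((?E ^^ a) (?y h)) y = 0"
  proof -
    have "2 *\<^sub>R e q \<in> R" using cone e by auto
    then have "e q + e q \<in> R" by (simp only: scaleR_2)
    then have "fdiff (e q) (fdiff (e q) ((?E ^^ a) h)) y = 0"
      using eV e Suc.prems by (intro fdiff_fdiff_eq_0[OF affine_along_wdiff_pow[OF h V] V R]) auto
    moreover have "?y (?y g) y = x q * (x q * fdiff (e q) (fdiff (e q) g) y)" for g
      by (simp add: wdiff_def fdiff_def algebra_simps)
    ultimately show ?thesis by (simp add: wdiff_pow_commute)
  qed
  finally show ?case by (simp add: algebra_simps)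
qed

text \<open>For commuting operators with square zero, \<Prod> (1 + x_p \<Delta>_p) is exp(\<Sum> x_p
  \<Delta>_p), and powers beyond the number of operators vanish. The cut-off \<open>B\<close> is
  left free because the induction expands \<open>h\<close> and its difference to different
  orders.\<close>

lemma affine_along_exp:
  assumes P: "finite P" and V: "subspace V" and R: "R \<subseteq> V" and cone: "\<forall>v\<in>R. \<forall>t. t *\<^sub>R v \<in> R"
    and h: "affine_along V R h" and e: "e ` P \<subseteq> R" and y: "y \<in> V" and B: "card P \<le> B"
  shows "(\<forall>a>card P. (wdiff x e P ^^ a) h y = 0) \<and>
     h (y + (\<Sum>p\<in>P. x p *\<^sub>R e p)) = (\<Sum>a\<le>B. (wdiff x e P ^^ a) h y / fact a)"
  using P h e y B
proof (induction P arbitrary: h y B rule: finite_induct)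
  case empty
  have z: "(wdiff x e {} ^^ a) h y = 0" if "a > 0" for a
    using that by (cases a) (auto simp: wdiff_def)
  have "(\<Sum>a\<le>B. (wdiff x e {} ^^ a) h y / fact a) = (\<Sum>a\<in>{0}. (wdiff x e {} ^^ a) h y / fact a)"
    by (rule sum.mono_neutral_right) (auto simp: z)
  then show ?case using z by simp
next
  case (insert q P)
  let ?E = "wdiff x e P" and ?F = "wdiff x e (insert q P)" and ?g = "wdiff x e {q} h"
  have eV: "e ` insert q P \<subseteq> V" using insert.prems R by blast
  have g: "affine_along V R ?g" using insert.prems V eV by (intro affine_along_wdiff) auto
  note ins = wdiff_pow_insert[OF insert.prems(1) V R cone insert.prems(2) insert.hyps]
  have "(?F ^^ a) h z = 0" if "a > card (insert q P)" "z \<in> V" for a z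
  proof -
    have "a = Suc (a - 1)" "a - 1 > card P" using that insert.hyps by auto
    then obtain b where b: "a = Suc b" "b > card P" by blast
    have "(?E ^^ Suc b) h z = 0" "(?E ^^ b) ?g z = 0"
      using insert.IH[OF insert.prems(1), THEN conjunct1, rule_format, of z "card P" "Suc b"]
        insert.IH[OF g, THEN conjunct1, rule_format, of z "card P" b] b insert.prems that
      by (auto simp del: funpow.simps)
    then show ?thesis using ins[OF that(2), where x = x and a = b] b by simp
  qed
  moreover have "h (y + (\<Sum>p\<in>insert q P. x p *\<^sub>R e p)) = (\<Sum>a\<le>B. (?F ^^ a) h y / fact a)"
  proof -
    \<comment> \<open>The function \<open>?g\<close> is expanded to one order less than
      \<open>h\<close>, as one difference is already spent on the direction
      \<open>e q\<close>.\<close>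
    obtain C where C: "B = Suc C" "card P \<le> C" using insert.prems(4) insert.hyps by (cases B) auto
    have S: "(\<Sum>p\<in>P. x p *\<^sub>R e p) \<in> V" using eV V by (auto intro!: subspace_sum subspace_scale)
    have "h (y + (\<Sum>p\<in>insert q P. x p *\<^sub>R e p)) = h ((y + (\<Sum>p\<in>P. x p *\<^sub>R e p)) + x q *\<^sub>R e q)"
      using insert.hyps by (simp add: algebra_simps)
    also have "\<dots> = h (y + (\<Sum>p\<in>P. x p *\<^sub>R e p)) + ?g (y + (\<Sum>p\<in>P. x p *\<^sub>R e p))"
      using insert.prems S V by (subst affine_along_eq[OF insert.prems(1)]) (auto simp: subspace_add wdiff_def)
    also have "h (y + (\<Sum>p\<in>P. x p *\<^sub>R e p)) = (\<Sum>a\<le>Suc C. (?E ^^ a) h y / fact a)"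
      using insert.IH[OF insert.prems(1) _ insert.prems(3), of "Suc C"] insert.prems C by auto
    also have "\<dots> = h y + (\<Sum>a\<le>C. (?E ^^ Suc a) h y / fact (Suc a))"
      by (subst sum.atMost_Suc_shift) simp
    also have "?g (y + (\<Sum>p\<in>P. x p *\<^sub>R e p)) = (\<Sum>a\<le>C. (?E ^^ a) ?g y / fact a)"
      using insert.IH[OF g _ insert.prems(3) C(2)] insert.prems by auto
    \<comment> \<open>Order by order this is \<open>wdiff_pow_insert\<close>; its factor
      \<open>Suc a\<close> turns \<open>fact (Suc a)\<close> into \<open>fact a\<close>.\<close>
    also have "h y + (\<Sum>a\<le>C. (?E ^^ Suc a) h y / fact (Suc a)) + (\<Sum>a\<le>C. (?E ^^ a) ?g y / fact a)
       = h y + (\<Sum>a\<le>C. (?F ^^ Suc a) h y / fact (Suc a))"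
      unfolding ins[OF insert.prems(3)] add_divide_distrib sum.distrib by (simp add: fact_reduce del: of_nat_Suc)
    also have "\<dots> = (\<Sum>a\<le>Suc C. (?F ^^ a) h y / fact a)"
      by (subst sum.atMost_Suc_shift) simp
    finally show ?thesis using C by simp
  qed
  ultimately show ?case using insert.prems by blast
qed

subsection \<open>One affine functions\<close>

text \<open>One covector \<open>a\<close> serves all components. The set is a union of subspaces,
  one for each \<open>a\<close>, so a sum of two directions is a direction again when they share the
  covector.\<close>

definition wedge_dirs :: "('m::finite \<Rightarrow> nat) \<Rightarrow> ('n::finite form ^ 'm) set" where
  "wedge_dirs k = {v. \<exists>a\<in>Lambda 1. \<exists>\<beta>\<in>Lambda_prod (\<lambda>i. k i - 1). v = (\<chi> i. a \<and>\<^sub>\<Lambda> \<beta> $ i)}"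

lemma ext_one_affine_iff: "ext_one_affine k f \<longleftrightarrow> affine_along (Lambda_prod k) (wedge_dirs k) f"
proof -
  have "(\<chi> i. \<xi> $ i + t *\<^sub>R (a \<and>\<^sub>\<Lambda> \<beta> $ i)) = \<xi> + t *\<^sub>R (\<chi> i. a \<and>\<^sub>\<Lambda> \<beta> $ i)" for \<xi> \<beta> :: "'b form ^ 'a" and t a
    by (simp add: vec_eq_iff)
  then show ?thesis unfolding ext_one_affine_def affine_along_def wedge_dirs_def by simp blast
qed

lemma subspace_Lambda_prod: "subspace (Lambda_prod k)"
  using subspace_Lambda by (auto simp: subspace_def Lambda_prod_def)

lemma wedge_dirs_cone: "\<forall>v\<in>wedge_dirs k. \<forall>t. t *\<^sub>R v \<in> wedge_dirs k"
proof (intro ballI allI)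
  fix v t assume "v \<in> wedge_dirs k"
  then obtain a \<beta> where ab: "a \<in> Lambda 1" "\<beta> \<in> Lambda_prod (\<lambda>i. k i - 1)" "v = (\<chi> i. a \<and>\<^sub>\<Lambda> \<beta> $ i)"
    unfolding wedge_dirs_def by blast
  have "t *\<^sub>R v = (\<chi> i. a \<and>\<^sub>\<Lambda> (t *\<^sub>R \<beta>) $ i)" by (simp add: ab(3) vec_eq_iff wedge.scaleR_right)
  moreover have "t *\<^sub>R \<beta> \<in> Lambda_prod (\<lambda>i. k i - 1)" using ab(2) by (intro subspace_scale subspace_Lambda_prod)
  ultimately show "t *\<^sub>R v \<in> wedge_dirs k" using ab(1) unfolding wedge_dirs_def by blast
qed

lemma wedge_dirs_subset:
  assumes "\<forall>i. 1 \<le> k i"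
  shows "wedge_dirs k \<subseteq> Lambda_prod k"
proof
  fix v assume "v \<in> wedge_dirs k"
  then obtain a \<beta> where ab: "a \<in> Lambda 1" "\<beta> \<in> Lambda_prod (\<lambda>i. k i - 1)" "v = (\<chi> i. a \<and>\<^sub>\<Lambda> \<beta> $ i)"
    unfolding wedge_dirs_def by blast
  have "a \<and>\<^sub>\<Lambda> \<beta> $ i \<in> Lambda (k i)" for i
  proof -
    have "\<beta> $ i \<in> Lambda (k i - 1)" using ab(2) by (simp add: Lambda_prod_def)
    moreover have "1 + (k i - 1) = k i" using spec[OF assms, of i] by linarith
    ultimately show ?thesis using wedge_Lambda[OF ab(1), of "\<beta> $ i" "k i - 1"] by simp
  qed
  then show "v \<in> Lambda_prod k" by (simp add: ab(3) Lambda_prod_def)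
qed

lemma axis_Lambda_prod: "\<omega> \<in> Lambda (k i) \<Longrightarrow> axis i \<omega> \<in> Lambda_prod k"
  by (auto simp: Lambda_prod_def axis_def subspace_0 subspace_Lambda)

lemma axis_wedge: "axis i (a \<and>\<^sub>\<Lambda> \<beta>) = (\<chi> j. a \<and>\<^sub>\<Lambda> axis i \<beta> $ j)"
  by (auto simp: axis_def vec_eq_iff wedge.zero_right)

lemma axis_wedge_dirs:
  assumes "a \<in> Lambda 1" "\<beta> \<in> Lambda (k i - 1)"
  shows "axis i (a \<and>\<^sub>\<Lambda> \<beta>) \<in> wedge_dirs k"
  using axis_Lambda_prod[of \<beta> "\<lambda>i. k i - 1" i] assms unfolding axis_wedge wedge_dirs_def by blast

text \<open>Provides the condition on \<open>v + w\<close> in \<open>fdiff_fdiff_eq_0\<close>, also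
  for directions in two different components.\<close>

lemma axis_wedge_dirs_add:
  assumes "a \<in> Lambda 1" "\<beta> \<in> Lambda (k i - 1)" "\<gamma> \<in> Lambda (k j - 1)"
  shows "axis i (a \<and>\<^sub>\<Lambda> \<beta>) + axis j (a \<and>\<^sub>\<Lambda> \<gamma>) \<in> wedge_dirs k"
proof -
  have "axis i (a \<and>\<^sub>\<Lambda> \<beta>) + axis j (a \<and>\<^sub>\<Lambda> \<gamma>) = (\<chi> l. a \<and>\<^sub>\<Lambda> (axis i \<beta> + axis j \<gamma>) $ l)"
    by (simp add: axis_wedge vec_eq_iff wedge.add_right)
  moreover have "axis i \<beta> + axis j \<gamma> \<in> Lambda_prod (\<lambda>i. k i - 1)"
    using axis_Lambda_prod[of \<beta> "\<lambda>i. k i - 1" i] axis_Lambda_prod[of \<gamma> "\<lambda>i. k i - 1" j] assms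
    by (simp add: subspace_add subspace_Lambda_prod)
  ultimately show ?thesis using assms(1) unfolding wedge_dirs_def by blast
qed

lemma axis_dec_wedge_dirs:
  assumes "1 \<le> k i" "length vs = k i"
  shows "axis i (dec vs) \<in> wedge_dirs k"
proof -
  have "dec (tl vs) \<in> Lambda (k i - 1)" using dec_Lambda[of "tl vs"] assms by simp
  from axis_wedge_dirs[where i = i and k = k, OF covec_Lambda this, of "hd vs"] show ?thesis using assms by (cases vs) auto
qed

text \<open>The list \<open>vs\<close> is cut from the left into blocks of lengths
  \<open>k i\<close>, and each block contributes a difference in a decomposable direction. Keeping
  all covectors in one flat list makes the result comparable with a form.\<close>

fun block_diff :: "('m \<Rightarrow> nat) \<Rightarrow> ('n::finite form ^ 'm::finite \<Rightarrow> real) \<Rightarrow> 'm list \<Rightarrow> (real ^ 'n) list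
    \<Rightarrow> 'n form ^ 'm \<Rightarrow> real" where
  "block_diff k h [] vs = h"
| "block_diff k h (i # is) vs = fdiff (axis i (dec (take (k i) vs))) (block_diff k h is (drop (k i) vs))"

context
  fixes k :: "'m::finite \<Rightarrow> nat" and h :: "'n::finite form ^ 'm \<Rightarrow> real"
  assumes k: "\<forall>i. 1 \<le> k i" and h: "affine_along (Lambda_prod k) (wedge_dirs k) h"
begin

lemma affine_along_block_diff:
  "length vs = sum_list (map k is) \<Longrightarrow> affine_along (Lambda_prod k) (wedge_dirs k) (block_diff k h is vs)"
proof (induction "is" arbitrary: vs)
  case (Cons i "is")
  have "axis i (dec (take (k i) vs)) \<in> Lambda_prod k"
    using Cons.prems dec_Lambda[of "take (k i) vs"] by (intro axis_Lambda_prod) simp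
  then show ?case using Cons by (auto intro!: affine_along_fdiff subspace_Lambda_prod)
qed (simp add: h)

text \<open>The additional difference is commuted inwards until it meets the block that contains
  \<open>v\<close>; there two directions share a covector and their second difference is
  zero.\<close>

lemma block_diff_shared:
  assumes "length vs = sum_list (map k is)" "v \<in> set vs" "\<beta> \<in> Lambda (k j - 1)" "\<xi> \<in> Lambda_prod k"
  shows "fdiff (axis j (covec v \<and>\<^sub>\<Lambda> \<beta>)) (block_diff k h is vs) \<xi> = 0"
  using assms
proof (induction "is" arbitrary: vs \<xi>)
  case (Cons i "is")
  let ?g = "block_diff k h is (drop (k i) vs)"
  have len: "length (take (k i) vs) = k i" "length (drop (k i) vs) = sum_list (map k is)"
    using Cons.prems by auto
  have vs: "set vs = set (take (k i) vs) \<union> set (drop (k i) vs)" by (metis append_take_drop_id set_append)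
  show ?case
  proof (cases "v \<in> set (take (k i) vs)")
    case True
    then obtain \<gamma> where \<gamma>: "\<gamma> \<in> Lambda (k i - 1)" "dec (take (k i) vs) = covec v \<and>\<^sub>\<Lambda> \<gamma>"
      using dec_factor[of v "take (k i) vs"] len by auto
    show ?thesis unfolding block_diff.simps \<gamma>
      using Cons.prems \<gamma> covec_Lambda
      by (intro fdiff_fdiff_eq_0[OF affine_along_block_diff[OF len(2)] subspace_Lambda_prod wedge_dirs_subset[OF k]]
          axis_wedge_dirs axis_wedge_dirs_add)
  next
    case False
    then have v: "v \<in> set (drop (k i) vs)" using Cons.prems vs by blast
    have "axis i (dec (take (k i) vs)) \<in> Lambda_prod k"
      using len dec_Lambda[of "take (k i) vs"] by (intro axis_Lambda_prod) simp
    then have "\<xi> + axis i (dec (take (k i) vs)) \<in> Lambda_prod k"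
      using Cons.prems by (intro subspace_add subspace_Lambda_prod)
    then show ?thesis unfolding block_diff.simps
      using Cons.IH[OF len(2) v Cons.prems(3)] Cons.prems(4)
      by (subst fdiff_commute) (simp add: fdiff_def[of "axis i _"])
  qed
qed simp

text \<open>A repetition inside a block makes its decomposable form vanish; for a repetition across
  blocks the later block makes \<open>block_diff_shared\<close> applicable.\<close>

lemma block_diff_not_distinct:
  assumes "length vs = sum_list (map k is)" "\<not> distinct vs" "\<xi> \<in> Lambda_prod k"
  shows "block_diff k h is vs \<xi> = 0"
  using assms
proof (induction "is" arbitrary: vs \<xi>)
  case (Cons i "is")
  have len: "length (take (k i) vs) = k i" "length (drop (k i) vs) = sum_list (map k is)"
    using Cons.prems by auto
  have ax: "axis i (dec (take (k i) vs)) \<in> Lambda_prod k"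
    using len dec_Lambda[of "take (k i) vs"] by (intro axis_Lambda_prod) simp
  have "\<not> distinct (take (k i) vs) \<or> \<not> distinct (drop (k i) vs) \<or> set (take (k i) vs) \<inter> set (drop (k i) vs) \<noteq> {}"
    using Cons.prems(2) by (metis append_take_drop_id distinct_append)
  then consider "\<not> distinct (take (k i) vs)" | "\<not> distinct (drop (k i) vs)"
    | v where "v \<in> set (take (k i) vs)" "v \<in> set (drop (k i) vs)" by blast
  then show ?case
  proof cases
    case 1
    then show ?thesis by (simp add: dec_not_distinct fdiff_def axis_def flip: zero_vec_def)
  next
    case 2
    then show ?thesis using Cons.IH[OF len(2)] Cons.prems(3) ax
      by (simp add: fdiff_def subspace_add subspace_Lambda_prod)
  next
    case 3
    then obtain \<gamma> where \<gamma>: "\<gamma> \<in> Lambda (k i - 1)" "dec (take (k i) vs) = covec v \<and>\<^sub>\<Lambda> \<gamma>"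
      using dec_factor[of v "take (k i) vs"] len by auto
    then show ?thesis using block_diff_shared[OF len(2) 3(2)] Cons.prems by simp
  qed
qed simp

text \<open>In the block containing the variable vector, the directions belonging to
  \<open>v\<close>, \<open>w\<close> and \<open>v + w\<close> are all decomposable, so
  \<open>fdiff_add\<close> applies. A block in front of it only shifts the base point.\<close>

lemma linear_block_diff:
  assumes "length (us @ v # ws) = sum_list (map k is)" "\<xi> \<in> Lambda_prod k"
  shows "linear (\<lambda>v. block_diff k h is (us @ v # ws) \<xi>)"
  using assms
proof (induction "is" arbitrary: us \<xi>)
  case (Cons i "is")
  have len: "length (take (k i) (us @ v # ws)) = k i" "length (drop (k i) (us @ v # ws)) = sum_list (map k is)" for v
    using Cons.prems by auto
  show ?case
  proof (cases "length us < k i")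
    case True
    define g where "g = block_diff k h is (drop (k i) (us @ v # ws))"
    define ws' where "ws' = take (k i - length us - 1) ws"
    have tk: "take (k i) (us @ v # ws) = us @ v # ws'" for v
      using True by (cases "k i - length us") (auto simp: ws'_def)
    have "drop (k i) (us @ v' # ws) = drop (k i) (us @ v # ws)" for v'
      using True by (cases "k i - length us") auto
    then have eq: "block_diff k h (i # is) (us @ v' # ws) \<xi> = fdiff (axis i (dec (us @ v' # ws'))) g \<xi>" for v'
      unfolding block_diff.simps g_def tk by metis
    have g: "affine_along (Lambda_prod k) (wedge_dirs k) g"
      unfolding g_def by (rule affine_along_block_diff[OF len(2)])
    have R: "axis i (dec (us @ v' # ws')) \<in> wedge_dirs k" for v'
      using len(1)[of v'] k by (intro axis_dec_wedge_dirs) (simp_all add: tk del: take_append)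
    have lin: "linear (\<lambda>v. axis i (dec (us @ v # ws')))"
      by (intro linearI) (auto simp: axis_def vec_eq_iff linear_add[OF linear_dec] linear_scale[OF linear_dec])
    show ?thesis unfolding eq
    proof (rule linearI)
      fix v w :: "real ^ 'n" and r :: real
      show "fdiff (axis i (dec (us @ (v + w) # ws'))) g \<xi> =
         fdiff (axis i (dec (us @ v # ws'))) g \<xi> + fdiff (axis i (dec (us @ w # ws'))) g \<xi>"
        using fdiff_add[OF g subspace_Lambda_prod wedge_dirs_subset[OF k] R[of v] R[of w] _ Cons.prems(2)] R[of "v + w"]
        by (simp only: linear_add[OF lin])
      show "fdiff (axis i (dec (us @ (r *\<^sub>R v) # ws'))) g \<xi> = r *\<^sub>R fdiff (axis i (dec (us @ v # ws'))) g \<xi>"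
        using fdiff_scale[OF g Cons.prems(2) R[of v]] by (simp only: linear_scale[OF lin] real_scaleR_def)
    qed
  next
    case False
    define us' where "us' = drop (k i) us"
    let ?u = "axis i (dec (take (k i) us))"
    have d: "take (k i) (us @ v # ws) = take (k i) us" "drop (k i) (us @ v # ws) = us' @ v # ws" for v
      using False by (simp_all add: us'_def)
    have len': "length (us' @ v # ws) = sum_list (map k is)" using len(2)[of v] by (simp only: d)
    have u: "?u \<in> Lambda_prod k"
      using len(1) dec_Lambda[of "take (k i) us"] by (intro axis_Lambda_prod) (simp add: d del: take_append)
    show ?thesis unfolding block_diff.simps d fdiff_def
      using Cons.prems(2) u by (intro linear_compose_sub Cons.IH[OF len'] subspace_add subspace_Lambda_prod)
  qed
qed simp

text \<open>As a function of the covectors, the iterated difference in decomposable directions is alternating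
  across the blocks as well; it is thus a form, whose degree is the sum of the block lengths.\<close>

lemma ex_block_form:
  "\<exists>c\<in>Lambda (sum_list (map k is)). \<forall>vs. length vs = sum_list (map k is) \<longrightarrow> form_app c vs = block_diff k h is vs 0"
proof -
  define \<omega> where "\<omega> vs = (if length vs = sum_list (map k is) then block_diff k h is vs 0 else 0)" for vs
  have 0: "0 \<in> Lambda_prod k" by (rule subspace_0[OF subspace_Lambda_prod])
  have "alternating_multilinear \<omega>"
    unfolding alternating_multilinear_def
  proof (intro conjI allI impI)
    fix us vs :: "(real ^ 'n) list"
    show "linear (\<lambda>v. \<omega> (us @ v # vs))"
      using linear_block_diff[OF _ 0, of us 0 vs "is"]
      by (cases "length (us @ 0 # vs) = sum_list (map k is)") (simp_all add: \<omega>_def linear_zero)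
  qed (simp add: \<omega>_def block_diff_not_distinct[OF _ _ 0])
  then have "form_app (Abs_form \<omega>) = \<omega>" by (simp add: Abs_form_inverse)
  then show ?thesis by (intro bexI[of _ "Abs_form \<omega>"]) (auto simp: \<omega>_def Lambda_def)
qed

end

section \<open>Words in the indices and multiindices\<close>

lemma wedge_list_insort:
  "\<exists>s. \<forall>\<xi>\<in>(Lambda_prod k :: ('n::finite form ^ 'm::{finite,linorder}) set). \<xi> $ i \<and>\<^sub>\<Lambda> wedge_list \<xi> is = s *\<^sub>R wedge_list \<xi> (insort i is)"
  for k :: "'m::{finite,linorder} \<Rightarrow> nat"
proof (induction "is")
  case Nil
  show ?case by (intro exI[of _ 1]) simp
next
  case (Cons j "is")
  then obtain s where s: "\<And>\<xi> :: 'n form ^ 'm::{finite,linorder}. \<xi> \<in> Lambda_prod k \<Longrightarrow>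
    \<xi> $ i \<and>\<^sub>\<Lambda> wedge_list \<xi> is = s *\<^sub>R wedge_list \<xi> (insort i is)" by blast
  show ?case
  proof (cases "i \<le> j")
    case True
    then show ?thesis by (intro exI[of _ 1]) simp
  next
    case False
    have "\<xi> $ i \<and>\<^sub>\<Lambda> wedge_list \<xi> (j # is) = ((-1) ^ (k i * k j) * s) *\<^sub>R wedge_list \<xi> (insort i (j # is))"
      if "\<xi> \<in> Lambda_prod k" for \<xi> :: "'n form ^ 'm::{finite,linorder}"
    proof -
      have "\<xi> $ i \<in> Lambda (k i)" "\<xi> $ j \<in> Lambda (k j)" using that by (simp_all add: Lambda_prod_def)
      then have "\<xi> $ i \<and>\<^sub>\<Lambda> wedge_list \<xi> (j # is) = (-1) ^ (k i * k j) *\<^sub>R (\<xi> $ j \<and>\<^sub>\<Lambda> (\<xi> $ i \<and>\<^sub>\<Lambda> wedge_list \<xi> is))"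
        using wedge_commute[of "\<xi> $ i" "k i" "\<xi> $ j" "k j"]
        by (simp add: wedge_assoc[symmetric] wedge.scaleR_left)
      then show ?thesis using False s[OF that] by (simp add: wedge.scaleR_right)
    qed
    then show ?thesis by blast
  qed
qed

text \<open>The factor \<open>s\<close> is chosen before \<open>\<xi>\<close>: it comes from the
  word and the degrees alone and can therefore be moved into the coefficients.\<close>

lemma wedge_list_sort:
  "\<exists>s. \<forall>\<xi>\<in>(Lambda_prod k :: ('n::finite form ^ 'm::{finite,linorder}) set). wedge_list \<xi> is = s *\<^sub>R wedge_list \<xi> (sort is)"
  for k :: "'m::{finite,linorder} \<Rightarrow> nat"
proof (induction "is")
  case Nil
  show ?case by (intro exI[of _ 1]) simp
next
  case (Cons j "is")
  then obtain s where "\<And>\<xi> :: 'n form ^ 'm::{finite,linorder}. \<xi> \<in> Lambda_prod k \<Longrightarrow>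
    wedge_list \<xi> is = s *\<^sub>R wedge_list \<xi> (sort is)" by blast
  moreover obtain r where "\<And>\<xi> :: 'n form ^ 'm::{finite,linorder}. \<xi> \<in> Lambda_prod k \<Longrightarrow>
    \<xi> $ j \<and>\<^sub>\<Lambda> wedge_list \<xi> (sort is) = r *\<^sub>R wedge_list \<xi> (insort j (sort is))"
    using wedge_list_insort[of k j "sort is", where ?'n = 'n] by blast
  ultimately have "wedge_list \<xi> (j # is) = (s * r) *\<^sub>R wedge_list \<xi> (sort (j # is))"
    if "\<xi> \<in> Lambda_prod k" for \<xi> :: "'n form ^ 'm::{finite,linorder}" using that by (simp add: wedge.scaleR_right)
  then show ?case by blast
qed

lemma sort_eq_index_list: "sort is = index_list (count_list is)"
proof (rule properties_for_sort)
  have c: "count_list (concat (map (\<lambda>i. replicate (\<alpha> i) i) xs)) j = (if j \<in> set xs then \<alpha> j else 0)"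
    if "distinct xs" for xs :: "'a list" and \<alpha> j
  proof -
    have "count_list (replicate a i) j = (if i = j then a else 0)" for a and i :: 'a by (induction a) auto
    then show ?thesis using that by (induction xs) auto
  qed
  show "mset (index_list (count_list is)) = mset is"
    by (rule multiset_eqI) (simp add: count_mset c index_list_def)
  have "sorted (concat (map (\<lambda>i. replicate (\<alpha> i) i) xs))" if "sorted xs" for xs :: "'a list" and \<alpha>
    using that by (induction xs) (auto simp: sorted_append)
  then show "sorted (index_list (count_list is))" by (simp add: index_list_def)
qed

lemma wdeg_count_list: "wdeg k (count_list is) = sum_list (map k is)"
  by (simp add: wdeg_def sum_list_map_eq_sum_count2[of "is" UNIV] mult.commute)

lemma sum_lists_snoc:
  "(\<Sum>is | length is = a. \<Sum>i\<in>UNIV. g (is @ [i])) = (\<Sum>is :: 'm::finite list | length is = Suc a. g is)"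
proof -
  have fin: "finite {is :: 'm list. length is = a}" for a using finite_lists_length_eq[of "UNIV :: 'm set" a] by simp
  have "(\<Sum>is | length is = a. \<Sum>i\<in>UNIV. g (is @ [i])) = (\<Sum>(is, i)\<in>{is. length is = a} \<times> UNIV. g (is @ [i]))"
    by (simp add: sum.cartesian_product)
  also have "\<dots> = (\<Sum>is | length is = Suc a. g is)"
    by (rule sum.reindex_bij_witness[of _ "\<lambda>is. (butlast is, last is)" "\<lambda>(is, i). is @ [i]"])
       (auto simp: length_Suc_conv_rev)
  finally show ?thesis .
qed

text \<open>Every application of the operator puts one more block in front of \<open>qs\<close>.
  Summing over the ordered multiindices of this block reassembles \<xi>_i by
  \<open>Lambda_eq_sum_dec\<close>, and the letter i moves to the end of the word \<open>is\<close>.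
  The blocks \<open>qs\<close> are a parameter for the sake of the induction; the case of interest
  is \<open>qs = []\<close>.\<close>

lemma wdiff_pow_eq:
  fixes k :: "'m::finite \<Rightarrow> nat" and \<xi> :: "'n::finite form ^ 'm" and c :: "'m list \<Rightarrow> 'n form"
  assumes k: "\<forall>i. 1 \<le> k i" 
    and \<xi>: "\<xi> \<in> Lambda_prod k"
    and c: "\<And>is vs. length vs = sum_list (map k is) \<Longrightarrow> form_app (c is) vs = block_diff k h is vs 0"
  defines "P \<equiv> SIGMA i:UNIV. {js. distinct js \<and> length js = k i}"
    and "x \<equiv> \<lambda>(i, js). form_app (\<xi> $ i) (basis_vecs js) / fact (k i)"
    and "e \<equiv> \<lambda>(i, js). axis i (dec (basis_vecs js))"
  assumes qs: "set qs \<subseteq> P"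
  shows "(wdiff x e P ^^ a) (block_diff k h (map fst qs) (concat (map (basis_vecs \<circ> snd) qs))) 0
    = (\<Sum>is | length is = a. c (is @ map fst qs) \<bullet> (wedge_list \<xi> is \<and>\<^sub>\<Lambda> dec (concat (map (basis_vecs \<circ> snd) qs))))"
  using qs
proof (induction a arbitrary: qs)
  case 0
  have "length (concat (map (basis_vecs \<circ> snd) qs)) = sum_list (map k (map fst qs))"
    using 0 by (induction qs) (auto simp: P_def)
  from c[OF this] show ?case by (simp add: inner_dec o_def)
next
  case (Suc a)
  let ?B = "\<lambda>qs. concat (map (basis_vecs \<circ> snd) qs)"
  let ?G = "\<lambda>qs. block_diff k h (map fst qs) (?B qs)"
  have fin: "finite {js :: 'n list. distinct js \<and> length js = l}" for l
    by (rule finite_subset[OF _ finite_distinct]) auto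
  have "wdiff x e P (?G qs) = (\<lambda>\<eta>. \<Sum>p\<in>P. x p * ?G (p # qs) \<eta>)"
    by (auto simp: wdiff_def fun_eq_iff P_def e_def intro!: sum.cong)
  then have "(wdiff x e P ^^ Suc a) (?G qs) 0 = (\<Sum>p\<in>P. x p * (wdiff x e P ^^ a) (?G (p # qs)) 0)"
    by (simp only: funpow_Suc_right o_apply wdiff_pow_cmul_sum)
  also have "\<dots> = (\<Sum>p\<in>P. x p * (\<Sum>is | length is = a. c (is @ map fst (p # qs)) \<bullet> (wedge_list \<xi> is \<and>\<^sub>\<Lambda> dec (?B (p # qs)))))"
    using Suc by (intro sum.cong refl) (subst Suc.IH, auto)
  also have "\<dots> = (\<Sum>is | length is = a. \<Sum>p\<in>P. x p * (c (is @ map fst (p # qs)) \<bullet> (wedge_list \<xi> is \<and>\<^sub>\<Lambda> dec (?B (p # qs)))))"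
    by (simp only: sum_distrib_left) (rule sum.swap)
  also have "\<dots> = (\<Sum>is | length is = a. \<Sum>i\<in>UNIV. c ((is @ [i]) @ map fst qs) \<bullet> (wedge_list \<xi> (is @ [i]) \<and>\<^sub>\<Lambda> dec (?B qs)))"
  proof (intro sum.cong refl)
    fix "is" :: "'m list"
    have "(\<Sum>p\<in>P. x p * (c (is @ map fst (p # qs)) \<bullet> (wedge_list \<xi> is \<and>\<^sub>\<Lambda> dec (?B (p # qs)))))
      = (\<Sum>i\<in>UNIV. \<Sum>js | distinct js \<and> length js = k i. (form_app (\<xi> $ i) (basis_vecs js) / fact (k i)) *
           (c (is @ i # map fst qs) \<bullet> (wedge_list \<xi> is \<and>\<^sub>\<Lambda> (dec (basis_vecs js) \<and>\<^sub>\<Lambda> dec (?B qs)))))"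
      unfolding P_def by (subst sum.Sigma) (auto simp: fin x_def dec_append intro!: sum.cong)
    also have "\<dots> = (\<Sum>i\<in>UNIV. c (is @ i # map fst qs) \<bullet> (wedge_list \<xi> is \<and>\<^sub>\<Lambda>
        ((\<Sum>js | distinct js \<and> length js = k i. (form_app (\<xi> $ i) (basis_vecs js) / fact (k i)) *\<^sub>R dec (basis_vecs js)) \<and>\<^sub>\<Lambda> dec (?B qs))))"
      by (simp only: wedge.sum_left wedge.sum_right wedge.scaleR_left wedge.scaleR_right inner_sum_right inner_scaleR_right)
    also have "\<dots> = (\<Sum>i\<in>UNIV. c ((is @ [i]) @ map fst qs) \<bullet> (wedge_list \<xi> (is @ [i]) \<and>\<^sub>\<Lambda> dec (?B qs)))"
    proof (intro sum.cong refl)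
      fix i
      have "\<xi> $ i \<in> Lambda (k i)" using \<xi> by (simp add: Lambda_prod_def)
      from Lambda_eq_sum_dec[OF this, symmetric]
      show "c (is @ i # map fst qs) \<bullet> (wedge_list \<xi> is \<and>\<^sub>\<Lambda>
        ((\<Sum>js | distinct js \<and> length js = k i. (form_app (\<xi> $ i) (basis_vecs js) / fact (k i)) *\<^sub>R dec (basis_vecs js)) \<and>\<^sub>\<Lambda> dec (?B qs)))
        = c ((is @ [i]) @ map fst qs) \<bullet> (wedge_list \<xi> (is @ [i]) \<and>\<^sub>\<Lambda> dec (?B qs))"
        by (simp add: wedge_list_append wedge_assoc)
    qed
    finally show "(\<Sum>p\<in>P. x p * (c (is @ map fst (p # qs)) \<bullet> (wedge_list \<xi> is \<and>\<^sub>\<Lambda> dec (?B (p # qs)))))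
      = (\<Sum>i\<in>UNIV. c ((is @ [i]) @ map fst qs) \<bullet> (wedge_list \<xi> (is @ [i]) \<and>\<^sub>\<Lambda> dec (?B qs)))" .
  qed
  also have "\<dots> = (\<Sum>is | length is = Suc a. c (is @ map fst qs) \<bullet> (wedge_list \<xi> is \<and>\<^sub>\<Lambda> dec (?B qs)))"
    by (rule sum_lists_snoc)
  finally show ?case .
qed

lemma finite_fixed_length: "finite {is :: 'c::finite list. length is = a}"
  using finite_lists_length_eq[of "UNIV :: 'c set" a] by simp

lemma one_affine_imp_power_expansion:
  fixes k :: "'m::{finite,linorder} \<Rightarrow> nat" and f :: "'n::finite form ^ 'm::{finite,linorder} \<Rightarrow> real"
  assumes k: "\<forall>i. 1 \<le> k i" and "ext_one_affine k f"
  shows "\<exists>c :: ('m \<Rightarrow> nat) \<Rightarrow> 'n form.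
    (\<forall>\<alpha>\<in>multiindices CARD('n) k. c \<alpha> \<in> Lambda (wdeg k \<alpha>)) \<and>
    (\<forall>\<xi>\<in>Lambda_prod k. f \<xi> = (\<Sum>\<alpha>\<in>multiindices CARD('n) k. c \<alpha> \<bullet> multi_power \<xi> \<alpha>))"
proof -
  let ?M = "multiindices CARD('n) k"
  have f: "affine_along (Lambda_prod k) (wedge_dirs k) f" using assms(2) by (simp add: ext_one_affine_iff)
  have "\<forall>is. \<exists>c. c \<in> Lambda (sum_list (map k is)) \<and>
      (\<forall>vs. length vs = sum_list (map k is) \<longrightarrow> form_app c vs = block_diff k f is vs 0)"
    using ex_block_form[OF k f] by (simp add: Bex_def)
  from choice[OF this] obtain c where
    c: "\<And>is. c is \<in> Lambda (sum_list (map k is))"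
       "\<And>is vs. length vs = sum_list (map k is) \<Longrightarrow> form_app (c is) vs = block_diff k f is vs 0"
    by blast
  have "\<forall>is. \<exists>s. \<forall>\<xi>\<in>(Lambda_prod k :: (('n form, 'm) vec) set). wedge_list \<xi> is = s *\<^sub>R wedge_list \<xi> (sort is)"
    using wedge_list_sort[of k] by blast
  from choice[OF this] obtain s where
    s: "\<And>is \<xi>. \<xi> \<in> (Lambda_prod k :: (('n form, 'm) vec) set) \<Longrightarrow> wedge_list \<xi> is = s is *\<^sub>R wedge_list \<xi> (sort is)"
    by blast
  \<comment> \<open>Indices of the spanning directions: a component and an ordered multiindex. The
    coordinates \<open>x \<xi>\<close> carry \<open>1 / fact (k i)\<close> because each multiindex
    occurs in all its orderings.\<close>
  define P where "P = (SIGMA i:UNIV. {js :: 'n list. distinct js \<and> length js = k i})"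
  define e where "e = (\<lambda>(i, js). axis i (dec (basis_vecs js)) :: ('n form, 'm) vec)"
  define x where "x = (\<lambda>\<xi> :: ('n form, 'm) vec. \<lambda>(i, js). form_app (\<xi> $ i) (basis_vecs js) / fact (k i))"
  have finj: "finite {js :: 'n list. distinct js \<and> length js = l}" for l
    by (rule finite_subset[OF _ finite_distinct]) auto
  have finP: "finite P" unfolding P_def by (intro finite_SigmaI finj) simp
  have eR: "e ` P \<subseteq> wedge_dirs k"
  proof
    fix v assume "v \<in> e ` P"
    then obtain i js where "v = axis i (dec (basis_vecs js))" "length js = k i" by (auto simp: e_def P_def)
    then show "v \<in> wedge_dirs k" using k by (auto intro: axis_dec_wedge_dirs)
  qed
  have expand: "\<xi> = (\<Sum>p\<in>P. x \<xi> p *\<^sub>R e p)" if \<xi>: "\<xi> \<in> Lambda_prod k" for \<xi>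
  proof (subst vec_eq_iff, rule allI)
    fix l
    have "(\<Sum>p\<in>P. x \<xi> p *\<^sub>R e p) $ l = (\<Sum>i\<in>UNIV. \<Sum>js | distinct js \<and> length js = k i.
        (form_app (\<xi> $ i) (basis_vecs js) / fact (k i)) *\<^sub>R (axis i (dec (basis_vecs js)) :: ('n form, 'm) vec) $ l)"
      unfolding P_def by (subst sum.Sigma) (auto simp: finj x_def e_def intro!: sum.cong)
    also have "\<dots> = (\<Sum>i\<in>UNIV. if i = l then \<xi> $ l else 0)"
    proof (intro sum.cong refl)
      fix i
      have "\<xi> $ i \<in> Lambda (k i)" using \<xi> by (simp add: Lambda_prod_def)
      from Lambda_eq_sum_dec[OF this]
      show "(\<Sum>js | distinct js \<and> length js = k i.
        (form_app (\<xi> $ i) (basis_vecs js) / fact (k i)) *\<^sub>R (axis i (dec (basis_vecs js)) :: ('n form, 'm) vec) $ l)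
        = (if i = l then \<xi> $ l else 0)"
        by (auto simp: axis_def)
    qed
    finally show "\<xi> $ l = (\<Sum>p\<in>P. x \<xi> p *\<^sub>R e p) $ l" by simp
  qed
  \<comment> \<open>The exponential series stops at order \<open>card P\<close>, so longer words do
    not occur.\<close>
  define L where "L = {is :: 'm list. length is \<le> card P}"
  have L_eq: "L = (\<Union>a\<le>card P. {is. length is = a})" by (auto simp: L_def)
  have finL: "finite L" unfolding L_eq by (intro finite_UN_I finite_fixed_length) simp
  \<comment> \<open>The coefficient takes up the sign from sorting the word and the factorial of the
    exponential series.\<close>
  define d where "d is = (s is / fact (length is)) *\<^sub>R c is" for "is"
  have d: "d is \<in> Lambda (wdeg k (count_list is))" for "is"
    unfolding d_def wdeg_count_list by (intro subspace_scale subspace_Lambda c)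
  have f1: "f \<xi> = (\<Sum>is\<in>L. d is \<bullet> multi_power \<xi> (count_list is))" if \<xi>: "\<xi> \<in> Lambda_prod k" for \<xi>
  proof -
    have "f \<xi> = f (0 + (\<Sum>p\<in>P. x \<xi> p *\<^sub>R e p))" using expand[OF \<xi>] by simp
    also have "\<dots> = (\<Sum>a\<le>card P. (wdiff (x \<xi>) e P ^^ a) f 0 / fact a)"
      using affine_along_exp[OF finP subspace_Lambda_prod wedge_dirs_subset[OF k] wedge_dirs_cone f eR
        subspace_0[OF subspace_Lambda_prod] order_refl] by blast
    also have "\<dots> = (\<Sum>a\<le>card P. \<Sum>is | length is = a. d is \<bullet> multi_power \<xi> (count_list is))"
    proof (intro sum.cong refl)
      fix a
      have "(wdiff (x \<xi>) e P ^^ a) f 0 = (\<Sum>is | length is = a. c is \<bullet> wedge_list \<xi> is)"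
        using wdiff_pow_eq[OF k \<xi> c(2), of "[]" a] unfolding P_def x_def e_def by simp
      also have "\<dots> / fact a = (\<Sum>is | length is = a. d is \<bullet> multi_power \<xi> (count_list is))"
        unfolding sum_divide_distrib
      proof (intro sum.cong refl)
        fix "is" :: "'m list" assume "is \<in> {is. length is = a}"
        then show "c is \<bullet> wedge_list \<xi> is / fact a = d is \<bullet> multi_power \<xi> (count_list is)"
          using s[OF \<xi>, of "is"] by (simp add: d_def multi_power_eq sort_eq_index_list)
      qed
      finally show "(wdiff (x \<xi>) e P ^^ a) f 0 / fact a = (\<Sum>is | length is = a. d is \<bullet> multi_power \<xi> (count_list is))" .
    qed
    also have "\<dots> = (\<Sum>is\<in>L. d is \<bullet> multi_power \<xi> (count_list is))"
      unfolding L_eq by (rule sum.UNION_disjoint[symmetric]) (auto simp: finite_fixed_length)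
    finally show ?thesis .
  qed
  \<comment> \<open>Words with the same letter counts have the same sorted product; their
    coefficients are collected.\<close>
  define C where "C \<alpha> = (\<Sum>is | is \<in> L \<and> count_list is = \<alpha>. d is)" for \<alpha>
  have "C \<alpha> \<in> Lambda (wdeg k \<alpha>)" for \<alpha>
    unfolding C_def using d by (intro subspace_sum subspace_Lambda) auto
  moreover have "f \<xi> = (\<Sum>\<alpha>\<in>?M. C \<alpha> \<bullet> multi_power \<xi> \<alpha>)" if \<xi>: "\<xi> \<in> Lambda_prod k" for \<xi>
  proof -
    define L' where "L' = {is \<in> L. count_list is \<in> ?M}"
    have "f \<xi> = (\<Sum>is\<in>L'. d is \<bullet> multi_power \<xi> (count_list is))"
      unfolding f1[OF \<xi>]
    proof (rule sum.mono_neutral_right[OF finL])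
      show "L' \<subseteq> L" by (auto simp: L'_def)
      show "\<forall>is\<in>L - L'. d is \<bullet> multi_power \<xi> (count_list is) = 0"
      proof
        fix "is" assume "is \<in> L - L'"
        then have nM: "count_list is \<notin> ?M" by (auto simp: L'_def)
        \<comment> \<open>A total degree of at most \<open>CARD('n)\<close> already forces the
          bounds on the single exponents. An inadmissible count therefore means too large a degree,
          and the product vanishes.\<close>
        have "wdeg k (count_list is) > CARD('n)"
        proof (rule ccontr)
          assume "\<not> wdeg k (count_list is) > CARD('n)"
          then have le: "wdeg k (count_list is) \<le> CARD('n)" by simp
          have "count_list is i \<le> CARD('n) div k i" for i
          proof -
            have "k i * count_list is i \<le> wdeg k (count_list is)"
              unfolding wdeg_def by (rule member_le_sum) auto
            then show ?thesis using le spec[OF k, of i]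
              by (subst less_eq_div_iff_mult_less_eq) (auto simp: mult.commute)
          qed
          then show False using le nM by (simp add: multiindices_def)
        qed
        then have "multi_power \<xi> (count_list is) = 0"
          by (rule Lambda_eq_0[OF multi_power_Lambda[OF \<xi>]])
        then show "d is \<bullet> multi_power \<xi> (count_list is) = 0" by simp
      qed
    qed
    also have "\<dots> = (\<Sum>\<alpha>\<in>?M. \<Sum>is | is \<in> L' \<and> count_list is = \<alpha>. d is \<bullet> multi_power \<xi> (count_list is))"
      using finL by (intro sum.group[symmetric] finite_multiindices) (auto simp: L'_def)
    also have "\<dots> = (\<Sum>\<alpha>\<in>?M. C \<alpha> \<bullet> multi_power \<xi> \<alpha>)"
      unfolding C_def inner_sum_left by (intro sum.cong) (auto simp: L'_def)
    finally show ?thesis .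
  qed
  ultimately show ?thesis by blast
qed

section \<open>Smooth functions\<close>

lemma frechet_derivative_eq: "(f has_derivative f') (at x) \<Longrightarrow> frechet_derivative f (at x) = f'"
  by (rule frechet_derivative_at[symmetric])

lemma partial_eqI: "(\<phi> has_derivative d) (at x) \<Longrightarrow> partial j \<phi> x = d (axis j 1)"
  unfolding partial_def by (simp add: frechet_derivative_eq)

lemma Ck_Suc_D: "Ck (Suc r) \<phi> \<Longrightarrow> Ck r \<phi>"
proof (induction r arbitrary: \<phi>)
  case 0
  then show ?case by (auto simp: continuous_on_eq_continuous_at differentiable_imp_continuous_within)
next
  case (Suc r)
  then show ?case by simp
qed

definition smooth :: "(real ^ 'n::finite \<Rightarrow> 'b::real_normed_vector) \<Rightarrow> bool" where
  "smooth \<phi> \<longleftrightarrow> (\<forall>r. Ck r \<phi>)"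

lemma smooth_differentiable: "smooth \<phi> \<Longrightarrow> \<phi> differentiable (at x)"
  using Ck.simps(2)[of 0 \<phi>] by (simp add: smooth_def del: Ck.simps(1))

lemma smooth_has_derivative: "smooth \<phi> \<Longrightarrow> (\<phi> has_derivative frechet_derivative \<phi> (at x)) (at x)"
  using smooth_differentiable frechet_derivative_works by blast

lemma smooth_partial: "smooth \<phi> \<Longrightarrow> smooth (partial j \<phi>)"
  unfolding smooth_def using Ck.simps(2) by blast

lemma smooth_continuous: "smooth \<phi> \<Longrightarrow> continuous_on S \<phi>"
  unfolding smooth_def using Ck.simps(1) continuous_on_subset by blast

lemma Ck_const: "Ck r (\<lambda>_ :: real ^ 'n::finite. c)"
proof (induction r arbitrary: c)
  case (Suc r)
  have "partial j (\<lambda>_ :: real ^ 'n. c) = (\<lambda>_. 0)" for j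
    by (rule ext) (simp add: partial_eqI[OF has_derivative_const])
  then show ?case using Suc[of 0] by simp
qed (simp add: continuous_on_const)

lemma Ck_add: "Ck r \<phi> \<Longrightarrow> Ck r \<psi> \<Longrightarrow> Ck r (\<lambda>x. \<phi> x + \<psi> x)"
proof (induction r arbitrary: \<phi> \<psi>)
  case (Suc r)
  have "partial j (\<lambda>x. \<phi> x + \<psi> x) = (\<lambda>x. partial j \<phi> x + partial j \<psi> x)" for j
    using Suc.prems
    by (intro ext partial_eqI[THEN trans] has_derivative_add[of \<phi> "frechet_derivative \<phi> (at x)" _ \<psi> "frechet_derivative \<psi> (at x)" for x])
       (auto simp: partial_def frechet_derivative_works)
  then show ?case using Suc by (simp add: differentiable_add)
qed (simp add: continuous_on_add)

text \<open>One product rule for all products in use: multiplication of reals, scalar multiples and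
  the exterior product.\<close>

lemma Ck_bilinear:
  assumes "bounded_bilinear B"
  shows "Ck r \<phi> \<Longrightarrow> Ck r \<psi> \<Longrightarrow> Ck r (\<lambda>x. B (\<phi> x) (\<psi> x))"
proof (induction r arbitrary: \<phi> \<psi>)
  case 0
  then show ?case by (simp add: bounded_bilinear.continuous_on[OF assms])
next
  case (Suc r)
  have d: "((\<lambda>x. B (\<phi> x) (\<psi> x)) has_derivative
     (\<lambda>h. B (\<phi> x) (frechet_derivative \<psi> (at x) h) + B (frechet_derivative \<phi> (at x) h) (\<psi> x))) (at x)" for x
    using Suc.prems by (intro bounded_bilinear.FDERIV[OF assms]) (auto simp: frechet_derivative_works)
  have "partial j (\<lambda>x. B (\<phi> x) (\<psi> x)) = (\<lambda>x. B (\<phi> x) (partial j \<psi> x) + B (partial j \<phi> x) (\<psi> x))" for j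
    by (rule ext, subst partial_eqI[OF d]) (simp add: partial_def)
  moreover have "(\<lambda>x. B (\<phi> x) (\<psi> x)) differentiable (at x)" for x using d differentiable_def by blast
  ultimately show ?case using Suc.prems Suc.IH Ck_Suc_D[OF Suc.prems(1)] Ck_Suc_D[OF Suc.prems(2)]
    by (auto intro!: Ck_add)
qed

lemma smooth_const: "smooth (\<lambda>_. c)"
  by (simp add: smooth_def Ck_const)

lemma smooth_add: "smooth \<phi> \<Longrightarrow> smooth \<psi> \<Longrightarrow> smooth (\<lambda>x. \<phi> x + \<psi> x)"
  by (simp add: smooth_def Ck_add)

lemma smooth_bilinear: "bounded_bilinear B \<Longrightarrow> smooth \<phi> \<Longrightarrow> smooth \<psi> \<Longrightarrow> smooth (\<lambda>x. B (\<phi> x) (\<psi> x))"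
  by (simp add: smooth_def Ck_bilinear)

lemma smooth_linear:
  assumes "bounded_linear L" "smooth \<phi>"
  shows "smooth (\<lambda>x. L (\<phi> x))"
proof -
  \<comment> \<open>A linear map is made bilinear by a scalar factor, which is then the constant
    function 1.\<close>
  have "bounded_bilinear (\<lambda>(r::real) y. r *\<^sub>R L y)"
    using bounded_bilinear.comp[OF bounded_bilinear_scaleR bounded_linear_ident assms(1)] .
  from smooth_bilinear[OF this smooth_const[of 1] assms(2)] show ?thesis by simp
qed

lemma partial_bilinear:
  assumes "bounded_bilinear B" "smooth \<phi>" "smooth \<psi>"
  shows "partial j (\<lambda>x. B (\<phi> x) (\<psi> x)) x = B (\<phi> x) (partial j \<psi> x) + B (partial j \<phi> x) (\<psi> x)"
  using partial_eqI[OF bounded_bilinear.FDERIV[OF assms(1) smooth_has_derivative[OF assms(2)] smooth_has_derivative[OF assms(3)]]]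
  by (simp add: partial_def)

lemma partial_add:
  assumes "smooth \<phi>" "smooth \<psi>"
  shows "partial j (\<lambda>x. \<phi> x + \<psi> x) x = partial j \<phi> x + partial j \<psi> x"
  using partial_eqI[OF has_derivative_add[OF smooth_has_derivative[OF assms(1)] smooth_has_derivative[OF assms(2)]]]
  by (simp add: partial_def)

lemma partial_linear:
  assumes "bounded_linear L" "smooth \<phi>"
  shows "partial j (\<lambda>x. L (\<phi> x)) x = L (partial j \<phi> x)"
  using partial_eqI[OF bounded_linear.has_derivative[OF assms(1) smooth_has_derivative[OF assms(2)]]]
  by (simp add: partial_def)

lemma partial_const: "partial j (\<lambda>_. c) x = 0"
  by (simp add: partial_eqI[OF has_derivative_const])

lemma smooth_sum: "(\<And>i. i \<in> I \<Longrightarrow> smooth (\<phi> i)) \<Longrightarrow> smooth (\<lambda>x. \<Sum>i\<in>I. \<phi> i x)"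
  by (induction I rule: infinite_finite_induct) (auto intro: smooth_const smooth_add)

lemma smooth_prod: "(\<And>i. i \<in> I \<Longrightarrow> smooth (\<phi> i)) \<Longrightarrow> smooth (\<lambda>x. \<Prod>i\<in>I. \<phi> i x :: real)"
  by (induction I rule: infinite_finite_induct) (auto intro: smooth_const smooth_bilinear[OF bounded_bilinear_mult])

lemma partial_line:
  assumes "smooth \<phi>"
  shows "((\<lambda>t. \<phi> (x + t *\<^sub>R axis j 1)) has_vector_derivative partial j \<phi> (x + t *\<^sub>R axis j 1)) (at t within S)"
proof -
  have "((\<lambda>t. \<phi> (x + t *\<^sub>R axis j 1)) has_derivative
      (\<lambda>h. frechet_derivative \<phi> (at (x + t *\<^sub>R axis j 1)) (h *\<^sub>R axis j 1))) (at t within S)"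
    by (rule has_derivative_compose[OF _ smooth_has_derivative[OF assms], where f = "\<lambda>t. x + t *\<^sub>R axis j 1"])
       (auto intro!: derivative_eq_intros)
  moreover have "linear (frechet_derivative \<phi> (at y))" for y
    using has_derivative_linear[OF smooth_has_derivative[OF assms]] .
  ultimately show ?thesis
    unfolding has_vector_derivative_def partial_def by (simp add: linear_scale)
qed

subsection \<open>Symmetry of second derivatives\<close>

text \<open>The second difference of \<open>\<phi>\<close> over a square of side h equals, by the
  mean value theorem applied twice, h^2 times a mixed second derivative at an intermediate point, in
  either order of differentiation. Continuity gives the claim as h tends to 0.\<close>

lemma partial_partial_real:
  fixes \<phi> :: "real ^ 'n::finite \<Rightarrow> real"
  assumes "smooth \<phi>"
  shows "partial i (partial j \<phi>) x = partial j (partial i \<phi>) x"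
proof -
  let ?e = "\<lambda>i. axis i 1 :: real ^ 'n"
  define \<Delta> where "\<Delta> h = \<phi> (x + h *\<^sub>R ?e i + h *\<^sub>R ?e j) - \<phi> (x + h *\<^sub>R ?e i) - \<phi> (x + h *\<^sub>R ?e j) + \<phi> x" for h
  have step: "\<exists>s\<in>{0<..<h}. \<exists>t\<in>{0<..<h}. \<phi> (x + h *\<^sub>R ?e i + h *\<^sub>R ?e j) - \<phi> (x + h *\<^sub>R ?e i) - \<phi> (x + h *\<^sub>R ?e j) + \<phi> x
      = h * h * partial j (partial i \<phi>) (x + s *\<^sub>R ?e i + t *\<^sub>R ?e j)" if "h > 0" for h i j
  proof -
    have "((\<lambda>s. \<phi> (x + h *\<^sub>R ?e j + s *\<^sub>R ?e i) - \<phi> (x + s *\<^sub>R ?e i)) has_real_derivative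
        partial i \<phi> (x + h *\<^sub>R ?e j + s *\<^sub>R ?e i) - partial i \<phi> (x + s *\<^sub>R ?e i)) (at s)" for s
      unfolding has_real_derivative_iff_has_vector_derivative
      by (intro has_vector_derivative_diff partial_line assms)
    from MVT2[OF that this] obtain s where s: "0 < s" "s < h" and 1:
      "(\<phi> (x + h *\<^sub>R ?e j + h *\<^sub>R ?e i) - \<phi> (x + h *\<^sub>R ?e i)) - (\<phi> (x + h *\<^sub>R ?e j + 0 *\<^sub>R ?e i) - \<phi> (x + 0 *\<^sub>R ?e i))
       = (h - 0) * (partial i \<phi> (x + h *\<^sub>R ?e j + s *\<^sub>R ?e i) - partial i \<phi> (x + s *\<^sub>R ?e i))" by blast
    have "((\<lambda>t. partial i \<phi> (x + s *\<^sub>R ?e i + t *\<^sub>R ?e j)) has_real_derivative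
        partial j (partial i \<phi>) (x + s *\<^sub>R ?e i + t *\<^sub>R ?e j)) (at t)" for t
      unfolding has_real_derivative_iff_has_vector_derivative
      by (intro partial_line smooth_partial assms)
    from MVT2[OF that this] obtain t where t: "0 < t" "t < h" and 2:
      "partial i \<phi> (x + s *\<^sub>R ?e i + h *\<^sub>R ?e j) - partial i \<phi> (x + s *\<^sub>R ?e i + 0 *\<^sub>R ?e j)
       = (h - 0) * partial j (partial i \<phi>) (x + s *\<^sub>R ?e i + t *\<^sub>R ?e j)" by blast
    show ?thesis using s t 1 2 by (intro bexI[of _ s] bexI[of _ t]) (simp_all add: add_ac algebra_simps)
  qed
  have lim: "(\<lambda>n. \<psi> (x + s n *\<^sub>R ?e i + t n *\<^sub>R ?e j)) \<longlonglongrightarrow> \<psi> x"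
    if "continuous_on UNIV \<psi>" "\<And>n. s n \<in> {0<..<inverse (real (Suc n))}" "\<And>n. t n \<in> {0<..<inverse (real (Suc n))}"
    for \<psi> :: "real ^ 'n \<Rightarrow> real" and s t i j
  proof -
    have "s \<longlonglongrightarrow> 0" "t \<longlonglongrightarrow> 0"
      using that(2,3) by (auto intro!: tendsto_sandwich[OF _ _ tendsto_const LIMSEQ_inverse_real_of_nat] less_imp_le always_eventually)
    then have "(\<lambda>n. x + s n *\<^sub>R ?e i + t n *\<^sub>R ?e j) \<longlonglongrightarrow> x + 0 *\<^sub>R ?e i + 0 *\<^sub>R ?e j"
      by (intro tendsto_intros)
    moreover have "isCont \<psi> x" using that(1) by (simp add: continuous_on_eq_continuous_at)
    ultimately show ?thesis using isCont_tendsto_compose[of x \<psi>] by simp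
  qed
  let ?h = "\<lambda>n. inverse (real (Suc n))"
  have "\<forall>n. \<exists>s t. s \<in> {0<..<?h n} \<and> t \<in> {0<..<?h n} \<and> \<Delta> (?h n) = ?h n * ?h n * partial j (partial i \<phi>) (x + s *\<^sub>R ?e i + t *\<^sub>R ?e j)"
    unfolding \<Delta>_def using step[of "?h n" i j for n] by fastforce
  then obtain s t where st: "\<And>n. s n \<in> {0<..<?h n}" "\<And>n. t n \<in> {0<..<?h n}"
    "\<And>n. \<Delta> (?h n) = ?h n * ?h n * partial j (partial i \<phi>) (x + s n *\<^sub>R ?e i + t n *\<^sub>R ?e j)" by metis
  have "\<forall>n. \<exists>s t. s \<in> {0<..<?h n} \<and> t \<in> {0<..<?h n} \<and> \<Delta> (?h n) = ?h n * ?h n * partial i (partial j \<phi>) (x + s *\<^sub>R ?e j + t *\<^sub>R ?e i)"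
  proof
    fix n
    have "\<Delta> (?h n) = \<phi> (x + ?h n *\<^sub>R ?e j + ?h n *\<^sub>R ?e i) - \<phi> (x + ?h n *\<^sub>R ?e j) - \<phi> (x + ?h n *\<^sub>R ?e i) + \<phi> x"
      by (simp add: \<Delta>_def add_ac)
    then show "\<exists>s t. s \<in> {0<..<?h n} \<and> t \<in> {0<..<?h n} \<and> \<Delta> (?h n) = ?h n * ?h n * partial i (partial j \<phi>) (x + s *\<^sub>R ?e j + t *\<^sub>R ?e i)"
      using step[of "?h n" j i] by fastforce
  qed
  then obtain s' t' where st': "\<And>n. s' n \<in> {0<..<?h n}" "\<And>n. t' n \<in> {0<..<?h n}"
    "\<And>n. \<Delta> (?h n) = ?h n * ?h n * partial i (partial j \<phi>) (x + s' n *\<^sub>R ?e j + t' n *\<^sub>R ?e i)" by metis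
  \<comment> \<open>Both sides are the same second difference divided by the square of the
    side.\<close>
  have "partial j (partial i \<phi>) (x + s n *\<^sub>R ?e i + t n *\<^sub>R ?e j) = partial i (partial j \<phi>) (x + s' n *\<^sub>R ?e j + t' n *\<^sub>R ?e i)" for n
    using st(3)[of n] st'(3)[of n] by simp
  then have "(\<lambda>n. partial j (partial i \<phi>) (x + s n *\<^sub>R ?e i + t n *\<^sub>R ?e j)) \<longlonglongrightarrow> partial i (partial j \<phi>) x"
    using lim[OF smooth_continuous[OF smooth_partial[OF smooth_partial[OF assms]]] st'(1,2)] by simp
  moreover have "(\<lambda>n. partial j (partial i \<phi>) (x + s n *\<^sub>R ?e i + t n *\<^sub>R ?e j)) \<longlonglongrightarrow> partial j (partial i \<phi>) x"
    by (rule lim[OF smooth_continuous[OF smooth_partial[OF smooth_partial[OF assms]]] st(1,2)])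
  ultimately show ?thesis using LIMSEQ_unique by blast
qed

lemma partial_partial:
  fixes \<phi> :: "real ^ 'n::finite \<Rightarrow> 'b::euclidean_space"
  assumes "smooth \<phi>"
  shows "partial i (partial j \<phi>) x = partial j (partial i \<phi>) x"
proof (rule euclidean_eqI)
  fix b :: 'b
  have "partial i (partial j (\<lambda>x. \<phi> x \<bullet> b)) x = partial i (partial j \<phi>) x \<bullet> b" for i j
  proof -
    have "partial j (\<lambda>x. \<phi> x \<bullet> b) = (\<lambda>x. partial j \<phi> x \<bullet> b)"
      by (rule ext) (rule partial_linear[OF bounded_linear_inner_left assms])
    then show ?thesis using partial_linear[OF bounded_linear_inner_left smooth_partial[OF assms]] by simp
  qed
  then show "partial i (partial j \<phi>) x \<bullet> b = partial j (partial i \<phi>) x \<bullet> b"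
    using partial_partial_real[OF smooth_linear[OF bounded_linear_inner_left assms, of b]] by metis
qed

section \<open>Test functions and integration by parts\<close>

lemma lebesgue_open [intro]: "open S \<Longrightarrow> S \<in> sets lebesgue" 
  by (simp add: sets_completionI_sets)

lemma test_functionsD:
  assumes "\<phi> \<in> test_functions \<Omega>"
  shows "smooth \<phi>" "compact (closure {x. \<phi> x \<noteq> 0})" "closure {x. \<phi> x \<noteq> 0} \<subseteq> \<Omega>"
  using assms by (auto simp: test_functions_def smooth_def)

lemma test_functionsI:
  assumes "smooth \<phi>" "compact K" "K \<subseteq> \<Omega>" "\<And>x. x \<notin> K \<Longrightarrow> \<phi> x = 0"
  shows "\<phi> \<in> test_functions \<Omega>"
proof -
  have sub: "closure {x. \<phi> x \<noteq> 0} \<subseteq> K"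
    using assms(4) by (intro closure_minimal compact_imp_closed assms(2)) auto
  then have "compact (closure {x. \<phi> x \<noteq> 0})"
    using compact_Int_closed[OF assms(2) closed_closure, of "{x. \<phi> x \<noteq> 0}"] by (simp add: inf.absorb2)
  then show ?thesis using sub assms by (auto simp: test_functions_def smooth_def)
qed

lemma test_functions_support:
  assumes "\<phi> \<in> test_functions \<Omega>"
  shows "\<exists>K. compact K \<and> K \<subseteq> \<Omega> \<and> (\<forall>x. x \<notin> K \<longrightarrow> \<phi> x = 0)"
  using test_functionsD(2,3)[OF assms] closure_subset[of "{x. \<phi> x \<noteq> 0}"]
  by (intro exI[of _ "closure {x. \<phi> x \<noteq> 0}"]) auto

lemma test_functions_partial:
  assumes "\<phi> \<in> test_functions \<Omega>"
  shows "partial j \<phi> \<in> test_functions \<Omega>"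
proof -
  obtain K where K: "compact K" "K \<subseteq> \<Omega>" "\<And>x. x \<notin> K \<Longrightarrow> \<phi> x = 0"
    using test_functions_support[OF assms] by blast
  have "partial j \<phi> x = 0" if "x \<notin> K" for x
  proof -
    have "(\<phi> has_derivative (\<lambda>_. 0)) (at x)"
      by (rule has_derivative_transform_within_open[of "\<lambda>_. 0" _ _ _ "- K"])
         (use that K compact_imp_closed[OF K(1)] in auto)
    then show ?thesis by (simp add: partial_eqI)
  qed
  with K show ?thesis using test_functionsD(1)[OF assms] by (intro test_functionsI[of _ K]) (auto intro: smooth_partial)
qed

lemma test_functions_bilinear:
  assumes "\<phi> \<in> test_functions \<Omega>" "smooth \<psi>" and B: "bounded_bilinear B"
  shows "(\<lambda>x. B (\<phi> x) (\<psi> x)) \<in> test_functions \<Omega>"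
proof -
  obtain K where K: "compact K" "K \<subseteq> \<Omega>" "\<And>x. x \<notin> K \<Longrightarrow> \<phi> x = 0"
    using test_functions_support[OF assms(1)] by blast
  show ?thesis
    using K smooth_bilinear[OF B test_functionsD(1)[OF assms(1)] assms(2)]
    by (intro test_functionsI[of _ K]) (simp_all add: bounded_bilinear.zero_left[OF B])
qed

lemma test_functions_linear:
  assumes "bounded_linear L" "\<phi> \<in> test_functions \<Omega>"
  shows "(\<lambda>x. L (\<phi> x)) \<in> test_functions \<Omega>"
proof -
  obtain K where K: "compact K" "K \<subseteq> \<Omega>" "\<And>x. x \<notin> K \<Longrightarrow> \<phi> x = 0"
    using test_functions_support[OF assms(2)] by blast
  show ?thesis using K smooth_linear[OF assms(1) test_functionsD(1)[OF assms(2)]]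
    by (intro test_functionsI[of _ K]) (simp_all add: linear_0[OF bounded_linear.linear[OF assms(1)]])
qed

lemma test_functions_bounded:
  assumes "\<phi> \<in> test_functions \<Omega>"
  shows "\<exists>C\<ge>0. \<forall>x. norm (\<phi> x) \<le> C"
proof -
  obtain K where K: "compact K" "\<And>x. x \<notin> K \<Longrightarrow> \<phi> x = 0"
    using test_functions_support[OF assms] by blast
  have "bounded (\<phi> ` K)"
    using K(1) smooth_continuous[OF test_functionsD(1)[OF assms]] by (intro compact_imp_bounded compact_continuous_image)
  then obtain C where "\<forall>y\<in>\<phi> ` K. norm y \<le> C" by (auto simp: bounded_iff)
  then have "norm (\<phi> x) \<le> max 0 C" for x using K(2)[of x] by (cases "x \<in> K") (auto simp: le_max_iff_disj)
  then show ?thesis by (intro exI[of _ "max 0 C"]) simp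
qed

lemma smooth_measurable: 
  fixes \<phi> :: "real ^ 'n::finite \<Rightarrow> 'b::euclidean_space"
  shows "smooth \<phi> \<Longrightarrow> \<phi> \<in> borel_measurable borel"
  by (intro borel_measurable_continuous_onI smooth_continuous)

lemma test_functions_integrable:
  fixes \<phi> :: "real ^ 'n::finite \<Rightarrow> 'b::euclidean_space"
  assumes "\<phi> \<in> test_functions \<Omega>"
  shows "integrable lborel \<phi>"
proof -
  obtain K where K: "compact K" "\<And>x. x \<notin> K \<Longrightarrow> \<phi> x = 0"
    using test_functions_support[OF assms] by blast
  have "integrable lborel (\<lambda>x. indicator K x *\<^sub>R \<phi> x)"
    using K(1) smooth_continuous[OF test_functionsD(1)[OF assms]] by (rule borel_integrable_compact)
  moreover have "(\<lambda>x. indicator K x *\<^sub>R \<phi> x) = \<phi>" using K(2) by (auto simp: indicator_def fun_eq_iff)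
  ultimately show ?thesis by simp
qed

lemma test_functions_integrable_on:
  fixes \<phi> :: "real ^ 'n::finite \<Rightarrow> 'b::euclidean_space"
  assumes "\<phi> \<in> test_functions \<Omega>" "S \<in> sets lebesgue"
  shows "integrable (lebesgue_on S) \<phi>"
proof -
  have "integrable lebesgue \<phi>"
    using test_functions_integrable[OF assms(1)] smooth_measurable[OF test_functionsD(1)[OF assms(1)]]
    by (subst integrable_completion) simp_all
  then have "integrable lebesgue (\<lambda>x. indicator S x *\<^sub>R \<phi> x)" using assms(2) by (intro integrable_mult_indicator)
  then show ?thesis using assms(2) by (subst integrable_restrict_space) auto
qed

lemma test_functions_integral_on:
  fixes \<phi> :: "real ^ 'n::finite \<Rightarrow> 'b::euclidean_space"
  assumes "\<phi> \<in> test_functions \<Omega>" "\<Omega> \<in> sets lebesgue"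
  shows "(\<integral>x. \<phi> x \<partial>lebesgue_on \<Omega>) = (\<integral>x. \<phi> x \<partial>lborel)"
proof -
  obtain K where K: "compact K" "K \<subseteq> \<Omega>" "\<And>x. x \<notin> K \<Longrightarrow> \<phi> x = 0"
    using test_functions_support[OF assms(1)] by blast
  have "(\<integral>x. \<phi> x \<partial>lebesgue_on \<Omega>) = (\<integral>x. indicator \<Omega> x *\<^sub>R \<phi> x \<partial>lebesgue)"
    using assms(2) by (subst integral_restrict_space) auto
  also have "(\<lambda>x. indicator \<Omega> x *\<^sub>R \<phi> x) = \<phi>" using K by (auto simp: indicator_def fun_eq_iff)
  finally show ?thesis
    using smooth_measurable[OF test_functionsD(1)[OF assms(1)]] by (simp add: integral_completion)
qed

text \<open>Difference quotients have integral zero by translation invariance.\<close>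

lemma integral_partial_lborel:
  fixes \<phi> :: "real ^ 'n::finite \<Rightarrow> 'b::euclidean_space"
  assumes "\<phi> \<in> test_functions \<Omega>"
  shows "(\<integral>x. partial j \<phi> x \<partial>lborel) = 0"
proof -
  let ?e = "axis j 1 :: real ^ 'n"
  let ?h = "\<lambda>n. inverse (real (Suc n))"
  note sm = test_functionsD(1)[OF assms]
  have meas: "\<phi> \<in> borel_measurable borel" by (rule smooth_measurable[OF sm])
  define s where "s n x = (\<phi> (x + ?h n *\<^sub>R ?e) - \<phi> x) /\<^sub>R ?h n" for n x
  obtain K where K: "compact K" "\<And>x. x \<notin> K \<Longrightarrow> \<phi> x = 0"
    using test_functions_support[OF assms] by blast
  obtain r where r: "K \<subseteq> cball 0 r" using compact_imp_bounded[OF K(1)]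
    by (auto simp: bounded_iff subset_iff)
  obtain C where C: "0 \<le> C" "\<And>x. norm (partial j \<phi> x) \<le> C"
    using test_functions_bounded[OF test_functions_partial[OF assms]] by blast
  have trans: "(\<integral>x. \<phi> (x + c) \<partial>lborel) = (\<integral>x. \<phi> x \<partial>lborel)" for c
    using integral_distr[of "(+) c" lborel borel \<phi>] meas by (simp add: lborel_distr_plus add.commute)
  have itrans: "integrable lborel (\<lambda>x. \<phi> (x + c))" for c
    using integrable_distr_eq[of "(+) c" lborel borel \<phi>] meas test_functions_integrable[OF assms]
    by (simp add: lborel_distr_plus add.commute)
  have zero: "(\<integral>x. s n x \<partial>lborel) = 0" for n
    unfolding s_def using itrans test_functions_integrable[OF assms]
    by (simp add: Bochner_Integration.integral_diff trans)
  \<comment> \<open>Since the steps have length at most 1, every quotient vanishes outside the ball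
    of radius \<open>r + 1\<close>; inside, the mean value theorem bounds it by \<open>C\<close>.
    This is the majorant for dominated convergence.\<close>
  have "(\<lambda>n. \<integral>x. s n x \<partial>lborel) \<longlonglongrightarrow> (\<integral>x. partial j \<phi> x \<partial>lborel)"
  proof (rule integral_dominated_convergence[where w = "\<lambda>x. C * indicator (cball 0 (r + 1)) x"])
    show "partial j \<phi> \<in> borel_measurable lborel" using smooth_measurable[OF smooth_partial[OF sm]] by simp
    show "s n \<in> borel_measurable lborel" for n
      unfolding s_def using meas by measurable
    have "emeasure lborel (cball (0 :: real ^ 'n) (r + 1)) < \<infinity>" using emeasure_bounded_finite[OF bounded_cball] by auto
    then show "integrable lborel (\<lambda>x. C * indicator (cball 0 (r + 1) :: (real ^ 'n) set) x :: real)"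
      by (intro integrable_mult_right integrable_real_indicator) auto
    have "(\<lambda>n. s n x) \<longlonglongrightarrow> partial j \<phi> x" for x
    proof -
      have "((\<lambda>t. \<phi> (x + t *\<^sub>R ?e)) has_vector_derivative partial j \<phi> (x + 0 *\<^sub>R ?e)) (at 0)"
        by (rule partial_line[OF sm])
      then have "((\<lambda>t. norm (\<phi> (x + t *\<^sub>R ?e) - \<phi> x - t *\<^sub>R partial j \<phi> x) / norm t) \<longlongrightarrow> 0) (at 0)"
        by (simp add: has_vector_derivative_def has_derivative_at)
      moreover have "norm ((\<phi> (x + t *\<^sub>R ?e) - \<phi> x) /\<^sub>R t - partial j \<phi> x)
          = norm (\<phi> (x + t *\<^sub>R ?e) - \<phi> x - t *\<^sub>R partial j \<phi> x) / norm t" if "t \<noteq> 0" for t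
      proof -
        have "(\<phi> (x + t *\<^sub>R ?e) - \<phi> x) /\<^sub>R t - partial j \<phi> x
            = (\<phi> (x + t *\<^sub>R ?e) - \<phi> x - t *\<^sub>R partial j \<phi> x) /\<^sub>R t"
          using that by (simp add: scaleR_diff_right)
        then show ?thesis by (simp add: divide_inverse_commute)
      qed
      ultimately have "((\<lambda>t. norm ((\<phi> (x + t *\<^sub>R ?e) - \<phi> x) /\<^sub>R t - partial j \<phi> x)) \<longlongrightarrow> 0) (at 0)"
        by (subst tendsto_cong[where g = "\<lambda>t. norm (\<phi> (x + t *\<^sub>R ?e) - \<phi> x - t *\<^sub>R partial j \<phi> x) / norm t"])
           (auto simp: eventually_at_filter)
      then have "((\<lambda>t. (\<phi> (x + t *\<^sub>R ?e) - \<phi> x) /\<^sub>R t) \<longlongrightarrow> partial j \<phi> x) (at 0)"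
        by (simp add: tendsto_norm_zero_iff LIM_zero_iff)
      moreover have "filterlim ?h (at 0) sequentially"
        using LIMSEQ_inverse_real_of_nat by (auto simp: filterlim_at)
      ultimately show ?thesis unfolding s_def by (rule filterlim_compose)
    qed
    then show "AE x in lborel. (\<lambda>n. s n x) \<longlonglongrightarrow> partial j \<phi> x" by simp
    have "norm (s n x) \<le> C * indicator (cball 0 (r + 1)) x" for n x
    proof (cases "x \<in> cball 0 (r + 1)")
      case True
      have h: "0 < ?h n" by simp
      have "\<exists>t\<in>{0<..<?h n}. norm (\<phi> (x + ?h n *\<^sub>R ?e) - \<phi> (x + 0 *\<^sub>R ?e)) \<le> norm ((?h n - 0) *\<^sub>R partial j \<phi> (x + t *\<^sub>R ?e))"
        using partial_line[OF sm, of x j] unfolding has_vector_derivative_def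
        by (intro mvt_general[OF h, where f = "\<lambda>t. \<phi> (x + t *\<^sub>R ?e)" and f' = "\<lambda>t h. h *\<^sub>R partial j \<phi> (x + t *\<^sub>R ?e)"])
           (auto intro!: has_derivative_continuous_on)
      then have "norm (\<phi> (x + ?h n *\<^sub>R ?e) - \<phi> x) \<le> ?h n * C"
        using C(2) by (auto intro: order_trans mult_left_mono)
      then have "norm (s n x) \<le> inverse (?h n) * (?h n * C)" unfolding s_def norm_scaleR
        by (intro mult_mono) auto
      moreover have "inverse (?h n) * (?h n * C) = C"
      proof -
        have "?h n \<noteq> 0" by simp
        then show ?thesis by (simp only: mult.assoc[symmetric] left_inverse mult_1_left not_False_eq_True)
      qed
      ultimately have "norm (s n x) \<le> C" by linarith
      then show ?thesis using True by simp
    next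
      case False
      have "x \<notin> K" using False r by auto
      moreover have "x + ?h n *\<^sub>R ?e \<notin> K"
      proof
        assume "x + ?h n *\<^sub>R ?e \<in> K"
        then have "norm (x + ?h n *\<^sub>R ?e) \<le> r" using r by auto
        moreover have "norm x \<le> norm (x + ?h n *\<^sub>R ?e) + norm (?h n *\<^sub>R ?e)" 
          using norm_triangle_ineq4[of "x + ?h n *\<^sub>R ?e" "?h n *\<^sub>R ?e"] by simp
        moreover have "norm (?h n *\<^sub>R ?e) \<le> 1" by (simp add: field_simps)
        ultimately show False using False by simp
      qed
      ultimately show ?thesis using False K(2) by (simp add: s_def)
    qed
    then show "AE x in lborel. norm (s n x) \<le> C * indicator (cball 0 (r + 1)) x" for n by simp
  qed
  then show ?thesis unfolding zero by (simp add: LIMSEQ_const_iff)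
qed

lemma integral_partial:
  fixes \<phi> :: "real ^ 'n::finite \<Rightarrow> 'b::euclidean_space"
  assumes "\<phi> \<in> test_functions \<Omega>" "\<Omega> \<in> sets lebesgue"
  shows "(\<integral>x. partial j \<phi> x \<partial>lebesgue_on \<Omega>) = 0"
  using test_functions_integral_on[OF test_functions_partial[OF assms(1)] assms(2)] integral_partial_lborel[OF assms(1)]
  by simp

lemma integral_by_parts:
  fixes \<phi> :: "real ^ 'n::finite \<Rightarrow> real" and \<psi> :: "real ^ 'n::finite \<Rightarrow> 'b::euclidean_space"
  assumes "\<phi> \<in> test_functions \<Omega>" "smooth \<psi>" "\<Omega> \<in> sets lebesgue"
  shows "(\<integral>x. partial j \<phi> x *\<^sub>R \<psi> x \<partial>lebesgue_on \<Omega>) = - (\<integral>x. \<phi> x *\<^sub>R partial j \<psi> x \<partial>lebesgue_on \<Omega>)"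
proof -
  note B = bounded_bilinear_scaleR
  note i1 = test_functions_integrable_on[OF test_functions_bilinear[OF test_functions_partial[OF assms(1)] assms(2) B] assms(3), of j]
  note i2 = test_functions_integrable_on[OF test_functions_bilinear[OF assms(1) smooth_partial[OF assms(2)] B] assms(3), of j]
  have "0 = (\<integral>x. partial j (\<lambda>x. \<phi> x *\<^sub>R \<psi> x) x \<partial>lebesgue_on \<Omega>)"
    using integral_partial[OF test_functions_bilinear[OF assms(1,2) B] assms(3)] by simp
  also have "\<dots> = (\<integral>x. \<phi> x *\<^sub>R partial j \<psi> x + partial j \<phi> x *\<^sub>R \<psi> x \<partial>lebesgue_on \<Omega>)"
    by (simp add: partial_bilinear[OF B test_functionsD(1)[OF assms(1)] assms(2)])
  also have "\<dots> = (\<integral>x. \<phi> x *\<^sub>R partial j \<psi> x \<partial>lebesgue_on \<Omega>) + (\<integral>x. partial j \<phi> x *\<^sub>R \<psi> x \<partial>lebesgue_on \<Omega>)"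
    by (rule Bochner_Integration.integral_add[OF i2 i1])
  finally show ?thesis by (simp add: eq_neg_iff_add_eq_0 add.commute)
qed

subsection \<open>Test functions as Sobolev functions\<close>

lemma test_functions_weak_partial:
  fixes \<phi> :: "real ^ 'n::finite \<Rightarrow> 'b::euclidean_space"
  assumes "\<phi> \<in> test_functions \<Omega>" "open \<Omega>"
  shows "weak_partial \<Omega> j \<phi> (partial j \<phi>)"
  unfolding weak_partial_def locally_integrable_def
  using test_functions_integrable_on[OF assms(1)] test_functions_integrable_on[OF test_functions_partial[OF assms(1)]]
    integral_by_parts[OF _ test_functionsD(1)[OF assms(1)] lebesgue_open[OF assms(2)]]
  by (auto simp: sets_completionI_sets borel_compact)

text \<open>The constant sequence serves as approximating sequence in
  \<open>W1_1_zero\<close>.\<close>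

lemma test_functions_W1_infty_zero:
  fixes \<phi> :: "real ^ 'n::finite \<Rightarrow> 'b::euclidean_space"
  assumes "\<phi> \<in> test_functions \<Omega>" "open \<Omega>"
  shows "\<phi> \<in> W1_infty_zero \<Omega>"
proof -
  have L: "\<psi> \<in> L_infty \<Omega>" if "\<psi> \<in> test_functions \<Omega>" for \<psi> :: "real ^ 'n::finite \<Rightarrow> 'b"
    using borel_measurable_integrable[OF test_functions_integrable_on[OF that lebesgue_open[OF assms(2)]]]
      test_functions_bounded[OF that]
    unfolding L_infty_def by (auto intro: AE_I2)
  have "\<phi> \<in> W1_infty \<Omega>" unfolding W1_infty_def
    using L[OF assms(1)] L[OF test_functions_partial[OF assms(1)]] test_functions_weak_partial[OF assms] by blast
  moreover have "\<phi> \<in> W1_1_zero \<Omega>" unfolding W1_1_zero_def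
    using test_functions_integrable_on[OF assms(1) lebesgue_open[OF assms(2)]]
      test_functions_integrable_on[OF test_functions_partial[OF assms(1)] lebesgue_open[OF assms(2)]]
      test_functions_weak_partial[OF assms] assms(1)
    by (intro CollectI conjI exI[where x = "\<lambda>j. partial j \<phi>"]; simp?) (intro exI[where x = "\<lambda>_. \<phi>"]; simp)
  ultimately show ?thesis by (simp add: W1_infty_zero_def)
qed

subsection \<open>Smooth functions of one variable\<close>

text \<open>Differentiability of order \<open>r\<close> on the line, with derivatives given by
  witnesses, which suits closure proofs by induction on \<open>r\<close>. Continuity of the last
  derivative is not included, so the passage to \<open>Ck\<close> loses one order.\<close>

fun sm1 :: "nat \<Rightarrow> (real \<Rightarrow> real) \<Rightarrow> bool" where
  "sm1 0 h \<longleftrightarrow> True"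
| "sm1 (Suc r) h \<longleftrightarrow> (\<exists>h'. (\<forall>t. (h has_real_derivative h' t) (at t)) \<and> sm1 r h')"

lemma sm1_Suc_D: "sm1 (Suc r) h \<Longrightarrow> sm1 r h"
  by (induction r arbitrary: h) (auto simp del: sm1.simps(2) simp: sm1.simps(2)[of "Suc _"], auto)

lemma sm1_SucI: "sm1 r h' \<Longrightarrow> \<forall>t. (h has_real_derivative h' t) (at t) \<Longrightarrow> sm1 (Suc r) h"
  by auto

lemma sm1_const: "sm1 r (\<lambda>_. c)"
proof (induction r arbitrary: c)
  case (Suc r)
  have "\<forall>t. ((\<lambda>_. c) has_real_derivative (\<lambda>_. 0) t) (at t)" by simp
  with Suc[of 0] show ?case by (auto intro!: exI[of _ "\<lambda>_. 0"])
qed simp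

lemma sm1_add: "sm1 r g \<Longrightarrow> sm1 r h \<Longrightarrow> sm1 r (\<lambda>t. g t + h t)"
proof (induction r arbitrary: g h)
  case (Suc r)
  then obtain g' h' where d: "\<And>t. (g has_real_derivative g' t) (at t)" "\<And>t. (h has_real_derivative h' t) (at t)"
    and "sm1 r g'" "sm1 r h'" by auto
  then have "sm1 r (\<lambda>t. g' t + h' t)" using Suc.IH by blast
  moreover have "\<forall>t. ((\<lambda>t. g t + h t) has_real_derivative g' t + h' t) (at t)" using d by (auto intro: DERIV_add)
  ultimately show ?case by (rule sm1_SucI)
qed simp

lemma sm1_mult: "sm1 r g \<Longrightarrow> sm1 r h \<Longrightarrow> sm1 r (\<lambda>t. g t * h t)"
proof (induction r arbitrary: g h)
  case (Suc r)
  then obtain g' h' where d: "\<And>t. (g has_real_derivative g' t) (at t)" "\<And>t. (h has_real_derivative h' t) (at t)"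
    and "sm1 r g'" "sm1 r h'" by auto
  then have "sm1 r (\<lambda>t. g' t * h t + h' t * g t)"
    using Suc.IH Suc.prems[THEN sm1_Suc_D] by (intro sm1_add) auto
  moreover have "\<forall>t. ((\<lambda>t. g t * h t) has_real_derivative g' t * h t + h' t * g t) (at t)"
    using d by (auto intro: DERIV_mult)
  ultimately show ?case by (rule sm1_SucI)
qed simp

lemma sm1_compose: "sm1 r g \<Longrightarrow> sm1 r h \<Longrightarrow> sm1 r (\<lambda>t. g (h t))"
proof (induction r arbitrary: g h)
  case (Suc r)
  then obtain g' h' where d: "\<And>t. (g has_real_derivative g' t) (at t)" "\<And>t. (h has_real_derivative h' t) (at t)"
    and "sm1 r g'" "sm1 r h'" by auto
  then have "sm1 r (\<lambda>t. g' (h t) * h' t)"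
    using Suc.IH Suc.prems[THEN sm1_Suc_D] by (intro sm1_mult) auto
  moreover have "\<forall>t. ((\<lambda>t. g (h t)) has_real_derivative g' (h t) * h' t) (at t)"
    using DERIV_chain2[OF d(1) d(2)] by blast
  ultimately show ?case by (rule sm1_SucI)
qed simp

lemma sm1_inverse: "sm1 r h \<Longrightarrow> (\<And>t. h t \<noteq> 0) \<Longrightarrow> sm1 r (\<lambda>t. inverse (h t))"
proof (induction r arbitrary: h)
  case (Suc r)
  then obtain h' where d: "\<And>t. (h has_real_derivative h' t) (at t)" and "sm1 r h'" by auto
  moreover have "sm1 r (\<lambda>t. inverse (h t))" using Suc.IH Suc.prems sm1_Suc_D by blast
  ultimately have "sm1 r (\<lambda>t. (- 1) * (h' t * (inverse (h t) * inverse (h t))))"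
    by (intro sm1_mult sm1_const)
  moreover have "\<forall>t. ((\<lambda>t. inverse (h t)) has_real_derivative (- 1) * (h' t * (inverse (h t) * inverse (h t)))) (at t)"
    using DERIV_inverse_fun[OF d] Suc.prems(2) by (simp add: power2_eq_square inverse_mult_distrib field_simps)
  ultimately show ?case by (rule sm1_SucI)
qed simp

lemma sm1_ident: "sm1 r (\<lambda>t. t)"
proof (cases r)
  case (Suc m)
  have "\<forall>t. ((\<lambda>t. t) has_real_derivative (\<lambda>_. 1) t) (at t)" by simp
  with Suc show ?thesis using sm1_const[of m 1] by (auto intro!: exI[of _ "\<lambda>_. 1"])
qed simp

lemma sm1_cos_sin: "sm1 r cos \<and> sm1 r sin"
proof (induction r)
  case (Suc r)
  have "\<forall>t. (cos has_real_derivative (\<lambda>t. (-1) * sin t) t) (at t)" by (auto intro!: derivative_eq_intros)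
  moreover have "\<forall>t. (sin has_real_derivative cos t) (at t)" by (auto intro!: derivative_eq_intros)
  ultimately show ?case
    using Suc sm1_mult[OF sm1_const[of r "-1"], of sin] by (intro conjI sm1_SucI[of r "\<lambda>t. (-1) * sin t"] sm1_SucI[of r cos]) auto
qed simp

section \<open>Ridge functions and the smooth step\<close>

lemma ridge_has_derivative:
  assumes "(h has_real_derivative h') (at (a \<bullet> x))"
  shows "((\<lambda>x. h (a \<bullet> x)) has_derivative (\<lambda>v. h' * (a \<bullet> v))) (at x)"
  using assms unfolding has_field_derivative_def
  by (intro has_derivative_compose[where f = "\<lambda>x. a \<bullet> x" and g = h] bounded_linear_imp_has_derivative bounded_linear_inner_right)

lemma Ck_ridge: "sm1 (Suc r) h \<Longrightarrow> Ck r (\<lambda>x :: real ^ 'n::finite. h (a \<bullet> x))"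
proof (induction r arbitrary: h)
  case 0
  then obtain h' where "\<And>t. (h has_real_derivative h' t) (at t)" by auto
  then have "continuous_on UNIV h" by (meson DERIV_isCont continuous_at_imp_continuous_on)
  then have "continuous_on UNIV (\<lambda>x :: real ^ 'n. h (a \<bullet> x))"
    by (rule continuous_on_compose2) (auto intro: continuous_intros)
  then show ?case by simp
next
  case (Suc r)
  then obtain h' where h': "\<And>t. (h has_real_derivative h' t) (at t)" "sm1 (Suc r) h'" by (metis sm1.simps(2))
  have d: "((\<lambda>x :: real ^ 'n. h (a \<bullet> x)) has_derivative (\<lambda>v. h' (a \<bullet> x) * (a \<bullet> v))) (at x)" for x
    by (rule ridge_has_derivative[OF h'(1)])
  have "partial j (\<lambda>x :: real ^ 'n. h (a \<bullet> x)) = (\<lambda>x. h' (a \<bullet> x) * (a $ j))" for j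
    by (rule ext) (simp add: partial_eqI[OF d] inner_axis)
  then show ?case
    using Suc.IH[OF h'(2)] d Ck_const[of r] by (auto simp: differentiable_def intro!: Ck_bilinear[OF bounded_bilinear_mult] d)
qed

lemma smooth_ridge: "(\<And>r. sm1 r h) \<Longrightarrow> smooth (\<lambda>x :: real ^ 'n::finite. h (a \<bullet> x))"
  unfolding smooth_def using Ck_ridge by blast

lemma partial_ridge:
  assumes "\<And>t. (h has_real_derivative h' t) (at t)"
  shows "partial j (\<lambda>x :: real ^ 'n::finite. h (a \<bullet> x)) x = h' (a \<bullet> x) * (a $ j)"
proof -
  have "((\<lambda>x :: real ^ 'n. h (a \<bullet> x)) has_derivative (\<lambda>v. h' (a \<bullet> x) * (a \<bullet> v))) (at x)"
    by (rule ridge_has_derivative[OF assms])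
  from partial_eqI[OF this] show ?thesis by (simp add: inner_axis)
qed

text \<open>With s = 1/t these are the functions p(s) exp(-s), a family closed under
  differentiation: the polynomial p becomes s^2 (p - p'). The case p = 1 is the classical smooth
  function that is flat at the origin.\<close>

definition flat :: "real poly \<Rightarrow> real \<Rightarrow> real" where
  "flat p t = (if t > 0 then poly p (1 / t) * exp (- (1 / t)) else 0)"

lemma poly_div_exp_tendsto_0: "((\<lambda>s. poly p s / exp s) \<longlongrightarrow> (0 :: real)) at_top"
proof -
  have "((\<lambda>s. \<Sum>i\<le>degree p. coeff p i * (s ^ i / exp s)) \<longlongrightarrow> (\<Sum>i\<le>degree p. coeff p i * 0)) at_top"
    by (intro tendsto_intros tendsto_power_div_exp_0)
  then show ?thesis by (simp add: poly_altdef sum_divide_distrib)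
qed

lemma flat_DERIV: "(flat p has_real_derivative flat ([:0, 0, 1:] * (p - pderiv p)) t) (at t)"
proof -
  consider "t > 0" | "t < 0" | "t = 0" by linarith
  then show ?thesis
  proof cases
    case 1
    have "((\<lambda>t. poly p (1 / t) * exp (- (1 / t))) has_real_derivative
        (poly (pderiv p) (1 / t) * (- 1 / t\<^sup>2)) * exp (- (1 / t)) + (exp (- (1 / t)) * (1 / t\<^sup>2)) * poly p (1 / t)) (at t)"
      using 1 by (auto intro!: derivative_eq_intros simp: power2_eq_square)
    also have "(poly (pderiv p) (1 / t) * (- 1 / t\<^sup>2)) * exp (- (1 / t)) + (exp (- (1 / t)) * (1 / t\<^sup>2)) * poly p (1 / t)
        = flat ([:0, 0, 1:] * (p - pderiv p)) t"
      using 1 by (simp add: flat_def field_simps power2_eq_square)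
    finally show ?thesis
      by (rule has_field_derivative_transform_within_open[of _ _ _ "{0<..}"]) (use 1 in \<open>auto simp: flat_def\<close>)
  next
    case 2
    have "((\<lambda>_. 0) has_real_derivative 0) (at t)" by simp
    then have "(flat p has_real_derivative 0) (at t)"
      by (rule has_field_derivative_transform_within_open[of _ _ _ "{..<0}"]) (use 2 in \<open>auto simp: flat_def\<close>)
    then show ?thesis using 2 by (simp add: flat_def)
  next
    case 3
    have "((\<lambda>h. (flat p (0 + h) - flat p 0) / h) \<longlongrightarrow> 0) (at_right 0)"
    proof -
      \<comment> \<open>The difference quotient at 0 divides by h, which multiplies the polynomial
        by s = 1/h; the exponential still wins.\<close>
      have "((\<lambda>h. poly ([:0, 1:] * p) (inverse h) / exp (inverse h)) \<longlongrightarrow> 0) (at_right 0)"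
        by (rule filterlim_compose[OF poly_div_exp_tendsto_0 filterlim_inverse_at_top_right])
      then show ?thesis
        by (rule Lim_transform_eventually)
           (auto simp: eventually_at_right_field flat_def field_simps exp_minus intro!: exI[of _ 1])
    qed
    moreover have "((\<lambda>h. (flat p (0 + h) - flat p 0) / h) \<longlongrightarrow> 0) (at_left 0)"
      by (rule Lim_transform_eventually[OF tendsto_const])
         (auto simp: eventually_at_left_field flat_def intro!: exI[of _ "-1"])
    ultimately have "((\<lambda>h. (flat p (0 + h) - flat p 0) / h) \<longlongrightarrow> 0) (at 0)"
      by (simp add: filterlim_at_split)
    then have "(flat p has_real_derivative 0) (at 0)" by (simp add: DERIV_def)
    then show ?thesis using 3 by (simp add: flat_def)
  qed
qed

lemma sm1_flat: "sm1 r (flat p)"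
  by (induction r arbitrary: p) (use flat_DERIV in \<open>auto intro!: exI\<close>)

text \<open>The smooth transition from 0 on t \<le> 0 to 1 on t \<ge> 1. The quotient form yields
  the symmetry under t \<mapsto> 1 - t, from which an odd transition between -1 and 1 is obtained
  later.\<close>

definition step :: "real \<Rightarrow> real" where
  "step t = flat 1 t * inverse (flat 1 t + flat 1 (1 - t))"

lemma step_denominator: "flat 1 t + flat 1 (1 - t) > 0"
  by (auto simp: flat_def add_pos_nonneg add_nonneg_pos)

lemma sm1_affine: "sm1 r (\<lambda>t. c * t + d)"
  by (intro sm1_add sm1_mult sm1_const sm1_ident)

lemma sm1_step: "sm1 r step"
proof -
  have "sm1 r (\<lambda>t. flat 1 (1 - t))" using sm1_compose[OF sm1_flat[of r 1] sm1_affine[of r "-1" 1]] by simp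
  then show ?thesis unfolding step_def[abs_def] using step_denominator
    by (intro sm1_mult sm1_inverse sm1_add sm1_flat) (auto simp: less_imp_neq[symmetric])
qed

lemma step_0: "t \<le> 0 \<Longrightarrow> step t = 0"
  by (simp add: step_def flat_def)

lemma step_1: "t \<ge> 1 \<Longrightarrow> step t = 1"
  by (simp add: step_def flat_def)

lemma step_nonneg: "0 \<le> step t"
  using step_denominator[of t] by (auto simp: step_def flat_def intro!: mult_nonneg_nonneg less_imp_le)

lemma step_symm: "step (1 - t) = 1 - step t"
  using step_denominator[of t] by (simp add: step_def field_simps)

lemma step_le_1: "step t \<le> 1"
  using step_symm[of t] step_nonneg[of "1 - t"] by simp

subsection \<open>Cut-off functions of boxes\<close>

text \<open>The parameter \<open>p\<close> is the steepness: the transition takes place in a layer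
  of width 1/p inside the box, so the support stays in the closed box.\<close>

definition box_cutoff :: "real ^ 'n::finite \<Rightarrow> real ^ 'n \<Rightarrow> real \<Rightarrow> real ^ 'n \<Rightarrow> real" where
  "box_cutoff a b p x = (\<Prod>i\<in>UNIV. step (p * (x $ i - a $ i)) * step (p * (b $ i - x $ i)))"

lemma smooth_box_cutoff: "smooth (box_cutoff a b p)"
proof -
  have "smooth (\<lambda>x :: real ^ 'n::finite. step (c * x $ i + d))" for c d i
    using smooth_ridge[of "\<lambda>t. step (c * t + d)" "axis i 1"] sm1_compose[OF sm1_step sm1_affine[of _ c d]]
    by (simp add: inner_axis')
  from this[of p _ "- p * a $ _"] this[of "- p" _ "p * b $ _"] show ?thesis
    unfolding box_cutoff_def[abs_def]
    by (intro smooth_prod smooth_bilinear[OF bounded_bilinear_mult]) (simp_all add: algebra_simps)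
qed

lemma box_cutoff_bounds: "0 \<le> box_cutoff a b p x" "box_cutoff a b p x \<le> 1"
proof -
  show "0 \<le> box_cutoff a b p x" unfolding box_cutoff_def by (intro prod_nonneg) (simp add: step_nonneg)
  have "0 \<le> step s * step t \<and> step s * step t \<le> 1" for s t
    using step_nonneg step_le_1 by (simp add: mult_le_one)
  then show "box_cutoff a b p x \<le> 1" unfolding box_cutoff_def by (intro prod_le_1) auto
qed

lemma box_cutoff_eq_0: 
  assumes "0 < p" "x \<notin> box a b"
  shows "box_cutoff a b p x = 0"
proof -
  obtain i where "x $ i \<le> a $ i \<or> b $ i \<le> x $ i" using assms(2) by (auto simp: mem_box_cart not_less)
  then have "step (p * (x $ i - a $ i)) = 0 \<or> step (p * (b $ i - x $ i)) = 0"
    using assms(1) by (auto intro!: step_0 mult_nonneg_nonpos)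
  then show ?thesis unfolding box_cutoff_def by (intro prod_zero) auto
qed

lemma box_cutoff_eq_1:
  assumes "0 < p" "\<And>i. a $ i + 1 / p \<le> x $ i" "\<And>i. x $ i \<le> b $ i - 1 / p"
  shows "box_cutoff a b p x = 1"
proof -
  have "step (p * (x $ i - a $ i)) = 1" "step (p * (b $ i - x $ i)) = 1" for i
    using assms(1) assms(2,3)[of i] by (auto intro!: step_1 simp: field_simps)
  then show ?thesis unfolding box_cutoff_def by simp
qed

lemma box_cutoff_tendsto:
  "(\<lambda>m. box_cutoff a b (real (Suc m)) x) \<longlonglongrightarrow> indicator (box a b) x"
proof (cases "x \<in> box a b")
  case True
  then have pos: "a $ i < x $ i" "x $ i < b $ i" for i by (auto simp: mem_box_cart)
  define d where "d = Min (range (\<lambda>i. min (x $ i - a $ i) (b $ i - x $ i)))"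
  have d: "0 < d" "\<And>i. d \<le> x $ i - a $ i" "\<And>i. d \<le> b $ i - x $ i"
  proof -
    show "0 < d" unfolding d_def using pos by (subst Min_gr_iff) auto
    have "d \<le> min (x $ i - a $ i) (b $ i - x $ i)" for i unfolding d_def by (rule Min_le) auto
    then show "d \<le> x $ i - a $ i" "d \<le> b $ i - x $ i" for i by (meson min.boundedE)+
  qed
  obtain N where N: "inverse (real (Suc N)) < d" using reals_Archimedean[OF d(1)] by blast
  have "box_cutoff a b (real (Suc m)) x = 1" if "m \<ge> N" for m
  proof -
    have "1 / real (Suc m) \<le> inverse (real (Suc N))" using that by (simp add: field_simps)
    then have "1 / real (Suc m) \<le> d" using N by linarith
    then have "a $ i + 1 / real (Suc m) \<le> x $ i" "x $ i \<le> b $ i - 1 / real (Suc m)" for i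
      using d(2,3)[of i] by linarith+
    then show ?thesis by (intro box_cutoff_eq_1) auto
  qed
  then have "eventually (\<lambda>m. box_cutoff a b (real (Suc m)) x = indicator (box a b) x) sequentially"
    using True by (auto simp: eventually_sequentially)
  then show ?thesis by (rule tendsto_eventually)
next
  case False
  then show ?thesis using box_cutoff_eq_0[of _ x a b] by simp
qed

subsection \<open>The fundamental lemma of the calculus of variations\<close>

lemma box_cutoff_test:
  assumes "0 < p" "cbox a b \<subseteq> \<Omega>"
  shows "box_cutoff a b p \<in> test_functions \<Omega>"
  using assms box_subset_cbox[of a b]
  by (intro test_functionsI[OF smooth_box_cutoff compact_cbox]) (auto intro: box_cutoff_eq_0)

lemma integral_indicator_restrict:
  fixes f :: "real ^ 'n::finite \<Rightarrow> 'b::euclidean_space"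
  assumes "\<Omega> \<in> sets lebesgue" "A \<in> sets lebesgue" "A \<subseteq> \<Omega>"
  shows "(\<integral>x. indicator A x *\<^sub>R f x \<partial>lebesgue_on \<Omega>) = (\<integral>x. indicator A x *\<^sub>R f x \<partial>lebesgue)"
    and "integrable (lebesgue_on \<Omega>) (\<lambda>x. indicator A x *\<^sub>R f x) \<longleftrightarrow> integrable lebesgue (\<lambda>x. indicator A x *\<^sub>R f x)"
proof -
  have "(\<lambda>x. indicator \<Omega> x *\<^sub>R indicator A x *\<^sub>R f x) = (\<lambda>x. indicator A x *\<^sub>R f x)"
    using assms(3) by (auto simp: indicator_def fun_eq_iff)
  then show "(\<integral>x. indicator A x *\<^sub>R f x \<partial>lebesgue_on \<Omega>) = (\<integral>x. indicator A x *\<^sub>R f x \<partial>lebesgue)"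
    "integrable (lebesgue_on \<Omega>) (\<lambda>x. indicator A x *\<^sub>R f x) \<longleftrightarrow> integrable lebesgue (\<lambda>x. indicator A x *\<^sub>R f x)"
    using assms(1) by (simp_all add: integral_restrict_space integrable_restrict_space)
qed

lemma locally_integrable_indicator:
  fixes g :: "real ^ 'n::finite \<Rightarrow> 'b::euclidean_space"
  assumes "locally_integrable \<Omega> g" "compact K" "K \<subseteq> \<Omega>"
  shows "integrable lebesgue (\<lambda>x. indicator K x *\<^sub>R g x)"
proof -
  have "K \<in> sets lebesgue" using assms(2) by (simp add: borel_compact sets_completionI_sets)
  moreover have "integrable (lebesgue_on K) g" using assms by (simp add: locally_integrable_def)
  ultimately show ?thesis by (simp add: integrable_restrict_space)
qed

lemma test_function_times_integrable:
  fixes g :: "real ^ 'n::finite \<Rightarrow> 'b::euclidean_space" and \<phi> :: "real ^ 'n \<Rightarrow> real"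
  assumes "locally_integrable \<Omega> g" "\<phi> \<in> test_functions \<Omega>" "\<Omega> \<in> sets lebesgue"
  shows "integrable (lebesgue_on \<Omega>) (\<lambda>x. \<phi> x *\<^sub>R g x)"
proof -
  obtain K where K: "compact K" "K \<subseteq> \<Omega>" "\<And>x. x \<notin> K \<Longrightarrow> \<phi> x = 0"
    using test_functions_support[OF assms(2)] by blast
  obtain C where C: "0 \<le> C" "\<And>x. norm (\<phi> x) \<le> C" using test_functions_bounded[OF assms(2)] by blast
  note i = locally_integrable_indicator[OF assms(1) K(1,2)]
  have meas: "\<phi> \<in> borel_measurable lebesgue"
    using smooth_measurable[OF test_functionsD(1)[OF assms(2)]] by (intro measurable_completion) simp
  have "integrable lebesgue (\<lambda>x. \<phi> x *\<^sub>R (indicator K x *\<^sub>R g x))"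
  proof (rule Bochner_Integration.integrable_bound[OF integrable_scaleR_right[OF i, of C]])
    show "(\<lambda>x. \<phi> x *\<^sub>R (indicator K x *\<^sub>R g x)) \<in> borel_measurable lebesgue"
      using meas borel_measurable_integrable[OF i] by (rule borel_measurable_scaleR)
    show "AE x in lebesgue. norm (\<phi> x *\<^sub>R indicator K x *\<^sub>R g x) \<le> norm (C *\<^sub>R indicator K x *\<^sub>R g x)"
      using C by (auto intro!: AE_I2 mult_right_mono simp: indicator_def)
  qed
  moreover have "(\<lambda>x. \<phi> x *\<^sub>R (indicator K x *\<^sub>R g x)) = (\<lambda>x. \<phi> x *\<^sub>R g x)" using K(3) by (auto simp: indicator_def fun_eq_iff)
  ultimately have "integrable lebesgue (\<lambda>x. \<phi> x *\<^sub>R g x)" by (simp only:)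
  moreover have "(\<lambda>x. indicator \<Omega> x *\<^sub>R \<phi> x *\<^sub>R g x) = (\<lambda>x. \<phi> x *\<^sub>R g x)" using K by (auto simp: indicator_def fun_eq_iff)
  ultimately show ?thesis using assms(3) by (simp add: integrable_restrict_space)
qed

text \<open>The cut-offs of the box are admissible test functions and increase in steepness towards
  the indicator; \<open>g\<close> on the compact closed box is the majorant for dominated
  convergence.\<close>

lemma integral_box_eq_0:
  fixes g :: "real ^ 'n::finite \<Rightarrow> 'b::euclidean_space"
  assumes \<Omega>: "open \<Omega>" and g: "locally_integrable \<Omega> g"
    and zero: "\<And>\<phi> :: real ^ 'n \<Rightarrow> real. \<phi> \<in> test_functions \<Omega> \<Longrightarrow> (\<integral>x. \<phi> x *\<^sub>R g x \<partial>lebesgue_on \<Omega>) = 0"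
    and sub: "cbox a b \<subseteq> \<Omega>"
  shows "(\<integral>x. indicator (box a b) x *\<^sub>R g x \<partial>lebesgue) = 0"
proof -
  note L = lebesgue_open[OF \<Omega>]
  let ?\<phi> = "\<lambda>m. box_cutoff a b (real (Suc m))"
  have test: "?\<phi> m \<in> test_functions \<Omega>" for m by (rule box_cutoff_test[OF _ sub]) simp
  have C: "cbox a b \<in> sets lebesgue" by (simp add: sets_completionI_sets)
  have "(\<lambda>m. \<integral>x. ?\<phi> m x *\<^sub>R g x \<partial>lebesgue_on \<Omega>) \<longlonglongrightarrow> (\<integral>x. indicator (box a b) x *\<^sub>R g x \<partial>lebesgue_on \<Omega>)"
  proof (rule integral_dominated_convergence[where w = "\<lambda>x. norm (indicator (cbox a b) x *\<^sub>R g x)"])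
    have i: "integrable (lebesgue_on \<Omega>) (\<lambda>x. indicator (cbox a b) x *\<^sub>R g x)"
      using locally_integrable_indicator[OF g compact_cbox sub] integral_indicator_restrict(2)[OF L C sub] by blast
    then show "integrable (lebesgue_on \<Omega>) (\<lambda>x. norm (indicator (cbox a b) x *\<^sub>R g x))" by (rule integrable_norm)
    have "(\<lambda>x. indicator (box a b) x *\<^sub>R indicator (cbox a b) x *\<^sub>R g x) \<in> borel_measurable (lebesgue_on \<Omega>)"
    proof (rule borel_measurable_scaleR[OF _ borel_measurable_integrable[OF i]])
      have "indicator (box a b) \<in> borel_measurable lebesgue" by (intro borel_measurable_indicator) (simp add: sets_completionI_sets)
      then show "(indicator (box a b) :: real ^ 'n \<Rightarrow> real) \<in> borel_measurable (lebesgue_on \<Omega>)"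
        by (rule measurable_restrict_space1)
    qed
    moreover have "(\<lambda>x. indicator (box a b) x *\<^sub>R indicator (cbox a b) x *\<^sub>R g x) = (\<lambda>x. indicator (box a b) x *\<^sub>R g x)"
      using box_subset_cbox[of a b] by (auto simp: indicator_def fun_eq_iff)
    ultimately show "(\<lambda>x. indicator (box a b) x *\<^sub>R g x) \<in> borel_measurable (lebesgue_on \<Omega>)" by (simp only:)
    show "(\<lambda>x. ?\<phi> m x *\<^sub>R g x) \<in> borel_measurable (lebesgue_on \<Omega>)" for m
      by (rule borel_measurable_integrable[OF test_function_times_integrable[OF g test L]])
    show "AE x in lebesgue_on \<Omega>. (\<lambda>m. ?\<phi> m x *\<^sub>R g x) \<longlonglongrightarrow> indicator (box a b) x *\<^sub>R g x"
      by (intro AE_I2 tendsto_scaleR box_cutoff_tendsto tendsto_const)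
    show "AE x in lebesgue_on \<Omega>. norm (?\<phi> m x *\<^sub>R g x) \<le> norm (indicator (cbox a b) x *\<^sub>R g x)" for m
    proof (intro AE_I2)
      fix x
      show "norm (?\<phi> m x *\<^sub>R g x) \<le> norm (indicator (cbox a b) x *\<^sub>R g x)"
      proof (cases "x \<in> cbox a b")
        case True
        then show ?thesis using box_cutoff_bounds[of a b "real (Suc m)" x] by (simp add: mult_left_le_one_le)
      next
        case False
        then have "x \<notin> box a b" using box_subset_cbox by blast
        then show ?thesis by (simp add: box_cutoff_eq_0 del: of_nat_Suc)
      qed
    qed
  qed
  then have "(\<integral>x. indicator (box a b) x *\<^sub>R g x \<partial>lebesgue_on \<Omega>) = 0"
    by (simp add: zero[OF test] LIMSEQ_const_iff del: of_nat_Suc)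
  then show ?thesis
    using integral_indicator_restrict(1)[OF L, of "box a b" g] sub box_subset_cbox[of a b] by (auto simp: sets_completionI_sets)
qed

lemma sigma_finite_lebesgue: "sigma_finite_measure (lebesgue :: 'a::euclidean_space measure)"
proof
  obtain A :: "'a set set" where "countable A" "A \<subseteq> sets lborel" "\<Union>A = space lborel" "\<forall>a\<in>A. emeasure lborel a \<noteq> \<infinity>"
    using lborel.sigma_finite_countable by blast
  then show "\<exists>A :: 'a set set. countable A \<and> A \<subseteq> sets lebesgue \<and> \<Union>A = space lebesgue \<and> (\<forall>a\<in>A. emeasure lebesgue a \<noteq> \<infinity>)"
    by (intro exI[of _ A]) (auto simp: subset_iff)
qed

text \<open>Open boxes are an intersection-stable generator of the Borel sets, so the vanishing
  passes to all Borel sets, the total integral taking care of complements. Lebesgue sets differ from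
  Borel sets by subsets of null sets.\<close>

lemma AE_eq_0_of_box_integrals:
  fixes h :: "real ^ 'n::finite \<Rightarrow> 'b::euclidean_space"
  assumes h: "integrable lebesgue h" and tot: "(\<integral>x. h x \<partial>lebesgue) = 0"
    and box: "\<And>c d. (\<integral>x. indicator (box c d) x *\<^sub>R h x \<partial>lebesgue) = 0"
  shows "AE x in lebesgue. h x = 0"
proof (rule sigma_finite_measure.density_zero[OF sigma_finite_lebesgue h])
  have borel: "set_lebesgue_integral lebesgue A h = 0" if "A \<in> sets borel" for A
  proof -
    let ?G = "range (\<lambda>(a, b). box a b :: (real ^ 'n) set)"
    have sigma: "B \<in> sets lebesgue" if "B \<in> sigma_sets UNIV ?G" for B
    proof -
      have "B \<in> sets (borel :: (real ^ 'n) measure)" unfolding borel_eq_box using that by simp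
      then show ?thesis by (simp add: sets_completionI_sets)
    qed
    have "Int_stable ?G" by (auto simp: Int_stable_def box_Int_box)
    moreover have "?G \<subseteq> Pow UNIV" by simp
    moreover have "A \<in> sigma_sets UNIV ?G"
      using that unfolding borel_eq_box by (simp add: sets_measure_of)
    ultimately show ?thesis
    proof (induction rule: sigma_sets_induct_disjoint)
      case (basic A)
      then show ?case using box by (auto simp: set_lebesgue_integral_def)
    next
      case (compl A)
      then have A: "A \<in> sets lebesgue" by (intro sigma)
      have i: "integrable lebesgue (\<lambda>x. indicator A x *\<^sub>R h x)" using A h by (rule integrable_mult_indicator)
      have "(\<integral>x. indicator (UNIV - A) x *\<^sub>R h x \<partial>lebesgue) = (\<integral>x. h x - indicator A x *\<^sub>R h x \<partial>lebesgue)"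
        by (intro Bochner_Integration.integral_cong) (auto simp: indicator_def)
      also have "\<dots> = 0" using compl tot by (simp add: Bochner_Integration.integral_diff[OF h i] set_lebesgue_integral_def)
      finally show ?case by (simp add: set_lebesgue_integral_def)
    next
      case (union A)
      have A: "A i \<in> sets lebesgue" for i using union(2) by (intro sigma) auto
      have "set_integrable lebesgue (\<Union>i. A i) h" unfolding set_integrable_def using A h by (intro integrable_mult_indicator) auto
      then have "set_lebesgue_integral lebesgue (\<Union>i. A i) h = (\<Sum>i. set_lebesgue_integral lebesgue (A i) h)"
        using A union(1) by (intro lebesgue_integral_countable_add) (auto simp: disjoint_family_on_def)
      then show ?case using union by simp
    qed (simp add: set_lebesgue_integral_def)
  qed
  fix A :: "(real ^ 'n) set" assume "A \<in> sets lebesgue"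
  then obtain S N N' where S: "A = S \<union> N" "N \<subseteq> N'" "N' \<in> null_sets lborel" "S \<in> sets lborel" by (rule sets_completionE)
  have N': "AE x in lebesgue. x \<notin> N'" using S(3) by (intro AE_completion AE_not_in)
  have "set_lebesgue_integral lebesgue A h = set_lebesgue_integral lebesgue S h"
    unfolding set_lebesgue_integral_def
  proof (intro integral_cong_AE)
    show "AE x in lebesgue. indicator A x *\<^sub>R h x = indicator S x *\<^sub>R h x"
      using N' by eventually_elim (use S in \<open>auto simp: indicator_def\<close>)
  qed (use S \<open>A \<in> sets lebesgue\<close> in \<open>auto intro!: borel_measurable_integrable[OF integrable_mult_indicator[OF _ h]]\<close>)
  then show "set_lebesgue_integral lebesgue A h = 0" using borel S(4) by simp
qed

text \<open>Local integrability controls \<open>g\<close> on compact subsets only. The integral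
  criterion is therefore applied on closed boxes inside \<open>\<Omega>\<close>, countably many of
  which cover \<open>\<Omega>\<close>.\<close>

lemma fundamental_lemma:
  fixes g :: "real ^ 'n::finite \<Rightarrow> 'b::euclidean_space"
  assumes \<Omega>: "open \<Omega>" and g: "locally_integrable \<Omega> g"
    and zero: "\<And>\<phi> :: real ^ 'n \<Rightarrow> real. \<phi> \<in> test_functions \<Omega> \<Longrightarrow> (\<integral>x. \<phi> x *\<^sub>R g x \<partial>lebesgue_on \<Omega>) = 0"
  shows "AE x in lebesgue_on \<Omega>. g x = 0"
proof -
  have cb: "AE x in lebesgue. x \<in> cbox a b \<longrightarrow> g x = 0" if sub: "cbox a b \<subseteq> \<Omega>" for a b
  proof -
    let ?h = "\<lambda>x. indicator (box a b) x *\<^sub>R g x"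
    have "integrable lebesgue (\<lambda>x. indicator (box a b) x *\<^sub>R indicator (cbox a b) x *\<^sub>R g x)"
      using locally_integrable_indicator[OF g compact_cbox sub] by (rule integrable_mult_indicator[rotated]) (simp add: sets_completionI_sets)
    moreover have "(\<lambda>x. indicator (box a b) x *\<^sub>R indicator (cbox a b) x *\<^sub>R g x) = ?h"
      using box_subset_cbox[of a b] by (auto simp: indicator_def fun_eq_iff)
    ultimately have "integrable lebesgue ?h" by (simp only:)
    then have "AE x in lebesgue. ?h x = 0"
    proof (rule AE_eq_0_of_box_integrals)
      show "(\<integral>x. ?h x \<partial>lebesgue) = 0" by (rule integral_box_eq_0[OF \<Omega> g zero sub])
      fix c d :: "real ^ 'n"
      obtain p q where pq: "box c d \<inter> box a b = box p q" "cbox c d \<inter> cbox a b = cbox p q"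
        by (rule that[OF box_Int_box Int_interval])
      have "(\<lambda>x. indicator (box c d) x *\<^sub>R ?h x) = (\<lambda>x. indicator (box p q) x *\<^sub>R g x)"
        unfolding pq(1)[symmetric] by (auto simp: indicator_def fun_eq_iff)
      moreover have "cbox p q \<subseteq> \<Omega>" using pq(2) sub by blast
      ultimately show "(\<integral>x. indicator (box c d) x *\<^sub>R ?h x \<partial>lebesgue) = 0"
        using integral_box_eq_0[OF \<Omega> g zero] by simp
    qed
    \<comment> \<open>The criterion is applied on open boxes while the covering uses closed ones;
      the faces in between are negligible.\<close>
    moreover have "AE x in lebesgue. x \<notin> cbox a b - box a b"
      using negligible_frontier_interval[of a b] by (intro AE_not_in) (simp add: negligible_iff_null_sets)
    ultimately show ?thesis by eventually_elim (auto simp: indicator_def)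
  qed
  obtain D where D: "countable D" "\<And>X. X \<in> D \<Longrightarrow> \<exists>a b. X = cbox a b" "\<Union>D = \<Omega>"
    using open_countable_Union_open_cbox[OF \<Omega>] by metis
  have "AE x in lebesgue. \<forall>X\<in>D. x \<in> X \<longrightarrow> g x = 0"
  proof (subst AE_ball_countable[OF D(1)], rule ballI)
    fix X assume X: "X \<in> D"
    then obtain a b where "X = cbox a b" using D(2) by blast
    then show "AE x in lebesgue. x \<in> X \<longrightarrow> g x = 0" using cb X D(3) by blast
  qed
  then have "AE x in lebesgue. x \<in> \<Omega> \<longrightarrow> g x = 0" by eventually_elim (use D(3) in blast)
  then show ?thesis using lebesgue_open[OF \<Omega>] by (simp add: AE_restrict_space_iff)
qed

text \<open>The difference of two weak derivatives is annihilated by all test functions. It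
  identifies the representatives that enter \<open>ext_quasiaffine\<close> with those obtained from
  the Sobolev spaces.\<close>

lemma weak_partial_unique:
  fixes u g1 g2 :: "real ^ 'n::finite \<Rightarrow> 'b::euclidean_space"
  assumes \<Omega>: "open \<Omega>" and "weak_partial \<Omega> j u g1" "weak_partial \<Omega> j u g2"
  shows "AE x in lebesgue_on \<Omega>. g1 x = g2 x"
proof -
  have l: "locally_integrable \<Omega> g1" "locally_integrable \<Omega> g2" using assms by (auto simp: weak_partial_def)
  have "AE x in lebesgue_on \<Omega>. g1 x - g2 x = 0"
  proof (rule fundamental_lemma[OF \<Omega>])
    show "locally_integrable \<Omega> (\<lambda>x. g1 x - g2 x)"
      using l unfolding locally_integrable_def by (auto intro: Bochner_Integration.integrable_diff)
    fix \<phi> :: "real ^ 'n \<Rightarrow> real" assume \<phi>: "\<phi> \<in> test_functions \<Omega>"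
    have "- (\<integral>x. \<phi> x *\<^sub>R g1 x \<partial>lebesgue_on \<Omega>) = - (\<integral>x. \<phi> x *\<^sub>R g2 x \<partial>lebesgue_on \<Omega>)"
      using assms(2,3) \<phi> unfolding weak_partial_def by metis
    then show "(\<integral>x. \<phi> x *\<^sub>R (g1 x - g2 x) \<partial>lebesgue_on \<Omega>) = 0"
      using Bochner_Integration.integral_diff[OF test_function_times_integrable[OF l(1) \<phi> lebesgue_open[OF \<Omega>]]
        test_function_times_integrable[OF l(2) \<phi> lebesgue_open[OF \<Omega>]]] by (simp add: scaleR_diff_right)
  qed
  then show ?thesis by simp
qed

section \<open>Wedge products of exterior derivatives as null Lagrangians\<close>

subsection \<open>Closed forms\<close>

definition dext :: "(real ^ 'n::finite \<Rightarrow> 'n form) \<Rightarrow> real ^ 'n \<Rightarrow> 'n form" where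
  "dext \<phi> = ext_deriv (\<lambda>j. partial j \<phi>)"

text \<open>Closedness of \<open>X\<close> is what turns d\<phi> \<and> X into the exact form
  d(\<phi> \<and> X).\<close>

definition closed_form :: "(real ^ 'n::finite \<Rightarrow> 'n form) \<Rightarrow> bool" where
  "closed_form X \<longleftrightarrow> smooth X \<and> (\<forall>x. dext X x = 0)"

lemma bounded_linear_wedge_left: "bounded_linear (\<lambda>y. a \<and>\<^sub>\<Lambda> y)"
  by (rule wedge.bounded_linear_right)

lemma dx_wedge_move: "dx j \<and>\<^sub>\<Lambda> (\<omega> \<and>\<^sub>\<Lambda> \<eta>) = parity \<omega> \<and>\<^sub>\<Lambda> (dx j \<and>\<^sub>\<Lambda> \<eta>)"
  unfolding wedge_assoc[symmetric] wedge_parity[OF dx_Lambda, of _ \<omega>] ..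

lemma smooth_dext: "smooth \<phi> \<Longrightarrow> smooth (dext \<phi>)"
  unfolding dext_def ext_deriv_def[abs_def]
  by (intro smooth_sum smooth_linear[OF bounded_linear_wedge_left] smooth_partial)

lemma closed_form_const: "closed_form (\<lambda>_. c)"
  by (simp add: closed_form_def smooth_const dext_def ext_deriv_def partial_const wedge.zero_right)

lemma closed_form_add: "closed_form X \<Longrightarrow> closed_form Y \<Longrightarrow> closed_form (\<lambda>x. X x + Y x)"
  by (simp add: closed_form_def smooth_add dext_def ext_deriv_def partial_add wedge.add_right sum.distrib)

text \<open>The graded Leibniz rule; \<open>parity\<close> supplies the sign, because
  \<open>X\<close> may have parts of several degrees.\<close>

lemma closed_form_wedge:
  assumes "closed_form X" "closed_form Y"
  shows "closed_form (\<lambda>x. X x \<and>\<^sub>\<Lambda> Y x)"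
  unfolding closed_form_def
proof (intro conjI allI)
  have sm: "smooth X" "smooth Y" using assms by (simp_all add: closed_form_def)
  then show "smooth (\<lambda>x. X x \<and>\<^sub>\<Lambda> Y x)" by (rule smooth_bilinear[OF bounded_bilinear_wedge])
  fix x
  have "dext (\<lambda>x. X x \<and>\<^sub>\<Lambda> Y x) x = (\<Sum>j\<in>UNIV. dx j \<and>\<^sub>\<Lambda> (X x \<and>\<^sub>\<Lambda> partial j Y x)) + (\<Sum>j\<in>UNIV. dx j \<and>\<^sub>\<Lambda> (partial j X x \<and>\<^sub>\<Lambda> Y x))"
    by (simp add: dext_def ext_deriv_def partial_bilinear[OF bounded_bilinear_wedge sm] wedge.add_right sum.distrib)
  also have "(\<Sum>j\<in>UNIV. dx j \<and>\<^sub>\<Lambda> (X x \<and>\<^sub>\<Lambda> partial j Y x)) = (\<Sum>j\<in>UNIV. parity (X x) \<and>\<^sub>\<Lambda> (dx j \<and>\<^sub>\<Lambda> partial j Y x))"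
    by (simp only: dx_wedge_move)
  also have "\<dots> = parity (X x) \<and>\<^sub>\<Lambda> dext Y x" by (simp add: dext_def ext_deriv_def wedge.sum_right)
  also have "(\<Sum>j\<in>UNIV. dx j \<and>\<^sub>\<Lambda> (partial j X x \<and>\<^sub>\<Lambda> Y x)) = dext X x \<and>\<^sub>\<Lambda> Y x"
    by (simp add: dext_def ext_deriv_def wedge.sum_left wedge_assoc)
  finally show "dext (\<lambda>x. X x \<and>\<^sub>\<Lambda> Y x) x = 0"
    using assms by (simp add: closed_form_def wedge.zero_left wedge.zero_right)
qed

text \<open>Second derivatives are symmetric and the product of two 1-forms is antisymmetric, so the
  double sum equals its own negative.\<close>

lemma closed_form_dext:
  assumes "smooth \<phi>"
  shows "closed_form (dext \<phi>)"
  unfolding closed_form_def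
proof (intro conjI allI)
  show "smooth (dext \<phi>)" by (rule smooth_dext[OF assms])
  fix x
  have p: "partial i (dext \<phi>) x = (\<Sum>j\<in>UNIV. dx j \<and>\<^sub>\<Lambda> partial i (partial j \<phi>) x)" for i
  proof -
    have "partial i (\<lambda>x. \<Sum>j\<in>J. dx j \<and>\<^sub>\<Lambda> partial j \<phi> x) x = (\<Sum>j\<in>J. dx j \<and>\<^sub>\<Lambda> partial i (partial j \<phi>) x)"
      if "finite J" for J using that
    proof (induction J rule: finite_induct)
      case empty
      show ?case by (simp add: partial_const)
    next
      case (insert j J)
      have "smooth (\<lambda>x. dx j \<and>\<^sub>\<Lambda> partial j \<phi> x)" "smooth (\<lambda>x. \<Sum>j\<in>J. dx j \<and>\<^sub>\<Lambda> partial j \<phi> x)"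
        using assms by (intro smooth_sum smooth_linear[OF bounded_linear_wedge_left] smooth_partial; simp)+
      then show ?case using insert
        by (simp add: partial_add partial_linear[OF bounded_linear_wedge_left smooth_partial[OF assms]])
    qed
    then show ?thesis by (simp add: dext_def ext_deriv_def[abs_def])
  qed
  let ?S = "\<Sum>i\<in>UNIV. \<Sum>j\<in>UNIV. dx i \<and>\<^sub>\<Lambda> (dx j \<and>\<^sub>\<Lambda> partial i (partial j \<phi>) x)"
  have S: "dext (dext \<phi>) x = ?S" 
    by (simp add: dext_def[of "dext \<phi>"] ext_deriv_def p wedge.sum_right)
  have "?S = (\<Sum>j\<in>UNIV. \<Sum>i\<in>UNIV. dx i \<and>\<^sub>\<Lambda> (dx j \<and>\<^sub>\<Lambda> partial i (partial j \<phi>) x))" by (rule sum.swap)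
  also have "\<dots> = (\<Sum>j\<in>UNIV. \<Sum>i\<in>UNIV. - (dx j \<and>\<^sub>\<Lambda> (dx i \<and>\<^sub>\<Lambda> partial j (partial i \<phi>) x)))"
  proof (intro sum.cong refl)
    fix i j :: 'a
    have "dx i \<and>\<^sub>\<Lambda> dx j = - (dx j \<and>\<^sub>\<Lambda> (dx i :: 'a form))"
      using wedge_commute[OF dx_Lambda dx_Lambda, of i j] by simp
    then show "dx i \<and>\<^sub>\<Lambda> (dx j \<and>\<^sub>\<Lambda> partial i (partial j \<phi>) x) = - (dx j \<and>\<^sub>\<Lambda> (dx i \<and>\<^sub>\<Lambda> partial j (partial i \<phi>) x))"
      by (simp add: wedge_assoc[symmetric] wedge.minus_left partial_partial[OF assms, of i j])
  qed
  also have "\<dots> = - ?S" by (simp add: sum_negf)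
  finally have "?S + ?S = 0" by (simp only: eq_neg_iff_add_eq_0)
  then have "2 *\<^sub>R ?S = 0" by (simp only: scaleR_2)
  then have "?S = 0" by (simp only: scaleR_eq_0_iff) simp
  then show "dext (dext \<phi>) x = 0" using S by simp
qed

text \<open>For closed \<open>X\<close> the integrand is the divergence of the compactly supported
  functions \<open>\<psi> j\<close>, the coefficients of d(\<phi> \<and> X) tested against
  \<open>c\<close>.\<close>

lemma integral_exact:
  assumes \<phi>: "\<phi> \<in> test_functions \<Omega>" and X: "closed_form X" and \<Omega>: "\<Omega> \<in> sets lebesgue"
  shows "(\<integral>x. c \<bullet> (dext \<phi> x \<and>\<^sub>\<Lambda> X x) \<partial>lebesgue_on \<Omega>) = 0"
proof -
  note sm = test_functionsD(1)[OF \<phi>]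
  have smX: "smooth X" using X by (simp add: closed_form_def)
  have L: "bounded_linear (\<lambda>y. c \<bullet> (dx j \<and>\<^sub>\<Lambda> y))" for j
    by (rule bounded_linear_compose[OF bounded_linear_inner_right bounded_linear_wedge_left])
  define \<psi> where "\<psi> j x = c \<bullet> (dx j \<and>\<^sub>\<Lambda> (\<phi> x \<and>\<^sub>\<Lambda> X x))" for j x
  have smw: "smooth (\<lambda>x. \<phi> x \<and>\<^sub>\<Lambda> X x)" by (rule smooth_bilinear[OF bounded_bilinear_wedge sm smX])
  have \<psi>: "\<psi> j \<in> test_functions \<Omega>" for j
    unfolding \<psi>_def[abs_def]
    by (intro test_functions_linear[OF L] test_functions_bilinear[OF \<phi> smX bounded_bilinear_wedge])
  have "c \<bullet> (dext \<phi> x \<and>\<^sub>\<Lambda> X x) = (\<Sum>j\<in>UNIV. partial j (\<psi> j) x)" for x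
  proof -
    have "(\<Sum>j\<in>UNIV. partial j (\<psi> j) x) = (\<Sum>j\<in>UNIV. c \<bullet> (dx j \<and>\<^sub>\<Lambda> (\<phi> x \<and>\<^sub>\<Lambda> partial j X x + partial j \<phi> x \<and>\<^sub>\<Lambda> X x)))"
      unfolding \<psi>_def[abs_def] partial_linear[OF L smw] partial_bilinear[OF bounded_bilinear_wedge sm smX] ..
    also have "\<dots> = c \<bullet> (\<Sum>j\<in>UNIV. dx j \<and>\<^sub>\<Lambda> (\<phi> x \<and>\<^sub>\<Lambda> partial j X x)) + c \<bullet> (\<Sum>j\<in>UNIV. dx j \<and>\<^sub>\<Lambda> (partial j \<phi> x \<and>\<^sub>\<Lambda> X x))"
      by (simp add: inner_sum_right inner_add_right wedge.add_right sum.distrib)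
    also have "(\<Sum>j\<in>UNIV. dx j \<and>\<^sub>\<Lambda> (\<phi> x \<and>\<^sub>\<Lambda> partial j X x)) = (\<Sum>j\<in>UNIV. parity (\<phi> x) \<and>\<^sub>\<Lambda> (dx j \<and>\<^sub>\<Lambda> partial j X x))"
      by (simp only: dx_wedge_move)
    also have "\<dots> = parity (\<phi> x) \<and>\<^sub>\<Lambda> dext X x" by (simp add: dext_def ext_deriv_def wedge.sum_right)
    also have "\<dots> = 0" using X by (simp add: closed_form_def wedge.zero_right)
    also have "(\<Sum>j\<in>UNIV. dx j \<and>\<^sub>\<Lambda> (partial j \<phi> x \<and>\<^sub>\<Lambda> X x)) = dext \<phi> x \<and>\<^sub>\<Lambda> X x"
      by (simp add: dext_def ext_deriv_def wedge.sum_left wedge_assoc)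
    finally show ?thesis by simp
  qed
  then have "(\<integral>x. c \<bullet> (dext \<phi> x \<and>\<^sub>\<Lambda> X x) \<partial>lebesgue_on \<Omega>) = (\<integral>x. (\<Sum>j\<in>UNIV. partial j (\<psi> j) x) \<partial>lebesgue_on \<Omega>)" by simp
  also have "\<dots> = (\<Sum>j\<in>UNIV. \<integral>x. partial j (\<psi> j) x \<partial>lebesgue_on \<Omega>)"
    by (intro Bochner_Integration.integral_sum test_functions_integrable_on[OF test_functions_partial[OF \<psi>] \<Omega>])
  also have "\<dots> = 0" by (simp add: integral_partial[OF \<psi> \<Omega>])
  finally show ?thesis .
qed

subsection \<open>Bounded functions on bounded open sets\<close>

lemma L_inftyI: "u \<in> borel_measurable (lebesgue_on \<Omega>) \<Longrightarrow> AE x in lebesgue_on \<Omega>. norm (u x) \<le> C \<Longrightarrow> u \<in> L_infty \<Omega>"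
  unfolding L_infty_def by blast

lemma L_infty_const: "(\<lambda>_. c) \<in> L_infty \<Omega>"
  by (rule L_inftyI[of _ _ "norm c"]) simp_all

lemma L_infty_add:
  assumes "u \<in> L_infty \<Omega>" "v \<in> L_infty \<Omega>"
  shows "(\<lambda>x. u x + v x) \<in> L_infty \<Omega>"
proof -
  obtain C D where "AE x in lebesgue_on \<Omega>. norm (u x) \<le> C" "AE x in lebesgue_on \<Omega>. norm (v x) \<le> D"
    using assms unfolding L_infty_def by blast
  then have "AE x in lebesgue_on \<Omega>. norm (u x + v x) \<le> C + D"
    by eventually_elim (rule norm_triangle_mono)
  then show ?thesis using assms by (intro L_inftyI) (auto simp: L_infty_def)
qed

lemma L_infty_bilinear:
  fixes B :: "'a::euclidean_space \<Rightarrow> 'b::euclidean_space \<Rightarrow> 'c::euclidean_space"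
  assumes B: "bounded_bilinear B" and uv: "u \<in> L_infty \<Omega>" "v \<in> L_infty \<Omega>"
  shows "(\<lambda>x. B (u x) (v x)) \<in> L_infty \<Omega>"
proof -
  obtain C D where CD: "AE x in lebesgue_on \<Omega>. norm (u x) \<le> C" "AE x in lebesgue_on \<Omega>. norm (v x) \<le> D"
    using uv unfolding L_infty_def by blast
  obtain K where K: "\<And>a b. norm (B a b) \<le> norm a * norm b * K" "K > 0"
    using bounded_bilinear.pos_bounded[OF B] by blast
  from CD have "AE x in lebesgue_on \<Omega>. norm (B (u x) (v x)) \<le> C * D * K"
  proof eventually_elim
    case (elim x)
    have "norm (B (u x) (v x)) \<le> norm (u x) * norm (v x) * K" by (rule K)
    also have "\<dots> \<le> C * D * K"
      using elim K(2) order_trans[OF norm_ge_zero elim(1)] by (intro mult_right_mono mult_mono) auto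
    finally show ?case .
  qed
  moreover have "(\<lambda>x. B (u x) (v x)) \<in> borel_measurable (lebesgue_on \<Omega>)"
  proof -
    have "continuous_on UNIV (\<lambda>p. B (fst p) (snd p))"
      by (intro bounded_bilinear.continuous_on[OF B] continuous_intros)
    then show ?thesis using uv borel_measurable_continuous_Pair[of u "lebesgue_on \<Omega>" v B]
      by (simp add: L_infty_def)
  qed
  ultimately show ?thesis by (intro L_inftyI)
qed

lemma smooth_L_infty:
  fixes X :: "real ^ 'n::finite \<Rightarrow> 'b::euclidean_space"
  assumes "smooth X" "open \<Omega>" "bounded \<Omega>"
  shows "X \<in> L_infty \<Omega>"
proof -
  have "compact (X ` closure \<Omega>)"
    using assms(1) compact_closure[THEN iffD2, OF assms(3)] by (intro compact_continuous_image smooth_continuous)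
  then obtain C where C: "\<And>x. x \<in> closure \<Omega> \<Longrightarrow> norm (X x) \<le> C"
    using compact_imp_bounded by (fastforce simp: bounded_iff)
  have "AE x in lebesgue_on \<Omega>. norm (X x) \<le> C"
    using C closure_subset[of \<Omega>] by (intro AE_I2) auto
  moreover have "X \<in> borel_measurable (lebesgue_on \<Omega>)"
    by (intro measurable_restrict_space1 measurable_completion) (simp add: smooth_measurable[OF assms(1)])
  ultimately show ?thesis by (rule L_inftyI[rotated])
qed

lemma finite_measure_bounded_open: "open \<Omega> \<Longrightarrow> bounded \<Omega> \<Longrightarrow> finite_measure (lebesgue_on \<Omega>)"
  by (rule finite_measure_lebesgue_on) (simp add: lmeasurable_open)

lemma L_infty_integrable:
  fixes u :: "real ^ 'n::finite \<Rightarrow> 'b::euclidean_space"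
  assumes "u \<in> L_infty \<Omega>" "open \<Omega>" "bounded \<Omega>"
  shows "integrable (lebesgue_on \<Omega>) u"
proof -
  interpret finite_measure "lebesgue_on \<Omega>" using assms by (intro finite_measure_bounded_open)
  show ?thesis using assms(1) integrable_const_bound[of u] unfolding L_infty_def by blast
qed

subsection \<open>Limits of exact forms\<close>

text \<open>What remains of d\<omega> for \<omega> with bounded derivatives and zero boundary
  values: it is bounded, and it is an L^1 limit of exact forms with compact support. The
  approximating forms carry no uniform bound.\<close>

definition exact_limit :: "(real ^ 'n::finite) set \<Rightarrow> (real ^ 'n \<Rightarrow> 'n form) \<Rightarrow> bool" where
  "exact_limit \<Omega> E \<longleftrightarrow> E \<in> L_infty \<Omega> \<and> (\<exists>\<phi>. (\<forall>p::nat. \<phi> p \<in> test_functions \<Omega>) \<and>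
     (\<lambda>p. \<integral>x. norm (dext (\<phi> p) x - E x) \<partial>lebesgue_on \<Omega>) \<longlonglongrightarrow> 0)"

text \<open>Replaces a single factor. Convergence of this factor in L^1 suffices because its
  neighbours \<open>A\<close> and \<open>W\<close> are essentially bounded, so the error is at most
  a constant times the L^1 distance.\<close>

lemma exact_limit_approx:
  fixes \<Omega> :: "(real ^ 'n::finite) set"
  assumes \<Omega>: "open \<Omega>" "bounded \<Omega>" and E: "exact_limit \<Omega> E" and A: "A \<in> L_infty \<Omega>" and W: "W \<in> L_infty \<Omega>"
    and zero: "\<And>\<psi>. \<psi> \<in> test_functions \<Omega> \<Longrightarrow> (\<integral>x. c \<bullet> (A x \<and>\<^sub>\<Lambda> ((\<zeta> + dext \<psi> x) \<and>\<^sub>\<Lambda> W x)) \<partial>lebesgue_on \<Omega>) = 0"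
  shows "(\<integral>x. c \<bullet> (A x \<and>\<^sub>\<Lambda> ((\<zeta> + E x) \<and>\<^sub>\<Lambda> W x)) \<partial>lebesgue_on \<Omega>) = 0"
proof -
  let ?M = "lebesgue_on \<Omega>" and ?J = "\<lambda>F x. c \<bullet> (A x \<and>\<^sub>\<Lambda> (F x \<and>\<^sub>\<Lambda> W x))"
  obtain \<phi> where \<phi>: "\<And>p::nat. \<phi> p \<in> test_functions \<Omega>" "(\<lambda>p. \<integral>x. norm (dext (\<phi> p) x - E x) \<partial>?M) \<longlonglongrightarrow> 0"
    and EL: "E \<in> L_infty \<Omega>" using E unfolding exact_limit_def by blast
  have J: "integrable ?M (?J F)" if "F \<in> L_infty \<Omega>" for F
    by (intro L_infty_integrable[OF _ \<Omega>] L_infty_bilinear[OF bounded_bilinear_inner] L_infty_bilinear[OF bounded_bilinear_wedge]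
        L_infty_const A W that)
  obtain CA CW where C: "AE x in ?M. norm (A x) \<le> CA" "AE x in ?M. norm (W x) \<le> CW"
    using A W unfolding L_infty_def by blast
  obtain K where K: "\<And>a b :: 'n form. norm (a \<and>\<^sub>\<Lambda> b) \<le> norm a * norm b * K" "K > 0" using wedge.pos_bounded by blast
  define C where "C = norm c * (CA * CW * K * K)"
  have bound: "AE x in ?M. norm (?J F x) \<le> C * norm (F x)" for F
    using C(1,2)
  proof eventually_elim
    case (elim x)
    have pos: "0 \<le> CA" "0 \<le> CW" using elim norm_ge_zero order_trans by blast+
    have "norm (A x \<and>\<^sub>\<Lambda> (F x \<and>\<^sub>\<Lambda> W x)) \<le> norm (A x) * norm (F x \<and>\<^sub>\<Lambda> W x) * K" by (rule K)
    also have "\<dots> \<le> CA * (norm (F x) * CW * K) * K"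
    proof -
      have "norm (F x \<and>\<^sub>\<Lambda> W x) \<le> norm (F x) * norm (W x) * K" by (rule K)
      also have "\<dots> \<le> norm (F x) * CW * K" using elim K(2) by (intro mult_right_mono mult_left_mono) auto
      finally show ?thesis using elim K(2) pos by (intro mult_right_mono mult_mono) auto
    qed
    finally have "norm c * norm (A x \<and>\<^sub>\<Lambda> (F x \<and>\<^sub>\<Lambda> W x)) \<le> norm c * (CA * (norm (F x) * CW * K) * K)"
      by (intro mult_left_mono) simp_all
    then show ?case using Cauchy_Schwarz_ineq2[of c "A x \<and>\<^sub>\<Lambda> (F x \<and>\<^sub>\<Lambda> W x)"] by (simp add: C_def mult_ac)
  qed
  have d: "dext (\<phi> p) \<in> L_infty \<Omega>" for p
    by (intro smooth_L_infty[OF smooth_dext \<Omega>] test_functionsD(1)[OF \<phi>(1)])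
  have diff: "(\<lambda>x. dext (\<phi> p) x - E x) \<in> L_infty \<Omega>" for p
    using L_infty_add[OF d L_infty_bilinear[OF bounded_bilinear_scaleR L_infty_const[of "-1"] EL]] by simp
  have est: "\<bar>\<integral>x. ?J (\<lambda>x. \<zeta> + E x) x \<partial>?M\<bar> \<le> C * (\<integral>x. norm (dext (\<phi> p) x - E x) \<partial>?M)" for p
  proof -
    have i1: "integrable ?M (?J (\<lambda>x. \<zeta> + dext (\<phi> p) x))" "integrable ?M (?J (\<lambda>x. \<zeta> + E x))"
      by (intro J L_infty_add L_infty_const d EL)+
    have "(\<integral>x. ?J (\<lambda>x. dext (\<phi> p) x - E x) x \<partial>?M) = (\<integral>x. ?J (\<lambda>x. \<zeta> + dext (\<phi> p) x) x - ?J (\<lambda>x. \<zeta> + E x) x \<partial>?M)"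
      by (intro Bochner_Integration.integral_cong refl)
         (simp add: wedge.add_left wedge.add_right wedge.diff_left wedge.diff_right inner_add_right inner_diff_right)
    also have "\<dots> = - (\<integral>x. ?J (\<lambda>x. \<zeta> + E x) x \<partial>?M)"
      using zero[OF \<phi>(1)] by (simp add: Bochner_Integration.integral_diff[OF i1])
    finally have "\<bar>\<integral>x. ?J (\<lambda>x. \<zeta> + E x) x \<partial>?M\<bar> = norm (\<integral>x. ?J (\<lambda>x. dext (\<phi> p) x - E x) x \<partial>?M)" by simp
    also have "\<dots> \<le> (\<integral>x. norm (?J (\<lambda>x. dext (\<phi> p) x - E x) x) \<partial>?M)" by (rule integral_norm_bound)
    also have "\<dots> \<le> (\<integral>x. C * norm (dext (\<phi> p) x - E x) \<partial>?M)"
      using bound[of "\<lambda>x. dext (\<phi> p) x - E x"]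
      by (intro integral_mono_AE integrable_norm J diff integrable_mult_right L_infty_integrable[OF _ \<Omega>])
    finally show ?thesis by simp
  qed
  have "(\<lambda>p. C * (\<integral>x. norm (dext (\<phi> p) x - E x) \<partial>?M)) \<longlonglongrightarrow> C * 0" by (intro tendsto_intros \<phi>(2))
  then have "\<bar>\<integral>x. ?J (\<lambda>x. \<zeta> + E x) x \<partial>?M\<bar> \<le> 0"
    using est by (intro LIMSEQ_le_const[of _ "0"]) auto
  then show ?thesis by simp
qed

lemma wedge_list_L_infty:
  assumes "\<And>i. (\<lambda>x. \<eta> x $ i) \<in> L_infty \<Omega>"
  shows "(\<lambda>x. wedge_list (\<eta> x) is) \<in> L_infty \<Omega>"
  by (induction "is") (simp_all add: L_infty_const L_infty_bilinear[OF bounded_bilinear_wedge] assms)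

text \<open>Induction on the word: the first factor \<xi>_i + E_i is approximated by \<xi>_i +
  d\<psi>, which is closed and is absorbed into \<open>X\<close>. For this reason \<open>X\<close>
  is an arbitrary closed form.\<close>

lemma integral_exact_wedge_list:
  fixes \<Omega> :: "(real ^ 'n::finite) set" and \<xi> :: "'n form ^ 'm::finite"
  assumes \<Omega>: "open \<Omega>" "bounded \<Omega>" and E: "\<And>i. exact_limit \<Omega> (E i)"
    and \<phi>: "\<phi> \<in> test_functions \<Omega>" and X: "closed_form X"
  shows "(\<integral>x. c \<bullet> (dext \<phi> x \<and>\<^sub>\<Lambda> X x \<and>\<^sub>\<Lambda> wedge_list (\<chi> i. \<xi> $ i + E i x) is) \<partial>lebesgue_on \<Omega>) = 0"
  using X
proof (induction "is" arbitrary: X)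
  case Nil
  then show ?case using integral_exact[OF \<phi> Nil lebesgue_open[OF \<Omega>(1)]] by simp
next
  case (Cons i "is")
  have EL: "E i \<in> L_infty \<Omega>" for i using E by (simp add: exact_limit_def)
  have smX: "smooth X" using Cons.prems by (simp add: closed_form_def)
  have A: "(\<lambda>x. dext \<phi> x \<and>\<^sub>\<Lambda> X x) \<in> L_infty \<Omega>"
    by (intro L_infty_bilinear[OF bounded_bilinear_wedge] smooth_L_infty[OF _ \<Omega>] smooth_dext smX test_functionsD(1)[OF \<phi>])
  have W: "(\<lambda>x. wedge_list (\<chi> i. \<xi> $ i + E i x) is) \<in> L_infty \<Omega>"
    by (intro wedge_list_L_infty) (simp add: L_infty_add L_infty_const EL)
  have "(\<integral>x. c \<bullet> ((dext \<phi> x \<and>\<^sub>\<Lambda> X x) \<and>\<^sub>\<Lambda> ((\<xi> $ i + E i x) \<and>\<^sub>\<Lambda> wedge_list (\<chi> i. \<xi> $ i + E i x) is)) \<partial>lebesgue_on \<Omega>) = 0"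
  proof (rule exact_limit_approx[OF \<Omega> E A W])
    fix \<psi> :: "real ^ 'n \<Rightarrow> 'n form" assume \<psi>: "\<psi> \<in> test_functions \<Omega>"
    have "closed_form (\<lambda>x. X x \<and>\<^sub>\<Lambda> (\<xi> $ i + dext \<psi> x))"
      by (intro closed_form_wedge closed_form_add closed_form_const closed_form_dext Cons.prems test_functionsD(1)[OF \<psi>])
    from Cons.IH[OF this]
    show "(\<integral>x. c \<bullet> ((dext \<phi> x \<and>\<^sub>\<Lambda> X x) \<and>\<^sub>\<Lambda> ((\<xi> $ i + dext \<psi> x) \<and>\<^sub>\<Lambda> wedge_list (\<chi> i. \<xi> $ i + E i x) is)) \<partial>lebesgue_on \<Omega>) = 0"
      by (simp add: wedge_assoc)
  qed
  then show ?case by (simp add: wedge_assoc)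
qed

text \<open>Splitting off the first factor, the part with \<open>E i\<close> integrates to zero
  after approximation by d\<psi>, and the constant \<xi>_i is shifted into \<open>c\<close>, which
  therefore has to be arbitrary.\<close>

lemma integral_wedge_list:
  fixes \<Omega> :: "(real ^ 'n::finite) set" and \<xi> :: "'n form ^ 'm::finite"
  assumes \<Omega>: "open \<Omega>" "bounded \<Omega>" and E: "\<And>i. exact_limit \<Omega> (E i)"
  shows "(\<integral>x. c \<bullet> wedge_list (\<chi> i. \<xi> $ i + E i x) is \<partial>lebesgue_on \<Omega>) = measure lebesgue \<Omega> * (c \<bullet> wedge_list \<xi> is)"
proof (induction "is" arbitrary: c)
  case Nil
  interpret finite_measure "lebesgue_on \<Omega>" using \<Omega> by (rule finite_measure_bounded_open)
  show ?case using \<Omega> by (simp add: measure_restrict_space)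
next
  case (Cons i "is")
  let ?W = "\<lambda>x. wedge_list (\<chi> i. \<xi> $ i + E i x) is"
  have EL: "E i \<in> L_infty \<Omega>" for i using E by (simp add: exact_limit_def)
  have W: "?W \<in> L_infty \<Omega>"
    by (intro wedge_list_L_infty) (simp add: L_infty_add L_infty_const EL)
  have 0: "(\<integral>x. c \<bullet> (one_form \<and>\<^sub>\<Lambda> ((0 + E i x) \<and>\<^sub>\<Lambda> ?W x)) \<partial>lebesgue_on \<Omega>) = 0"
  proof (rule exact_limit_approx[OF \<Omega> E L_infty_const W])
    fix \<psi> :: "real ^ 'n \<Rightarrow> 'n form" assume \<psi>: "\<psi> \<in> test_functions \<Omega>"
    show "(\<integral>x. c \<bullet> (one_form \<and>\<^sub>\<Lambda> ((0 + dext \<psi> x) \<and>\<^sub>\<Lambda> ?W x)) \<partial>lebesgue_on \<Omega>) = 0"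
      using integral_exact_wedge_list[OF \<Omega> E \<psi> closed_form_const[of one_form]] by simp
  qed
  have i: "integrable (lebesgue_on \<Omega>) (\<lambda>x. c \<bullet> (F x \<and>\<^sub>\<Lambda> ?W x))" if "F \<in> L_infty \<Omega>" for F
    by (intro L_infty_integrable[OF _ \<Omega>] L_infty_bilinear[OF bounded_bilinear_inner] L_infty_bilinear[OF bounded_bilinear_wedge]
        L_infty_const W that)
  \<comment> \<open>The adjoint of multiplication by the constant factor moves it to the other side
    of the scalar product, where the induction hypothesis applies.\<close>
  define c' where "c' = adjoint (\<lambda>y. \<xi> $ i \<and>\<^sub>\<Lambda> y) c"
  have c': "c \<bullet> (\<xi> $ i \<and>\<^sub>\<Lambda> y) = c' \<bullet> y" for y
    unfolding c'_def using adjoint_works[OF bounded_linear.linear[OF bounded_linear_wedge_left]]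
    by (metis inner_commute)
  have "(\<integral>x. c \<bullet> wedge_list (\<chi> i. \<xi> $ i + E i x) (i # is) \<partial>lebesgue_on \<Omega>)
      = (\<integral>x. c \<bullet> (\<xi> $ i \<and>\<^sub>\<Lambda> ?W x) + c \<bullet> (E i x \<and>\<^sub>\<Lambda> ?W x) \<partial>lebesgue_on \<Omega>)"
    by (simp add: wedge.add_left inner_add_right)
  also have "\<dots> = (\<integral>x. c' \<bullet> ?W x \<partial>lebesgue_on \<Omega>)"
    using 0 by (subst Bochner_Integration.integral_add[OF i[OF L_infty_const] i[OF EL]]) (simp add: c')
  also have "\<dots> = measure lebesgue \<Omega> * (c \<bullet> wedge_list \<xi> (i # is))" by (simp add: Cons.IH c')
  finally show ?case .
qed

subsection \<open>Weak exterior derivatives\<close>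

lemma L_infty_AE_cong:
  fixes u v :: "real ^ 'n::finite \<Rightarrow> 'b::euclidean_space"
  assumes "u \<in> L_infty \<Omega>" "AE x in lebesgue_on \<Omega>. u x = v x" "v \<in> borel_measurable (lebesgue_on \<Omega>)"
  shows "v \<in> L_infty \<Omega>"
proof -
  obtain C where "AE x in lebesgue_on \<Omega>. norm (u x) \<le> C" using assms(1) unfolding L_infty_def by blast
  with assms(2) have "AE x in lebesgue_on \<Omega>. norm (v x) \<le> C" by eventually_elim simp
  then show ?thesis using assms(3) by (intro L_inftyI)
qed

text \<open>Three families of representatives meet: \<open>D\<close> is given, bounded ones come
  from the space of bounded derivatives, and \<open>G\<close> comes from the approximating sequence.
  They agree almost everywhere, so \<open>G\<close> is bounded and also the limit of the
  sequence.\<close>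

lemma W1_infty_zero_exact_limit:
  fixes \<Omega> :: "(real ^ 'n::finite) set"
  assumes \<Omega>: "open \<Omega>" "bounded \<Omega>" and \<omega>: "\<omega> \<in> W1_infty_zero \<Omega>" and D: "\<And>j. weak_partial \<Omega> j \<omega> (D j)"
  shows "\<exists>E. exact_limit \<Omega> E \<and> (AE x in lebesgue_on \<Omega>. ext_deriv D x = E x)"
proof -
  let ?M = "lebesgue_on \<Omega>"
  obtain G \<phi> where G: "\<And>j. weak_partial \<Omega> j \<omega> (G j)" "\<And>j. integrable ?M (G j)"
    and \<phi>: "\<And>p::nat. \<phi> p \<in> test_functions \<Omega>" "\<And>j. (\<lambda>p. \<integral>x. norm (partial j (\<phi> p) x - G j x) \<partial>?M) \<longlonglongrightarrow> 0"
    using \<omega> unfolding W1_infty_zero_def W1_1_zero_def by blast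
  have GL: "G j \<in> L_infty \<Omega>" for j
  proof -
    obtain g where g: "weak_partial \<Omega> j \<omega> g" "g \<in> L_infty \<Omega>"
      using \<omega> unfolding W1_infty_zero_def W1_infty_def by blast
    show ?thesis
      by (rule L_infty_AE_cong[OF g(2) weak_partial_unique[OF \<Omega>(1) g(1) G(1)] borel_measurable_integrable[OF G(2)]])
  qed
  have "AE x in ?M. \<forall>j\<in>UNIV. D j x = G j x"
    using weak_partial_unique[OF \<Omega>(1) D G(1)] by (subst AE_ball_countable) auto
  then have "AE x in ?M. ext_deriv D x = ext_deriv G x"
    by eventually_elim (simp add: ext_deriv_def)
  moreover have "exact_limit \<Omega> (ext_deriv G)"
    unfolding exact_limit_def
  proof (intro conjI exI[of _ \<phi>] allI \<phi>(1))
    have "(\<lambda>x. \<Sum>j\<in>J. dx j \<and>\<^sub>\<Lambda> G j x) \<in> L_infty \<Omega>" for J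
      by (induction J rule: infinite_finite_induct)
         (simp_all add: L_infty_const L_infty_add L_infty_bilinear[OF bounded_bilinear_wedge] GL)
    then show EL: "ext_deriv G \<in> L_infty \<Omega>" by (simp add: ext_deriv_def[abs_def])
    obtain K where K: "\<And>a b :: 'n form. norm (a \<and>\<^sub>\<Lambda> b) \<le> norm a * norm b * K" "K > 0" using wedge.pos_bounded by blast
    let ?b = "\<lambda>p. \<Sum>j\<in>UNIV. norm (dx j :: 'n form) * K * (\<integral>x. norm (partial j (\<phi> p) x - G j x) \<partial>?M)"
    have pd: "integrable ?M (\<lambda>x. partial j (\<phi> p) x - G j x)" for j p
      by (intro Bochner_Integration.integrable_diff G(2) test_functions_integrable_on[OF test_functions_partial[OF \<phi>(1)]] lebesgue_open \<Omega>(1))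
    have le: "(\<integral>x. norm (dext (\<phi> p) x - ext_deriv G x) \<partial>?M) \<le> ?b p" for p
    proof -
      have "(\<integral>x. norm (dext (\<phi> p) x - ext_deriv G x) \<partial>?M)
          \<le> (\<integral>x. (\<Sum>j\<in>UNIV. norm (dx j :: 'n form) * K * norm (partial j (\<phi> p) x - G j x)) \<partial>?M)"
      proof (rule integral_mono)
        show "integrable ?M (\<lambda>x. norm (dext (\<phi> p) x - ext_deriv G x))"
          by (intro integrable_norm Bochner_Integration.integrable_diff L_infty_integrable[OF EL \<Omega>]
              L_infty_integrable[OF smooth_L_infty[OF smooth_dext \<Omega>] \<Omega>] test_functionsD(1)[OF \<phi>(1)])
        show "integrable ?M (\<lambda>x. \<Sum>j\<in>UNIV. norm (dx j :: 'n form) * K * norm (partial j (\<phi> p) x - G j x))"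
          by (intro Bochner_Integration.integrable_sum integrable_mult_right integrable_norm pd)
        fix x
        have "norm (dext (\<phi> p) x - ext_deriv G x) = norm (\<Sum>j\<in>UNIV. dx j \<and>\<^sub>\<Lambda> (partial j (\<phi> p) x - G j x))"
          by (simp add: dext_def ext_deriv_def wedge.diff_right sum_subtractf)
        also have "\<dots> \<le> (\<Sum>j\<in>UNIV. norm (dx j :: 'n form) * K * norm (partial j (\<phi> p) x - G j x))"
          by (rule sum_norm_le) (use K(1) in \<open>simp add: mult_ac\<close>)
        finally show "norm (dext (\<phi> p) x - ext_deriv G x) \<le> (\<Sum>j\<in>UNIV. norm (dx j :: 'n form) * K * norm (partial j (\<phi> p) x - G j x))" .
      qed
      also have "\<dots> = ?b p"
        using pd by (subst Bochner_Integration.integral_sum) (auto intro!: integrable_mult_right integrable_norm)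
      finally show ?thesis .
    qed
    have "?b \<longlonglongrightarrow> (\<Sum>j\<in>UNIV. norm (dx j :: 'n form) * K * 0)" by (intro tendsto_intros \<phi>(2))
    then have "?b \<longlonglongrightarrow> 0" by simp
    then show "(\<lambda>p. \<integral>x. norm (dext (\<phi> p) x - ext_deriv G x) \<partial>?M) \<longlonglongrightarrow> 0"
      by (rule tendsto_sandwich[OF _ _ tendsto_const, rotated 2]) (use le in \<open>auto intro!: always_eventually integral_nonneg\<close>)
  qed
  ultimately show ?thesis by blast
qed

lift_definition degree_part :: "nat \<Rightarrow> 'n::finite form \<Rightarrow> 'n form" is "\<lambda>k \<omega> vs. if length vs = k then \<omega> vs else 0"
proof -
  fix k and \<omega> :: "(real ^ 'n) list \<Rightarrow> real" assume "alternating_multilinear \<omega>"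
  moreover have "(\<lambda>v. if length (us @ v # vs) = k then \<omega> (us @ v # vs) else 0)
      = (if Suc (length us + length vs) = k then (\<lambda>v. \<omega> (us @ v # vs)) else (\<lambda>_. 0))" for us vs by auto
  ultimately show "alternating_multilinear (\<lambda>vs. if length vs = k then \<omega> vs else 0)"
    unfolding alternating_multilinear_def by (simp add: linear_zero)
qed

lemma bounded_linear_degree_part: "bounded_linear (degree_part k :: 'n::finite form \<Rightarrow> 'n form)"
  by (subst linear_conv_bounded_linear[symmetric])
     (auto intro!: linearI form_eqI simp: degree_part.rep_eq)

lemma degree_part_Lambda: "degree_part k \<omega> \<in> Lambda k"
  by (simp add: Lambda_def degree_part.rep_eq)

lemma degree_part_id: "\<omega> \<in> Lambda k \<Longrightarrow> degree_part k \<omega> = \<omega>"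
  by (rule form_eqI) (simp add: degree_part.rep_eq Lambda_app)

text \<open>The projection to degree \<open>k\<close> is linear and fixes \<open>\<omega>\<close> on
  \<open>\<Omega>\<close>, so the projection of \<open>D\<close> is again a weak derivative and
  coincides with \<open>D\<close> almost everywhere. It keeps the argument of \<open>f\<close>
  inside \<open>Lambda_prod k\<close>.\<close>

lemma weak_partial_Lambda:
  fixes \<Omega> :: "(real ^ 'n::finite) set" and D \<omega> :: "real ^ 'n \<Rightarrow> 'n form"
  assumes \<Omega>: "open \<Omega>" and D: "weak_partial \<Omega> j \<omega> D" and \<omega>: "\<And>x. x \<in> \<Omega> \<Longrightarrow> \<omega> x \<in> Lambda k"
  shows "AE x in lebesgue_on \<Omega>. D x \<in> Lambda k"
proof -
  let ?P = "degree_part k :: 'n form \<Rightarrow> 'n form" and ?M = "lebesgue_on \<Omega>"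
  note L = lebesgue_open[OF \<Omega>]
  have l: "locally_integrable \<Omega> \<omega>" "locally_integrable \<Omega> D" using D by (auto simp: weak_partial_def)
  have "weak_partial \<Omega> j \<omega> (\<lambda>x. ?P (D x))"
    unfolding weak_partial_def
  proof (intro conjI allI impI l)
    show "locally_integrable \<Omega> (\<lambda>x. ?P (D x))"
      using l(2) unfolding locally_integrable_def by (auto intro: integrable_bounded_linear[OF bounded_linear_degree_part])
    fix \<phi> :: "real ^ 'n \<Rightarrow> real" assume \<phi>: "\<phi> \<in> test_functions \<Omega>"
    have i1: "integrable ?M (\<lambda>x. partial j \<phi> x *\<^sub>R \<omega> x)"
      by (rule test_function_times_integrable[OF l(1) test_functions_partial[OF \<phi>] L])
    have i2: "integrable ?M (\<lambda>x. \<phi> x *\<^sub>R D x)" by (rule test_function_times_integrable[OF l(2) \<phi> L])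
    let ?A = "\<integral>x. partial j \<phi> x *\<^sub>R \<omega> x \<partial>?M" and ?B = "\<integral>x. \<phi> x *\<^sub>R D x \<partial>?M"
    note lin = bounded_linear.linear[OF bounded_linear_degree_part]
    have "(\<integral>x. ?P (partial j \<phi> x *\<^sub>R \<omega> x) \<partial>?M) = ?A"
      by (intro Bochner_Integration.integral_cong refl) (simp add: degree_part_id[OF \<omega>] linear_scale[OF lin])
    then have "?A = ?P ?A" by (simp add: integral_bounded_linear[OF bounded_linear_degree_part i1])
    moreover have "?A = - ?B" using D \<phi> by (simp add: weak_partial_def)
    ultimately have "?A = - ?P ?B" by (metis linear_neg[OF lin])
    also have "?P ?B = (\<integral>x. ?P (\<phi> x *\<^sub>R D x) \<partial>?M)" by (rule integral_bounded_linear[OF bounded_linear_degree_part i2, symmetric])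
    finally show "?A = - (\<integral>x. \<phi> x *\<^sub>R ?P (D x) \<partial>?M)"
      by (simp add: linear_scale[OF lin])
  qed
  from weak_partial_unique[OF \<Omega> this D] show ?thesis
    by eventually_elim (metis degree_part_Lambda)
qed

lemma ext_deriv_Lambda:
  assumes "\<And>j. D j x \<in> Lambda (k - 1)" "1 \<le> k"
  shows "ext_deriv D x \<in> Lambda k"
  unfolding ext_deriv_def
proof (intro subspace_sum subspace_Lambda)
  fix j
  have "1 + (k - 1) = k" using assms(2) by simp
  then show "dx j \<and>\<^sub>\<Lambda> D j x \<in> Lambda k" using wedge_Lambda[OF dx_Lambda assms(1), of j j] by simp
qed

section \<open>Quasiaffinity of power expansions\<close>

lemma measure_open_pos:
  fixes \<Omega> :: "(real ^ 'n::finite) set"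
  assumes "open \<Omega>" "bounded \<Omega>" "\<Omega> \<noteq> {}"
  shows "measure lebesgue \<Omega> > 0"
proof -
  have "\<Omega> \<in> lmeasurable" using assms by (simp add: lmeasurable_open)
  moreover have "\<not> negligible \<Omega>" using assms(1,3) by (rule open_not_negligible)
  ultimately have "measure lebesgue \<Omega> \<noteq> 0" by (simp add: negligible_iff_measure0)
  then show ?thesis using measure_nonneg[of lebesgue \<Omega>] by linarith
qed

text \<open>Completeness of Lebesgue measure. It serves the integrand of
  \<open>ext_quasiaffine\<close>, whose argument may leave \<open>Lambda_prod k\<close> on a null
  set, where nothing is known about \<open>f\<close>.\<close>

lemma lebesgue_on_measurable_AE:
  fixes u v :: "'a::euclidean_space \<Rightarrow> real"
  assumes \<Omega>: "\<Omega> \<in> sets lebesgue" and u: "u \<in> borel_measurable (lebesgue_on \<Omega>)" and ae: "AE x in lebesgue_on \<Omega>. u x = v x"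
  shows "v \<in> borel_measurable (lebesgue_on \<Omega>)"
proof (rule measurableI)
  fix B :: "real set" assume B: "B \<in> sets borel"
  let ?N = "{x \<in> \<Omega>. u x \<noteq> v x}"
  have "AE x in lebesgue. x \<in> \<Omega> \<longrightarrow> u x = v x" using ae \<Omega> by (simp add: AE_restrict_space_iff)
  then obtain N where N: "N \<in> null_sets lebesgue" "{x. \<not> (x \<in> \<Omega> \<longrightarrow> u x = v x)} \<subseteq> N"
    by (auto simp: eventually_ae_filter)
  have null: "S \<in> sets lebesgue" if "S \<subseteq> ?N" for S
    using N that by (intro null_setsD2[OF null_sets_completion_subset[OF _ N(1)]]) auto
  have "u -` B \<inter> space (lebesgue_on \<Omega>) \<in> sets (lebesgue_on \<Omega>)" using u B by (rule measurable_sets)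
  then have "u -` B \<inter> \<Omega> \<in> sets lebesgue" using \<Omega> by (auto simp: sets_restrict_space_iff)
  then have "((u -` B \<inter> \<Omega>) - ?N) \<union> (v -` B \<inter> ?N) \<in> sets lebesgue"
    using null[of ?N] null[of "v -` B \<inter> ?N"] by (intro sets.Un sets.Diff) auto
  also have "((u -` B \<inter> \<Omega>) - ?N) \<union> (v -` B \<inter> ?N) = v -` B \<inter> \<Omega>" by auto
  finally show "v -` B \<inter> space (lebesgue_on \<Omega>) \<in> sets (lebesgue_on \<Omega>)"
    using \<Omega> by (auto simp: sets_restrict_space_iff)
qed simp

lemma continuous_wedge_list: "continuous_on S (\<lambda>\<xi> :: 'n::finite form ^ 'm::finite. wedge_list \<xi> is)"
  by (induction "is") (auto intro!: bounded_bilinear.continuous_on[OF bounded_bilinear_wedge] continuous_intros)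

lemma power_expansion_imp_quasiaffine:
  fixes k :: "'m::{finite,linorder} \<Rightarrow> nat" and f :: "('n::finite form, 'm) vec \<Rightarrow> real"
  assumes k: "\<forall>i. 1 \<le> k i" and "power_expansion k f"
  shows "ext_quasiaffine k f"
proof -
  let ?I = "multiindices CARD('n) k" and ?V = "Lambda_prod k :: ('n form, 'm) vec set"
  obtain c where f: "\<And>\<xi>. \<xi> \<in> ?V \<Longrightarrow> f \<xi> = (\<Sum>\<alpha>\<in>?I. c \<alpha> \<bullet> multi_power \<xi> \<alpha>)"
    using assms(2) unfolding power_expansion_def by blast
  \<comment> \<open>The same polynomial on the whole surrounding type: continuous everywhere and
    equal to \<open>f\<close> on \<open>?V\<close>.\<close>
  define F where "F \<xi> = (\<Sum>\<alpha>\<in>?I. c \<alpha> \<bullet> wedge_list \<xi> (index_list \<alpha>))" for \<xi> :: "('n form, 'm) vec"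
  have fF: "f \<xi> = F \<xi>" if "\<xi> \<in> ?V" for \<xi> using f[OF that] by (simp add: F_def multi_power_eq)
  have contF: "continuous_on S F" for S
    unfolding F_def[abs_def] by (intro continuous_intros continuous_wedge_list)
  have "F \<in> borel_measurable (restrict_space borel ?V)"
    by (intro measurable_restrict_space1 borel_measurable_continuous_onI contF)
  then have "f \<in> borel_measurable (restrict_space borel ?V)"
    by (subst measurable_cong[of _ f F]) (auto simp: space_restrict_space fF)
  moreover have "\<exists>U. open U \<and> \<xi> \<in> U \<and> bounded (f ` (U \<inter> ?V))" if "\<xi> \<in> ?V" for \<xi>
  proof (intro exI conjI)
    have "bounded (F ` cball \<xi> 1)" by (intro compact_imp_bounded compact_continuous_image contF) simp
    then show "bounded (f ` (ball \<xi> 1 \<inter> ?V))"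
      by (rule bounded_subset) (use fF ball_subset_cball in \<open>auto simp: image_iff\<close>)
  qed simp_all
  moreover have "1 / measure lebesgue \<Omega> * (\<integral>x. f (\<chi> i. \<xi> $ i + ext_deriv (D i) x) \<partial>lebesgue_on \<Omega>) = f \<xi>"
    if \<Omega>: "open \<Omega>" "bounded \<Omega>" "\<Omega> \<noteq> {}" and \<xi>: "\<xi> \<in> ?V"
      and \<omega>: "\<And>i. \<omega> i \<in> W1_infty_zero \<Omega>" "\<And>i x. x \<in> \<Omega> \<Longrightarrow> \<omega> i x \<in> Lambda (k i - 1)"
        "\<And>i j. weak_partial \<Omega> j (\<omega> i) (D i j)"
    for \<Omega> :: "(real ^ 'n) set" and \<xi> :: "('n form, 'm) vec" and \<omega> D
  proof -
    let ?M = "lebesgue_on \<Omega>"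
    have "\<forall>i. \<exists>E. exact_limit \<Omega> E \<and> (AE x in ?M. ext_deriv (D i) x = E x)"
      using W1_infty_zero_exact_limit[OF \<Omega>(1,2) \<omega>(1,3)] by blast
    from choice[OF this] obtain E where
      E: "\<And>i. exact_limit \<Omega> (E i)" "\<And>i. AE x in ?M. ext_deriv (D i) x = E i x" by blast
    have EL: "E i \<in> L_infty \<Omega>" for i using E by (simp add: exact_limit_def)
    have "AE x in ?M. \<forall>i\<in>UNIV. ext_deriv (D i) x = E i x"
      using E(2) by (subst AE_ball_countable) auto
    moreover have "AE x in ?M. \<forall>i\<in>UNIV. \<forall>j\<in>UNIV. D i j x \<in> Lambda (k i - 1)"
    proof -
      have "AE x in ?M. \<forall>j\<in>UNIV. D i j x \<in> Lambda (k i - 1)" for i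
        using weak_partial_Lambda[OF \<Omega>(1) \<omega>(3) \<omega>(2)] by (subst AE_ball_countable) auto
      then show ?thesis by (subst AE_ball_countable) auto
    qed
    \<comment> \<open>Outside a null set the argument lies in \<open>?V\<close> and the chosen
      derivatives agree with \<open>E\<close>, so \<open>f\<close> may be exchanged for
      \<open>F\<close>.\<close>
    ultimately have ae: "AE x in ?M. F (\<chi> i. \<xi> $ i + E i x) = f (\<chi> i. \<xi> $ i + ext_deriv (D i) x)"
    proof eventually_elim
      case (elim x)
      have "ext_deriv (D i) x \<in> Lambda (k i)" for i
        using elim spec[OF k, of i] by (intro ext_deriv_Lambda) auto
      then have "(\<chi> i. \<xi> $ i + ext_deriv (D i) x) \<in> ?V"
        using \<xi> by (auto simp: Lambda_prod_def intro: subspace_add subspace_Lambda)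
      then show ?case using elim fF by simp
    qed
    have L: "(\<lambda>x. c \<alpha> \<bullet> wedge_list (\<chi> i. \<xi> $ i + E i x) (index_list \<alpha>)) \<in> L_infty \<Omega>" for \<alpha>
      by (intro L_infty_bilinear[OF bounded_bilinear_inner] L_infty_const wedge_list_L_infty)
         (simp add: L_infty_add L_infty_const EL)
    have FL: "(\<lambda>x. F (\<chi> i. \<xi> $ i + E i x)) \<in> borel_measurable ?M"
      unfolding F_def using L by (intro borel_measurable_sum) (simp add: L_infty_def)
    have "(\<integral>x. f (\<chi> i. \<xi> $ i + ext_deriv (D i) x) \<partial>?M) = (\<integral>x. F (\<chi> i. \<xi> $ i + E i x) \<partial>?M)"
      using ae by (intro integral_cong_AE lebesgue_on_measurable_AE[OF lebesgue_open[OF \<Omega>(1)] FL ae] FL) (auto elim: eventually_mono)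
    also have "\<dots> = (\<Sum>\<alpha>\<in>?I. \<integral>x. c \<alpha> \<bullet> wedge_list (\<chi> i. \<xi> $ i + E i x) (index_list \<alpha>) \<partial>?M)"
      unfolding F_def by (intro Bochner_Integration.integral_sum L_infty_integrable[OF L \<Omega>(1,2)])
    also have "\<dots> = measure lebesgue \<Omega> * F \<xi>"
      by (simp add: integral_wedge_list[OF \<Omega>(1,2) E(1)] F_def sum_distrib_left)
    finally show ?thesis
      using measure_open_pos[OF \<Omega>] fF[OF \<xi>] by simp
  qed
  ultimately show ?thesis unfolding ext_quasiaffine_def by blast
qed

section \<open>Laminates\<close>

subsection \<open>Zigzag functions\<close>

text \<open>\<open>step\<close> rescaled to an odd function that is -1 below -1 and 1 above
  1.\<close>

definition odd_step :: "real \<Rightarrow> real" where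
  "odd_step t = 2 * step ((t + 1) / 2) - 1"

lemma sm1_odd_step: "sm1 r odd_step"
proof -
  have "sm1 r (\<lambda>t. 2 * step (1/2 * t + 1/2) + (- 1))"
    by (intro sm1_add sm1_mult sm1_const sm1_compose[OF sm1_step sm1_affine])
  then show ?thesis by (simp add: odd_step_def[abs_def] add_divide_distrib)
qed

lemma odd_step_minus: "odd_step (- t) = - odd_step t"
proof -
  have "(- t + 1) / 2 = 1 - (t + 1) / 2" by (simp add: field_simps)
  then show ?thesis unfolding odd_step_def by (simp only: step_symm) simp
qed

lemma odd_step_abs_le: "\<bar>odd_step t\<bar> \<le> 1"
  using step_nonneg[of "(t + 1) / 2"] step_le_1[of "(t + 1) / 2"] by (simp add: odd_step_def)

lemma odd_step_abs_eq: "1 \<le> \<bar>t\<bar> \<Longrightarrow> \<bar>odd_step t\<bar> = 1"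
  by (cases "t \<ge> 0") (simp_all add: odd_step_def step_0 step_1)

lemma ex_antiderivative:
  fixes f :: "real \<Rightarrow> real"
  assumes "continuous_on UNIV f"
  shows "\<exists>F. F 0 = 0 \<and> (\<forall>t. (F has_real_derivative f t) (at t))"
proof (intro exI[of _ "\<lambda>u :: real. LBINT y=ereal 0..ereal u. f y"] conjI allI)
  show "(LBINT y=ereal 0..ereal 0. f y) = 0" by (rule interval_integral_endpoints_same)
  fix t :: real
  \<comment> \<open>An interval with \<open>0\<close> in it and \<open>t\<close> in its interior, so
    that the one-sided statement of the fundamental theorem becomes a derivative at
    \<open>t\<close>.\<close>
  let ?a = "- \<bar>t\<bar> - 1" and ?b = "\<bar>t\<bar> + 1"
  have "((\<lambda>u :: real. LBINT y=ereal 0..ereal u. f y) has_vector_derivative f t) (at t within {?a..?b})"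
    using assms by (intro interval_integral_FTC2) (auto intro: continuous_on_subset)
  moreover have "at t within {?a..?b} = at t" by (rule at_within_Icc_at) auto
  ultimately show "((\<lambda>u :: real. LBINT y=ereal 0..ereal u. f y) has_real_derivative f t) (at t)"
    by (simp add: has_real_derivative_iff_has_vector_derivative)
qed

text \<open>The antiderivative of a function which changes sign under translation by half a period is periodic.\<close>

lemma ex_zigzag:
  assumes "0 < e"
  shows "\<exists>F \<theta>. (\<forall>r. sm1 r F) \<and> (\<forall>t. (F has_real_derivative \<theta> t) (at t)) \<and> (\<forall>t. \<bar>F t\<bar> \<le> 2 * pi)
    \<and> (\<forall>t. \<bar>\<theta> t\<bar> \<le> 1) \<and> (\<forall>t. e \<le> \<bar>cos t\<bar> \<longrightarrow> \<bar>\<theta> t\<bar> = 1)"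
proof -
  \<comment> \<open>The cosine changes sign under a shift by \<open>pi\<close>, and
    \<open>odd_step\<close> preserves this. Scaling by \<open>1 / e\<close> saturates the value
    where the cosine is at least \<open>e\<close> in modulus.\<close>
  define \<theta> where "\<theta> t = odd_step (1 / e * cos t + 0)" for t
  have sm: "sm1 r \<theta>" for r
    unfolding \<theta>_def[abs_def] using sm1_cos_sin[of r]
    by (intro sm1_compose[OF sm1_odd_step] sm1_compose[OF sm1_affine, of r cos]) auto
  obtain \<theta>' where "\<And>t. (\<theta> has_real_derivative \<theta>' t) (at t)" using sm[of 1] by auto
  then have "continuous_on UNIV \<theta>" by (meson DERIV_isCont continuous_at_imp_continuous_on)
  then obtain F where F: "F 0 = 0" "\<And>t. (F has_real_derivative \<theta> t) (at t)" using ex_antiderivative by blast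
  have smF: "sm1 r F" for r
    by (cases r) (use F(2) sm in auto)
  have le: "\<bar>\<theta> t\<bar> \<le> 1" for t by (simp add: \<theta>_def odd_step_abs_le)
  have half: "\<theta> (t + pi) = - \<theta> t" for t by (simp add: \<theta>_def flip: odd_step_minus)
  have "((\<lambda>t. F (t + pi) + F t) has_real_derivative 0) (at t)" for t
  proof -
    have "((\<lambda>t. F (t + pi)) has_real_derivative \<theta> (t + pi)) (at t)"
      using F(2)[of "t + pi"] by (simp add: DERIV_shift)
    from DERIV_add[OF this F(2)[of t]] show ?thesis by (simp add: half)
  qed
  \<comment> \<open>That F(t + pi) + F(t) is constant, compared at t and t + pi, gives the period 2
    pi.\<close>
  then have const: "F (s + pi) + F s = F (t + pi) + F t" for s t
    using DERIV_isconst_all[of "\<lambda>t. F (t + pi) + F t"] by blast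
  have per: "F (t + 2 * pi) = F t" for t
    using const[of "t + pi" t] by (simp add: algebra_simps)
  have pern: "F (t + 2 * pi * real n) = F t" for t n
  proof (induction n arbitrary: t)
    case (Suc n)
    have "t + 2 * pi * real (Suc n) = (t + 2 * pi) + 2 * pi * real n" by (simp add: algebra_simps)
    then show ?case by (simp only: Suc[of "t + 2 * pi"] per)
  qed simp
  have bound: "\<bar>F t\<bar> \<le> 2 * pi" for t
  proof -
    \<comment> \<open>Reduction to one period starting at 0, where F(0) = 0 and the slope is at most
      1; hence the bound by the length of the period, whatever \<open>e\<close> is.\<close>
    define n where "n = \<lfloor>t / (2 * pi)\<rfloor>"
    define s where "s = t - 2 * pi * of_int n"
    have "of_int n \<le> t / (2 * pi)" "t / (2 * pi) < of_int n + 1" unfolding n_def by linarith+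
    then have s: "0 \<le> s" "s \<le> 2 * pi" using pi_gt_zero by (auto simp: s_def field_simps)
    have "F t = F s"
    proof (cases "n \<ge> 0")
      case True
      then show ?thesis using pern[of s "nat n"] by (simp add: s_def)
    next
      case False
      then show ?thesis using pern[of t "nat (- n)"] by (simp add: s_def)
    qed
    moreover have "norm (F s - F 0) \<le> 1 * norm (s - 0)"
      by (rule field_differentiable_bound[of UNIV F \<theta>]) (use F(2) le in auto)
    ultimately show ?thesis using F(1) s by simp
  qed
  have "\<bar>\<theta> t\<bar> = 1" if "e \<le> \<bar>cos t\<bar>" for t
    unfolding \<theta>_def by (rule odd_step_abs_eq) (use that assms in \<open>simp add: abs_mult field_simps\<close>)
  then show ?thesis using smF F(2) bound le by blast
qed

lemma decseq_small_measure:
  fixes A :: "nat \<Rightarrow> 'a::euclidean_space set"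
  assumes "\<And>m. A m \<in> sets lebesgue" "decseq A" "bounded (A 0)" "negligible (\<Inter>m. A m)" "0 < (\<eta> :: real)"
  shows "\<exists>m. measure lebesgue (A m) < \<eta>"
proof -
  have "A m \<in> lmeasurable" for m
    using assms(1,3) decseqD[OF assms(2), of 0 m] by (intro bounded_set_imp_lmeasurable) (auto intro: bounded_subset)
  then have "(\<lambda>m. measure lebesgue (A m)) \<longlonglongrightarrow> measure lebesgue (\<Inter>m. A m)"
    using assms(1,2) fmeasurableD2[of _ lebesgue]
    by (intro Lim_measure_decseq) (auto simp only: image_subset_iff infinity_ennreal_def)
  moreover have "measure lebesgue (\<Inter>m. A m) = 0" using assms(4) by (rule negligible_imp_measure0)
  ultimately have "eventually (\<lambda>m. measure lebesgue (A m) < \<eta>) sequentially"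
    using assms(5) by (intro order_tendstoD) auto
  then show ?thesis by (auto simp: eventually_sequentially)
qed

lemma negligible_cos_zero: "negligible {x :: 'a::euclidean_space. cos (a \<bullet> x) = 0}"
proof -
  have "{x :: 'a. cos (a \<bullet> x) = 0} \<subseteq> (\<Union>i\<in>{i :: int. odd i}. {x. a \<bullet> x = of_int i * (pi / 2)})"
    by (auto simp: cos_zero_iff_int)
  \<comment> \<open>For \<open>a = 0\<close> the set is empty, because \<open>i\<close> is odd;
    otherwise it is a hyperplane.\<close>
  moreover have "negligible {x. a \<bullet> x = of_int i * (pi / 2)}" if "odd i" for i :: int
    by (rule negligible_hyperplane) (use that in auto)
  then have "negligible (\<Union>i\<in>{i :: int. odd i}. {x. a \<bullet> x = of_int i * (pi / 2)})"
    by (intro negligible_countable_Union) (blast intro: countable_image countableI_type)+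
  ultimately show ?thesis by (rule negligible_subset[rotated])
qed

text \<open>A function with gradient \<open>\<plusminus> a\<close> outside a small set: a fine zigzag in the direction of \<open>a\<close>, cut off
  near the boundary. The frequency \<open>N\<close> is chosen after the cut-off function, the smoothing parameter \<open>e\<close> last.\<close>

lemma ex_laminate:
  fixes a :: "real ^ 'n::finite"
  defines "\<Omega> \<equiv> box 0 (1 :: real ^ 'n)"
  assumes "0 < \<eta>"
  shows "\<exists>u S. u \<in> test_functions \<Omega> \<and> S \<in> sets lebesgue \<and> S \<subseteq> \<Omega> \<and> measure lebesgue S \<le> \<eta> \<and>
     (\<forall>x j. \<bar>partial j u x\<bar> \<le> \<bar>a $ j\<bar> + 1) \<and>
     (\<forall>x\<in>\<Omega> - S. (\<forall>j. partial j u x = a $ j) \<or> (\<forall>j. partial j u x = - a $ j))"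
proof -
  \<comment> \<open>Inner boxes that exhaust the unit box; on one of them the cut-off function will
    be 1.\<close>
  define I where "I m = {x :: real ^ 'n. \<forall>i. 1 / real (Suc m) < x $ i \<and> x $ i < 1 - 1 / real (Suc m)}" for m
  have openI: "open (I m)" for m
  proof -
    have "I m = box (\<chi> i. 1 / real (Suc m)) (\<chi> i. 1 - 1 / real (Suc m))" by (auto simp: I_def mem_box_cart)
    then show ?thesis by (simp only: open_box)
  qed
  have I\<Omega>: "I m \<subseteq> \<Omega>" for m
  proof
    fix x assume "x \<in> I m"
    then have "1 / real (Suc m) < x $ i \<and> x $ i < 1 - 1 / real (Suc m)" for i by (simp add: I_def)
    moreover have "0 < 1 / real (Suc m)" by simp
    ultimately have "0 < x $ i \<and> x $ i < 1" for i by (metis diff_gt_0_iff_gt less_trans diff_less_eq less_add_same_cancel1)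
    then show "x \<in> \<Omega>" by (simp add: \<Omega>_def mem_box_cart)
  qed
  have \<Omega>: "open \<Omega>" "bounded \<Omega>" unfolding \<Omega>_def by (rule open_box, rule bounded_box)
  have "\<exists>m. measure lebesgue (\<Omega> - I m) < \<eta> / 2"
  proof (rule decseq_small_measure)
    show "\<Omega> - I m \<in> sets lebesgue" for m using \<Omega>(1) openI by (intro sets.Diff lebesgue_open)
    have mono: "I m \<subseteq> I n" if "m \<le> n" for m n
    proof
      fix x assume x: "x \<in> I m"
      have "1 / real (Suc n) \<le> 1 / real (Suc m)" using that by (simp add: field_simps)
      then show "x \<in> I n" using x unfolding I_def by (auto intro: le_less_trans less_le_trans)
    qed
    then show "decseq (\<lambda>m. \<Omega> - I m)" by (auto simp: decseq_def)
    show "bounded (\<Omega> - I 0)" using \<Omega>(2) by (rule bounded_subset) auto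
    have "(\<Inter>m. \<Omega> - I m) = {}"
    proof -
      have "\<exists>m. x \<in> I m" if x: "x \<in> \<Omega>" for x
      proof -
        have "0 < x $ i \<and> x $ i < 1" for i using x by (simp add: \<Omega>_def mem_box_cart)
        then have "\<forall>i. \<exists>m. 1 / real (Suc m) < x $ i \<and> x $ i < 1 - 1 / real (Suc m)"
        proof (intro allI)
          fix i
          have "0 < min (x $ i) (1 - x $ i)" using \<open>\<And>i. 0 < x $ i \<and> x $ i < 1\<close>[of i] by simp
          then obtain m where "inverse (real (Suc m)) < min (x $ i) (1 - x $ i)" using reals_Archimedean by blast
          then show "\<exists>m. 1 / real (Suc m) < x $ i \<and> x $ i < 1 - 1 / real (Suc m)"
            by (intro exI[of _ m]) (simp add: inverse_eq_divide)
        qed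
        then obtain M where M: "\<And>i. 1 / real (Suc (M i)) < x $ i \<and> x $ i < 1 - 1 / real (Suc (M i))" by metis
        have "x \<in> I (Max (range M))"
          unfolding I_def
        proof (intro CollectI allI)
          fix i
          have "1 / real (Suc (Max (range M))) \<le> 1 / real (Suc (M i))"
            by (intro divide_left_mono) (auto intro!: Max_ge)
          then show "1 / real (Suc (Max (range M))) < x $ i \<and> x $ i < 1 - 1 / real (Suc (Max (range M)))"
            using M[of i] by linarith
        qed
        then show ?thesis by blast
      qed
      then show ?thesis by blast
    qed
    then show "negligible (\<Inter>m. \<Omega> - I m)" by simp
  qed (use assms in simp)
  then obtain m where m: "measure lebesgue (\<Omega> - I m) < \<eta> / 2" by blast
  \<comment> \<open>Half of the margin of \<open>I m\<close>: one half keeps the support inside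
    \<open>\<Omega>\<close>, the other one is the transition layer of the cut-off.\<close>
  define \<delta> where "\<delta> = 1 / (2 * real (Suc m))"
  have \<delta>: "0 < \<delta>" "\<delta> + \<delta> = 1 / real (Suc m)" "1 / (1 / \<delta>) = \<delta>" "0 < 1 / \<delta>"
    unfolding \<delta>_def by (simp_all del: of_nat_Suc)
  define \<psi> where "\<psi> = box_cutoff (\<chi> i. \<delta>) (\<chi> i. 1 - \<delta> :: real ^ 'n) (1 / \<delta>)"
  have sm\<psi>: "smooth \<psi>" unfolding \<psi>_def by (rule smooth_box_cutoff)
  have \<psi>1: "\<psi> x = 1" if "x \<in> I m" for x
    unfolding \<psi>_def
  proof (rule box_cutoff_eq_1[OF \<delta>(4)])
    fix i
    have "1 / real (Suc m) < x $ i \<and> x $ i < 1 - 1 / real (Suc m)" using that by (simp add: I_def)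
    then show "(\<chi> i. \<delta>) $ i + 1 / (1 / \<delta>) \<le> x $ i" "x $ i \<le> (\<chi> i. 1 - \<delta>) $ i - 1 / (1 / \<delta>)"
      unfolding \<delta>(3) using \<delta>(2) by simp_all
  qed
  have d\<psi>: "partial j \<psi> x = 0" if "x \<in> I m" for x j
  proof -
    have "(\<psi> has_derivative (\<lambda>_. 0)) (at x)"
      by (rule has_derivative_transform_within_open[of "\<lambda>_. 1" _ _ _ "I m"]) (use that openI \<psi>1 in auto)
    then show ?thesis by (simp add: partial_eqI)
  qed
  have test\<psi>: "\<psi> \<in> test_functions \<Omega>"
    unfolding \<psi>_def
  proof (rule box_cutoff_test[OF \<delta>(4)], rule subsetI)
    fix x :: "real ^ 'n" assume "x \<in> cbox (\<chi> i. \<delta>) (\<chi> i. 1 - \<delta>)"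
    then have "\<delta> \<le> x $ i \<and> x $ i \<le> 1 - \<delta>" for i by (simp add: mem_box_cart)
    then have "0 < x $ i \<and> x $ i < 1" for i using \<delta>(1) by (smt (verit))
    then show "x \<in> \<Omega>" by (simp add: \<Omega>_def mem_box_cart)
  qed
  have "\<exists>C\<ge>0. \<forall>x. norm (partial j \<psi> x) \<le> C" for j
    by (rule test_functions_bounded[OF test_functions_partial[OF test\<psi>]])
  then obtain C where C: "\<And>j. 0 \<le> C j" "\<And>j x. norm (partial j \<psi> x) \<le> C j" by metis
  define B where "B = (\<Sum>j\<in>UNIV. C j)"
  have B: "0 \<le> B" "\<bar>partial j \<psi> x\<bar> \<le> B" for j x
  proof -
    show "0 \<le> B" unfolding B_def by (intro sum_nonneg C)
    have "C j \<le> B" unfolding B_def using C(1) by (intro member_le_sum) auto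
    then show "\<bar>partial j \<psi> x\<bar> \<le> B" using C(2)[of j x] by simp
  qed
  \<comment> \<open>Dividing by \<open>N\<close> brings the product of the zigzag, bounded by
    \<open>2 * pi\<close>, with the derivative of the cut-off, bounded by \<open>B\<close>, below 1.
    As the bound \<open>2 * pi\<close> does not involve the smoothing, \<open>N\<close> can be fixed
    before it; the summand 1 keeps \<open>N\<close> positive.\<close>
  define N where "N = 2 * pi * B + 1"
  have N: "0 < N" "2 * pi * B \<le> N" using B(1) pi_gt_zero by (auto simp: N_def intro!: add_nonneg_pos mult_nonneg_nonneg)
  \<comment> \<open>Neighbourhoods of the hyperplanes where the zigzag turns; they shrink to a null
    set.\<close>
  define Z where "Z q = {x \<in> \<Omega>. \<bar>cos ((N *\<^sub>R a) \<bullet> x)\<bar> < 1 / real (Suc q)}" for q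
  have openZ: "open (Z q)" for q
  proof -
    have "open {x. \<bar>cos ((N *\<^sub>R a) \<bullet> x)\<bar> < 1 / real (Suc q)}"
      by (intro open_Collect_less continuous_intros)
    then have "open (\<Omega> \<inter> {x. \<bar>cos ((N *\<^sub>R a) \<bullet> x)\<bar> < 1 / real (Suc q)})" using \<Omega>(1) by (rule open_Int[rotated])
    moreover have "Z q = \<Omega> \<inter> {x. \<bar>cos ((N *\<^sub>R a) \<bullet> x)\<bar> < 1 / real (Suc q)}" by (auto simp: Z_def)
    ultimately show ?thesis by (simp only:)
  qed
  have "\<exists>q. measure lebesgue (Z q) < \<eta> / 2"
  proof (rule decseq_small_measure)
    show "Z q \<in> sets lebesgue" for q using openZ by (rule lebesgue_open)
    have "Z r \<subseteq> Z q" if "q \<le> r" for q r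
    proof -
      have "1 / real (Suc r) \<le> 1 / real (Suc q)" using that by (simp add: field_simps)
      then show ?thesis by (auto simp: Z_def simp del: of_nat_Suc)
    qed
    then show "decseq Z" by (auto simp: decseq_def)
    show "bounded (Z 0)" using \<Omega>(2) by (rule bounded_subset) (auto simp: Z_def)
    have "(\<Inter>q. Z q) \<subseteq> {x. cos ((N *\<^sub>R a) \<bullet> x) = 0}"
    proof
      fix x assume x: "x \<in> (\<Inter>q. Z q)"
      have "\<not> 0 < \<bar>cos ((N *\<^sub>R a) \<bullet> x)\<bar>"
      proof
        assume "0 < \<bar>cos ((N *\<^sub>R a) \<bullet> x)\<bar>"
        then obtain q where "inverse (real (Suc q)) < \<bar>cos ((N *\<^sub>R a) \<bullet> x)\<bar>" using reals_Archimedean by blast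
        moreover have "x \<in> Z q" using x by blast
        ultimately show False unfolding Z_def inverse_eq_divide mem_Collect_eq by linarith
      qed
      then show "x \<in> {x. cos ((N *\<^sub>R a) \<bullet> x) = 0}" by simp
    qed
    then show "negligible (\<Inter>q. Z q)" by (rule negligible_subset[OF negligible_cos_zero])
  qed (use assms in simp)
  then obtain q where q: "measure lebesgue (Z q) < \<eta> / 2" by blast
  have "0 < 1 / real (Suc q)" by simp
  from ex_zigzag[OF this] obtain F \<theta> where F: "\<And>r. sm1 r F" "\<And>t. (F has_real_derivative \<theta> t) (at t)"
    "\<And>t. \<bar>F t\<bar> \<le> 2 * pi" "\<And>t. \<bar>\<theta> t\<bar> \<le> 1" "\<And>t. 1 / real (Suc q) \<le> \<bar>cos t\<bar> \<Longrightarrow> \<bar>\<theta> t\<bar> = 1" by blast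
  define h where "h x = F ((N *\<^sub>R a) \<bullet> x)" for x
  have smh: "smooth h" unfolding h_def[abs_def] by (rule smooth_ridge[OF F(1)])
  have dh: "partial j h x = \<theta> ((N *\<^sub>R a) \<bullet> x) * (N * a $ j)" for j x
    unfolding h_def[abs_def] using partial_ridge[OF F(2), of j "N *\<^sub>R a" x] by simp
  \<comment> \<open>Amplitude \<open>1 / N\<close> against frequency \<open>N\<close>: the slope
    along \<open>a\<close> is unchanged while the function itself becomes small.\<close>
  define u where "u x = inverse N *\<^sub>R (\<psi> x * h x)" for x
  have u: "u \<in> test_functions \<Omega>"
    unfolding u_def[abs_def]
    by (intro test_functions_linear[OF bounded_linear_scaleR_right] test_functions_bilinear[OF test\<psi> smh bounded_bilinear_mult])
  have du: "partial j u x = \<psi> x * \<theta> ((N *\<^sub>R a) \<bullet> x) * a $ j + inverse N * (partial j \<psi> x * h x)" for j x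
    unfolding u_def[abs_def]
      partial_linear[OF bounded_linear_scaleR_right smooth_bilinear[OF bounded_bilinear_mult sm\<psi> smh]]
      partial_bilinear[OF bounded_bilinear_mult sm\<psi> smh] dh
    using N(1) by (simp add: field_simps)
  show ?thesis
  proof (intro exI[of _ u] exI[of _ "(\<Omega> - I m) \<union> Z q"] conjI u allI ballI)
    show "(\<Omega> - I m) \<union> Z q \<in> sets lebesgue" using \<Omega>(1) openI openZ by (intro sets.Un sets.Diff lebesgue_open)
    show "(\<Omega> - I m) \<union> Z q \<subseteq> \<Omega>" by (auto simp: Z_def)
    have "measure lebesgue ((\<Omega> - I m) \<union> Z q) \<le> measure lebesgue (\<Omega> - I m) + measure lebesgue (Z q)"
      using \<Omega>(1) openI openZ by (intro measure_Un_le sets.Diff lebesgue_open)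
    then show "measure lebesgue ((\<Omega> - I m) \<union> Z q) \<le> \<eta>" using m q by linarith
  next
    fix x j
    have "\<bar>\<psi> x * \<theta> ((N *\<^sub>R a) \<bullet> x)\<bar> \<le> 1 * 1"
      unfolding abs_mult using F(4) by (intro mult_mono) (auto simp: \<psi>_def box_cutoff_bounds abs_of_nonneg)
    then have "\<bar>\<psi> x * \<theta> ((N *\<^sub>R a) \<bullet> x) * a $ j\<bar> \<le> 1 * \<bar>a $ j\<bar>"
      unfolding abs_mult[of _ "a $ j"] by (intro mult_right_mono) auto
    moreover have "\<bar>inverse N * (partial j \<psi> x * h x)\<bar> \<le> 1"
    proof -
      have "\<bar>partial j \<psi> x * h x\<bar> \<le> B * (2 * pi)"
        unfolding abs_mult h_def using B F(3) by (intro mult_mono) auto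
      then have "\<bar>partial j \<psi> x * h x\<bar> \<le> N" using N(2) by (simp add: mult_ac)
      then show ?thesis using N(1) by (simp add: abs_mult field_simps)
    qed
    ultimately show "\<bar>partial j u x\<bar> \<le> \<bar>a $ j\<bar> + 1" unfolding du by linarith
  next
    fix x assume x: "x \<in> \<Omega> - ((\<Omega> - I m) \<union> Z q)"
    then have "x \<in> I m" "1 / real (Suc q) \<le> \<bar>cos ((N *\<^sub>R a) \<bullet> x)\<bar>" by (auto simp: Z_def)
    then have "\<bar>\<theta> ((N *\<^sub>R a) \<bullet> x)\<bar> = 1" "\<And>j. partial j u x = \<theta> ((N *\<^sub>R a) \<bullet> x) * a $ j"
      using F(5) by (simp_all add: du \<psi>1 d\<psi>)
    then show "(\<forall>j. partial j u x = a $ j) \<or> (\<forall>j. partial j u x = - a $ j)"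
      by (auto simp: abs_if split: if_splits)
  qed
qed

text \<open>After subtraction of the chord through 0 and 1 the function is additive and vanishes at
  the integers, hence is bounded on the whole line; an additive bounded function is zero, since its
  multiples stay bounded.\<close>

lemma jensen_bounded_imp_affine:
  fixes g :: "real \<Rightarrow> real"
  assumes jensen: "\<And>s t. g (s + t) + g (s - t) = 2 * g s"
    and bounded: "\<And>t. 0 \<le> t \<Longrightarrow> t \<le> 1 \<Longrightarrow> \<bar>g t\<bar> \<le> C"
  shows "g t = g 0 + (g 1 - g 0) * t"
proof -
  define M where "M t = g t - g 0 - t * (g 1 - g 0)" for t
  have add: "M (x + y) = M x + M y" for x y
  proof -
    have e: "(x + y) / 2 + (x - y) / 2 = x" "(x + y) / 2 - (x - y) / 2 = y" "(x + y) / 2 + (x + y) / 2 = x + y"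
      by (simp_all add: field_simps)
    have "g x + g y = g (x + y) + g 0"
      using jensen[of "(x + y) / 2" "(x - y) / 2"] jensen[of "(x + y) / 2" "(x + y) / 2"] unfolding e by simp
    then show ?thesis by (simp add: M_def algebra_simps)
  qed
  have 0: "M 0 = 0" "M 1 = 0" by (simp_all add: M_def)
  have nat: "M (real n * x) = real n * M x" for n x
    by (induction n) (simp_all add: 0 distrib_right add)
  have neg: "M (- x) = - M x" for x using add[of x "- x"] 0 by simp
  have int: "M (of_int i) = 0" for i :: int
  proof (cases "i \<ge> 0")
    case True
    then show ?thesis using nat[of "nat i" 1] 0 by simp
  next
    case False
    then show ?thesis using nat[of "nat (- i)" 1] neg[of "of_int i"] 0 by simp
  qed
  have C: "0 \<le> C" using bounded[of 0] by simp
  \<comment> \<open>On the fractional part, \<open>g\<close> and \<open>g 0\<close> contribute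
    \<open>C\<close> each and the slope of the chord \<open>2 * C\<close>.\<close>
  have bd: "\<bar>M x\<bar> \<le> 4 * C" for x
  proof -
    let ?y = "x - of_int \<lfloor>x\<rfloor>"
    have y: "0 \<le> ?y" "?y \<le> 1" by linarith+
    have "M x = M ?y" using add[of ?y "of_int \<lfloor>x\<rfloor>"] int by simp
    moreover have "\<bar>?y * (g 1 - g 0)\<bar> \<le> 1 * (C + C)"
      unfolding abs_mult using y bounded[of 0] bounded[of 1] by (intro mult_mono) auto
    ultimately show ?thesis using bounded[OF y] bounded[of 0] unfolding M_def by simp
  qed
  have "M t = 0"
  proof (rule ccontr)
    assume "M t \<noteq> 0"
    then obtain n where "4 * C < real n * \<bar>M t\<bar>" using reals_Archimedean3[of "\<bar>M t\<bar>"] by auto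
    then show False using bd[of "real n * t"] by (simp add: nat abs_mult)
  qed
  then show ?thesis by (simp add: M_def mult.commute)
qed

section \<open>Quasiaffine functions are one affine\<close>

lemma locally_bounded_imp_bounded_compact:
  fixes f :: "'a::topological_space \<Rightarrow> real"
  assumes "compact K" "K \<subseteq> V" "\<And>x. x \<in> V \<Longrightarrow> \<exists>U. open U \<and> x \<in> U \<and> bounded (f ` (U \<inter> V))"
  shows "\<exists>C\<ge>0. \<forall>x\<in>K. \<bar>f x\<bar> \<le> C"
proof -
  have "\<forall>x\<in>K. \<exists>U. open U \<and> x \<in> U \<and> bounded (f ` (U \<inter> V))"
    using assms(3)[OF subsetD[OF assms(2)]] by (rule ballI)
  from bchoice[OF this] obtain U where U: "\<forall>x\<in>K. open (U x) \<and> x \<in> U x \<and> bounded (f ` (U x \<inter> V))" ..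
  then have op: "open (U x)" if "x \<in> K" for x using that by simp
  have cov: "K \<subseteq> (\<Union>x\<in>K. U x)" using U by auto
  obtain D where D: "D \<subseteq> K" "finite D" "K \<subseteq> (\<Union>x\<in>D. U x)"
    by (rule compactE_image[OF assms(1) op cov])
  have "bounded (\<Union>x\<in>D. f ` (U x \<inter> V))" using D U by (intro bounded_UN) auto
  then obtain C where "\<forall>y\<in>(\<Union>x\<in>D. f ` (U x \<inter> V)). \<bar>y\<bar> \<le> C" by (auto simp: bounded_iff)
  then have "\<bar>f x\<bar> \<le> max 0 C" if "x \<in> K" for x 
  proof -
    obtain d where "d \<in> D" "x \<in> U d" using \<open>x \<in> K\<close> D(3) by blast
    then have "f x \<in> (\<Union>x\<in>D. f ` (U x \<inter> V))" using \<open>x \<in> K\<close> assms(2) by blast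
    then have "\<bar>f x\<bar> \<le> C" using \<open>\<forall>y\<in>(\<Union>x\<in>D. f ` (U x \<inter> V)). \<bar>y\<bar> \<le> C\<close> by blast
    then show ?thesis by simp
  qed
  then show ?thesis by (intro exI[of _ "max 0 C"]) auto
qed

lemma closed_Lambda_prod: "closed (Lambda_prod k :: ('n::finite form ^ 'm::finite) set)"
  by (rule closed_subspace[OF subspace_Lambda_prod])

lemma ext_deriv_scaleR: "ext_deriv (\<lambda>j x. u j x *\<^sub>R \<beta>) x = (\<Sum>j\<in>UNIV. u j x *\<^sub>R (dx j \<and>\<^sub>\<Lambda> \<beta>))"
  by (simp add: ext_deriv_def wedge.scaleR_right)

lemma ext_quasiaffineD:
  fixes \<Omega> :: "(real ^ 'n::finite) set" and f :: "'n form ^ 'm::finite \<Rightarrow> real"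
  assumes "ext_quasiaffine k f" "open \<Omega>" "bounded \<Omega>" "\<Omega> \<noteq> {}" "\<xi> \<in> Lambda_prod k"
    and \<omega>: "\<And>i. \<omega> i \<in> W1_infty_zero \<Omega>" "\<And>i. \<forall>x\<in>\<Omega>. \<omega> i x \<in> Lambda (k i - 1)"
      "\<And>i j. weak_partial \<Omega> j (\<omega> i) (D i j)"
  shows "1 / measure lebesgue \<Omega> * (\<integral>x. f (\<chi> i. \<xi> $ i + ext_deriv (D i) x) \<partial>lebesgue_on \<Omega>) = f \<xi>"
proof -
  from assms(1) have "\<forall>\<Omega> :: (real ^ 'n) set. open \<Omega> \<longrightarrow> bounded \<Omega> \<longrightarrow> \<Omega> \<noteq> {} \<longrightarrow>
        (\<forall>\<xi>\<in>Lambda_prod k. \<forall>\<omega> D.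
           (\<forall>i. \<omega> i \<in> W1_infty_zero \<Omega> \<and> (\<forall>x\<in>\<Omega>. \<omega> i x \<in> Lambda (k i - 1)) \<and>
                (\<forall>j. weak_partial \<Omega> j (\<omega> i) (D i j))) \<longrightarrow>
           1 / measure lebesgue \<Omega> *
             (\<integral>x. f (\<chi> i. \<xi> $ i + ext_deriv (D i) x) \<partial>lebesgue_on \<Omega>) = f \<xi>)"
    unfolding ext_quasiaffine_def by (elim conjE)
  from this[THEN spec, THEN mp, OF assms(2), THEN mp, OF assms(3), THEN mp, OF assms(4), THEN bspec, OF assms(5),
      THEN spec, THEN spec, THEN mp, of \<omega> D]
  show ?thesis using \<omega> by (simp del: One_nat_def)
qed

lemma ext_quasiaffine_local:
  assumes "ext_quasiaffine k f"
  shows "f \<in> borel_measurable (restrict_space borel (Lambda_prod k))"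
    "\<forall>\<xi>\<in>Lambda_prod k. \<exists>U. open U \<and> \<xi> \<in> U \<and> bounded (f ` (U \<inter> Lambda_prod k))"
  by (rule assms[unfolded ext_quasiaffine_def, THEN conjunct1],
      rule assms[unfolded ext_quasiaffine_def, THEN conjunct2, THEN conjunct1])

text \<open>With \<omega>_i = u \<beta>_i for a function u as in \<open>ex_laminate\<close>, the
  argument of \<open>f\<close> is \<open>\<xi> + v\<close> or \<open>\<xi> - v\<close> outside a
  small set. After the correction by a null integral the integrand is there the mean of the two
  values, so quasiaffinity gives f(\<xi>) up to an error of the order of that small set.\<close>

lemma quasiaffine_jensen:
  fixes f :: "'n::finite form ^ 'm::finite \<Rightarrow> real"
  assumes k: "\<forall>i. 1 \<le> k i" and f: "ext_quasiaffine k f"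
    and \<xi>: "\<xi> \<in> Lambda_prod k" and v: "v \<in> wedge_dirs k"
  shows "f (\<xi> + v) + f (\<xi> - v) = 2 * f \<xi>"
proof -
  let ?V = "Lambda_prod k :: ('n form ^ 'm) set"
  obtain a0 \<beta> where a0: "a0 \<in> Lambda 1" and \<beta>: "\<beta> \<in> Lambda_prod (\<lambda>i. k i - 1)" and v0: "v = (\<chi> i. a0 \<and>\<^sub>\<Lambda> \<beta> $ i)"
    using v unfolding wedge_dirs_def by blast
  define a where "a = (\<chi> i. form_app a0 [axis i 1])"
  have a0a: "a0 = covec a" unfolding a_def by (rule Lambda_1_covec[OF a0])
  define G where "G j = (\<chi> i. dx j \<and>\<^sub>\<Lambda> \<beta> $ i)" for j
  have G: "G j \<in> ?V" for j
    unfolding G_def using dx_Lambda \<beta> by (intro subsetD[OF wedge_dirs_subset[OF k]]) (auto simp: wedge_dirs_def)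
  have vG: "v = (\<Sum>j\<in>UNIV. a $ j *\<^sub>R G j)"
    by (simp add: v0 a0a covec_def G_def vec_eq_iff wedge.sum_left wedge.scaleR_left)
  show ?thesis
  proof (cases "a = 0")
    case True
    then show ?thesis by (simp add: vG)
  next
    case False
    \<comment> \<open>One nonzero coordinate is enough to tell the two gradients \<open>a\<close>
      and \<open>- a\<close> apart.\<close>
    then obtain l where l: "a $ l \<noteq> 0" by (auto simp: vec_eq_iff)
    define \<Omega> where "\<Omega> = box 0 (1 :: real ^ 'n)"
    have \<Omega>: "open \<Omega>" "bounded \<Omega>" unfolding \<Omega>_def by (rule open_box, rule bounded_box)
    have "(\<chi> i. 1 / 2) \<in> \<Omega>" by (simp add: \<Omega>_def mem_box_cart)
    then have ne: "\<Omega> \<noteq> {}" by blast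
    note L = lebesgue_open[OF \<Omega>(1)]
    let ?M = "lebesgue_on \<Omega>" and ?\<mu> = "measure lebesgue \<Omega>"
    have \<mu>: "?\<mu> > 0" by (rule measure_open_pos[OF \<Omega> ne])
    \<comment> \<open>The bounds on the gradient of the zigzag confine the argument of
      \<open>f\<close> to this ball, whatever the size of the exceptional set.\<close>
    define R where "R = norm \<xi> + (\<Sum>j\<in>UNIV. (\<bar>a $ j\<bar> + 1) * norm (G j))"
    have fb: "f \<in> borel_measurable (restrict_space borel ?V)"
      "\<And>\<xi>. \<xi> \<in> ?V \<Longrightarrow> \<exists>U. open U \<and> \<xi> \<in> U \<and> bounded (f ` (U \<inter> ?V))"
      using ext_quasiaffine_local[OF f] by simp_all
    have "compact (?V \<inter> cball 0 R)" by (intro closed_Int_compact closed_Lambda_prod compact_cball)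
    from locally_bounded_imp_bounded_compact[OF this _ fb(2)]
    obtain C where C: "0 \<le> C" "\<And>\<eta>. \<eta> \<in> ?V \<Longrightarrow> norm \<eta> \<le> R \<Longrightarrow> \<bar>f \<eta>\<bar> \<le> C" by auto
    \<comment> \<open>Solves \<open>f (\<xi> + v) - \<kappa> * a $ l = f (\<xi> - v) + \<kappa> * a
      $ l\<close>; the common value is \<open>mid\<close>. The correction
      \<open>\<kappa> * partial l u\<close> has integral zero.\<close>
    define \<kappa> where "\<kappa> = (f (\<xi> + v) - f (\<xi> - v)) / (2 * a $ l)"
    define mid where "mid = (f (\<xi> + v) + f (\<xi> - v)) / 2"
    \<comment> \<open>A bound for the corrected integrand on the exceptional set, independent of its
      measure.\<close>
    define K where "K = C + \<bar>\<kappa>\<bar> * (\<bar>a $ l\<bar> + 1) + \<bar>mid\<bar>"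
    have K: "0 \<le> K" unfolding K_def using C(1) by (auto intro!: add_nonneg_nonneg mult_nonneg_nonneg)
    have est: "\<bar>?\<mu> * f \<xi> - ?\<mu> * mid\<bar> \<le> K * \<eta>" if \<eta>: "0 < \<eta>" for \<eta>
    proof -
      obtain u S where u: "u \<in> test_functions \<Omega>" and S: "S \<in> sets lebesgue" "S \<subseteq> \<Omega>" "measure lebesgue S \<le> \<eta>"
        and le: "\<And>x j. \<bar>partial j u x\<bar> \<le> \<bar>a $ j\<bar> + 1"
        and eq: "\<And>x. x \<in> \<Omega> - S \<Longrightarrow> (\<forall>j. partial j u x = a $ j) \<or> (\<forall>j. partial j u x = - a $ j)"
        using ex_laminate[OF \<eta>, of a] unfolding \<Omega>_def by blast
      note smu = test_functionsD(1)[OF u]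
      define y where "y x = \<xi> + (\<Sum>j\<in>UNIV. partial j u x *\<^sub>R G j)" for x
      have yV: "y x \<in> ?V" for x
        unfolding y_def using \<xi> G by (intro subspace_add subspace_sum subspace_scale subspace_Lambda_prod)
      have yR: "norm (y x) \<le> R" for x
      proof -
        have "norm (\<Sum>j\<in>UNIV. partial j u x *\<^sub>R G j) \<le> (\<Sum>j\<in>UNIV. (\<bar>a $ j\<bar> + 1) * norm (G j))"
          by (rule sum_norm_le) (use le in \<open>auto intro!: mult_right_mono\<close>)
        then show ?thesis unfolding y_def R_def using norm_triangle_ineq[of \<xi> "\<Sum>j\<in>UNIV. partial j u x *\<^sub>R G j"] by linarith
      qed
      have conty: "continuous_on UNIV y"
        unfolding y_def[abs_def] by (intro continuous_intros smooth_continuous smooth_partial smu)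
      \<comment> \<open>\<open>f\<close> is known to be measurable on \<open>?V\<close> only, so the
        argument must be measurable as a map into the restricted space.\<close>
      have "y \<in> borel \<rightarrow>\<^sub>M restrict_space borel ?V"
        using conty yV by (intro measurable_restrict_space2 borel_measurable_continuous_onI) auto
      then have "(\<lambda>x. f (y x)) \<in> borel_measurable borel" using fb(1) by (rule measurable_compose)
      then have fym: "(\<lambda>x. f (y x)) \<in> borel_measurable ?M"
        by (intro measurable_restrict_space1 measurable_completion) simp
      have fyL: "(\<lambda>x. f (y x)) \<in> L_infty \<Omega>"
        by (rule L_inftyI[OF fym, of C]) (use C(2)[OF yV yR] in auto)
      have arg: "(\<chi> i. \<xi> $ i + ext_deriv (\<lambda>j x. partial j u x *\<^sub>R \<beta> $ i) x) = y x" for x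
        by (simp add: vec_eq_iff y_def G_def ext_deriv_scaleR)
      have "1 / ?\<mu> * (\<integral>x. f (\<chi> i. \<xi> $ i + ext_deriv (\<lambda>j x. partial j u x *\<^sub>R \<beta> $ i) x) \<partial>?M) = f \<xi>"
      proof -
        have lin: "bounded_linear (\<lambda>r :: real. r *\<^sub>R \<beta> $ i)" for i by (rule bounded_linear_scaleR_left)
        have t: "(\<lambda>x. u x *\<^sub>R \<beta> $ i) \<in> test_functions \<Omega>" for i by (rule test_functions_linear[OF lin u])
        have "partial j (\<lambda>x. u x *\<^sub>R \<beta> $ i) = (\<lambda>x. partial j u x *\<^sub>R \<beta> $ i)" for i j
          by (rule ext) (rule partial_linear[OF lin smu])
        then have w: "weak_partial \<Omega> j (\<lambda>x. u x *\<^sub>R \<beta> $ i) (\<lambda>x. partial j u x *\<^sub>R \<beta> $ i)" for i j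
          using test_functions_weak_partial[OF t \<Omega>(1), of j i] by simp
        have "\<forall>i. (\<lambda>x. u x *\<^sub>R \<beta> $ i) \<in> W1_infty_zero \<Omega> \<and> (\<forall>x\<in>\<Omega>. u x *\<^sub>R \<beta> $ i \<in> Lambda (k i - 1)) \<and>
          (\<forall>j. weak_partial \<Omega> j (\<lambda>x. u x *\<^sub>R \<beta> $ i) (\<lambda>x. partial j u x *\<^sub>R \<beta> $ i))"
          using test_functions_W1_infty_zero[OF t \<Omega>(1)] w \<beta>
          by (auto simp: Lambda_prod_def intro: subspace_scale subspace_Lambda)
        then show ?thesis
          by (intro ext_quasiaffineD[OF f \<Omega> ne \<xi>, where \<omega> = "\<lambda>i x. u x *\<^sub>R \<beta> $ i"]) blast+
      qed
      then have int1: "(\<integral>x. f (y x) \<partial>?M) = ?\<mu> * f \<xi>"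
        using \<mu> by (simp add: arg field_simps)
      have int2: "(\<integral>x. partial l u x \<partial>?M) = 0" by (rule integral_partial[OF u L])
      have i1: "integrable ?M (\<lambda>x. f (y x))" by (rule L_infty_integrable[OF fyL \<Omega>(1,2)])
      have i2: "integrable ?M (\<lambda>x. \<kappa> * partial l u x)"
        by (intro integrable_mult_right test_functions_integrable_on[OF test_functions_partial[OF u] L])
      interpret finite_measure ?M using \<Omega> by (intro finite_measure_bounded_open)
      have i3: "integrable ?M (\<lambda>x. mid)" by simp
      have "?\<mu> * f \<xi> - ?\<mu> * mid = (\<integral>x. f (y x) - \<kappa> * partial l u x - mid \<partial>?M)"
        using i1 i2 i3 L by (simp add: int1 int2 measure_restrict_space)
      also have "\<bar>\<dots>\<bar> \<le> (\<integral>x. norm (f (y x) - \<kappa> * partial l u x - mid) \<partial>?M)"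
        unfolding real_norm_def[symmetric] by (rule integral_norm_bound)
      also have "\<dots> \<le> (\<integral>x. K * indicator S x \<partial>?M)"
      proof (rule integral_mono)
        show "integrable ?M (\<lambda>x. norm (f (y x) - \<kappa> * partial l u x - mid))"
          by (intro integrable_norm Bochner_Integration.integrable_diff i1 i2 i3)
        have "S \<in> sets ?M" using S(1,2) L by (auto simp: sets_restrict_space_iff)
        then show "integrable ?M (\<lambda>x. K * indicator S x)"
          by (intro integrable_mult_right integrable_real_indicator) (simp_all add: emeasure_finite less_top[symmetric])
        fix x assume "x \<in> space ?M"
        then have x: "x \<in> \<Omega>" by simp
        show "norm (f (y x) - \<kappa> * partial l u x - mid) \<le> K * indicator S x"
        proof (cases "x \<in> S")
          case True
          have "\<bar>\<kappa> * partial l u x\<bar> \<le> \<bar>\<kappa>\<bar> * (\<bar>a $ l\<bar> + 1)"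
            unfolding abs_mult using le by (intro mult_left_mono) auto
          then have "\<bar>f (y x) - \<kappa> * partial l u x - mid\<bar> \<le> K"
            using C(2)[OF yV[of x] yR[of x]] unfolding K_def by linarith
          then show ?thesis using True by simp
        next
          case False
          then have "(\<forall>j. partial j u x = a $ j) \<or> (\<forall>j. partial j u x = - a $ j)" using eq x by blast
          then have "f (y x) - \<kappa> * partial l u x - mid = 0"
          proof
            assume p: "\<forall>j. partial j u x = a $ j"
            then have yx: "y x = \<xi> + v" by (simp add: y_def vG)
            show ?thesis unfolding yx using p l by (simp add: \<kappa>_def mid_def field_simps)
          next
            assume p: "\<forall>j. partial j u x = - a $ j"
            then have yx: "y x = \<xi> - v" by (simp add: y_def vG sum_negf)
            show ?thesis unfolding yx using p l by (simp add: \<kappa>_def mid_def field_simps)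
          qed
          then show ?thesis using False by simp
        qed
      qed
      also have "\<dots> = K * measure lebesgue S"
        using S(1,2) L by (simp add: sets_restrict_space_iff measure_restrict_space inf.absorb1)
      also have "\<dots> \<le> K * \<eta>" using S(3) K by (intro mult_left_mono)
      finally show ?thesis .
    qed
    have "\<bar>?\<mu> * f \<xi> - ?\<mu> * mid\<bar> \<le> 0"
    proof (rule field_le_epsilon)
      fix e :: real assume "0 < e"
      \<comment> \<open>Dividing by \<open>K + 1\<close> instead of \<open>K\<close> covers the case
        \<open>K = 0\<close>.\<close>
      then have "\<bar>?\<mu> * f \<xi> - ?\<mu> * mid\<bar> \<le> K * (e / (K + 1))" using K by (intro est) auto
      also have "\<dots> \<le> e" using K \<open>0 < e\<close> by (simp add: field_simps)
      finally show "\<bar>?\<mu> * f \<xi> - ?\<mu> * mid\<bar> \<le> 0 + e" by simp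
    qed
    then have "f \<xi> = mid" using \<mu> by simp
    then show ?thesis by (simp add: mid_def)
  qed
qed

text \<open>Multiples of a direction are directions, so Jensen's equation holds at every point of
  the line \<open>\<xi> + t *\<^sub>R v\<close>; local boundedness and compactness of the segment
  over [0, 1] supply the bound.\<close>

lemma quasiaffine_imp_one_affine:
  fixes f :: "'n::finite form ^ 'm::finite \<Rightarrow> real"
  assumes k: "\<forall>i. 1 \<le> k i" and f: "ext_quasiaffine k f"
  shows "ext_one_affine k f"
  unfolding ext_one_affine_iff affine_along_def
proof (intro ballI)
  let ?V = "Lambda_prod k :: ('n form ^ 'm) set"
  fix \<xi> v :: "'n form ^ 'm" assume \<xi>: "\<xi> \<in> ?V" and v: "v \<in> wedge_dirs k"
  define g where "g t = f (\<xi> + t *\<^sub>R v)" for t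
  have tv: "t *\<^sub>R v \<in> wedge_dirs k" for t using v wedge_dirs_cone by blast
  then have V: "\<xi> + t *\<^sub>R v \<in> ?V" for t
    using \<xi> wedge_dirs_subset[OF k] by (blast intro: subspace_add subspace_Lambda_prod)
  have jensen: "g (s + t) + g (s - t) = 2 * g s" for s t
    using quasiaffine_jensen[OF k f V[of s] tv[of t]] by (simp add: g_def algebra_simps)
  have "compact ((\<lambda>t. \<xi> + t *\<^sub>R v) ` {0..1})"
    by (intro compact_continuous_image continuous_intros) simp
  moreover have "(\<lambda>t. \<xi> + t *\<^sub>R v) ` {0..1} \<subseteq> ?V" using V by blast
  moreover have "\<exists>U. open U \<and> \<zeta> \<in> U \<and> bounded (f ` (U \<inter> ?V))" if "\<zeta> \<in> ?V" for \<zeta>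
    using ext_quasiaffine_local(2)[OF f] that by simp
  ultimately obtain C where C: "\<forall>\<zeta>\<in>(\<lambda>t. \<xi> + t *\<^sub>R v) ` {0..1}. \<bar>f \<zeta>\<bar> \<le> C"
    using locally_bounded_imp_bounded_compact[of "(\<lambda>t. \<xi> + t *\<^sub>R v) ` {0..1}" ?V f] by blast
  have "\<bar>g t\<bar> \<le> C" if "0 \<le> t" "t \<le> 1" for t using C that by (simp add: g_def)
  from jensen_bounded_imp_affine[OF jensen this] show "\<exists>p q. \<forall>t. f (\<xi> + t *\<^sub>R v) = p + q * t"
    unfolding g_def by blast
qed

theorem theorem3p9:
  fixes k :: "'m::{finite,linorder} \<Rightarrow> nat"
    and f :: "'n::finite form ^ 'm::{finite,linorder} \<Rightarrow> real"
  assumes "\<forall>i. 1 \<le> k i \<and> k i \<le> CARD('n)"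
  shows "(ext_polyaffine k f \<longleftrightarrow> ext_quasiaffine k f) \<and>
         (ext_quasiaffine k f \<longleftrightarrow> ext_one_affine k f) \<and>
         (ext_one_affine k f \<longleftrightarrow>
           (\<exists>c :: ('m \<Rightarrow> nat) \<Rightarrow> 'n form.
              (\<forall>\<alpha>\<in>multiindices CARD('n) k. c \<alpha> \<in> Lambda (wdeg k \<alpha>)) \<and>
              (\<forall>\<xi>\<in>Lambda_prod k.
                 f \<xi> = (\<Sum>\<alpha>\<in>multiindices CARD('n) k. c \<alpha> \<bullet> multi_power \<xi> \<alpha>))))"
proof -
  have k: "\<forall>i. 1 \<le> k i" using assms by blast
  have "ext_polyaffine k f \<longleftrightarrow> power_expansion k f"
    using power_expansion_imp_polyaffine[OF k] polyaffine_imp_power_expansion[OF k] by blast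
  moreover have "power_expansion k f \<Longrightarrow> ext_quasiaffine k f" by (rule power_expansion_imp_quasiaffine[OF k])
  moreover have "ext_quasiaffine k f \<Longrightarrow> ext_one_affine k f" by (rule quasiaffine_imp_one_affine[OF k])
  moreover have "ext_one_affine k f \<Longrightarrow> power_expansion k f"
    unfolding power_expansion_def by (rule one_affine_imp_power_expansion[OF k])
  ultimately show ?thesis unfolding power_expansion_def[symmetric] by blast
qed

end
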